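(* Let $\mathcal{R}\subset\mathbb{R}^3$ be a $\rho$-convex domain, $\mathcal{S}\subset\mathbb{R}^3$ the unit sphere and $\mathcal{E}=(\epsilon_{min},\epsilon_{max})$ a bounded interval. Let $T,S,G_1,G_2,G_3\in W^{1,\infty}(\mathcal{R}\times\mathcal{E})$, $G=(G_1,G_2,G_3)$, and assume there are constants $c_S,c_T>0$ with $c_S\le S(r,\epsilon)$ and $c_T\le T(r,\epsilon)$ for a.e. $r\in\mathcal{R}$, $\epsilon\in\mathcal{E}$. Then for every $q\in L^2(\mathcal{E};L^2(\mathcal{R}\times\mathcal{S}))$ there exists a weak solution $\psi$ of the boundary value problem $$-\partial_\epsilon(S\psi)+s\cdot\nabla_r\psi+G\cdot(s\times\nabla_s\psi)-T\Delta_s\psi=q\quad\text{on }\mathcal{R}\times\mathcal{S}\times\mathcal{E},$$ $$\psi=0\quad\text{on }\Gamma_{in}\times\mathcal{E}\ \text{ and on }\ \mathcal{R}\times\mathcal{S}\times\{\epsilon_{max}\}.$$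
   Context: A domain $\mathcal{R}\subset\mathbb{R}^3$ (nonempty, open, connected) is $\rho$-convex if there is $\rho>0$ such that for every $r\in\partial\mathcal{R}$ there is a closed ball of radius $\rho$ that contains $\mathcal{R}$ and has $r$ on its boundary sphere. In particular $\mathcal{R}$ is bounded and convex with Lipschitz boundary; $n=n(r)$ is the outward unit normal on $\partial\mathcal{R}$. $\nabla_r$ is the gradient in $r\in\mathcal{R}$; $\nabla_s$ and $\Delta_s$ are the surface gradient and the Laplace-Beltrami operator on $\mathcal{S}$. Set $\Gamma=\partial\mathcal{R}\times\mathcal{S}$, $\Gamma_{in}=\{(r,s)\in\Gamma: n(r)\cdot s<0\}$, $\Gamma_{out}=\Gamma\setminus\overline{\Gamma_{in}}$, and $\langle u,v\rangle=\int_{\mathcal{R}\times\mathcal{S}}u\,v\,\mathrm{d}(r,s)$ (with Euclidean product of vector-valued arguments). Weak solution: a function $\psi\in L^\infty(\mathcal{E};L^2(\mathcal{R}\times\mathcal{S}))$ with $\nabla_s\psi\in L^2(\mathcal{E};L^2(\mathcal{R}\times\mathcal{S}))$ such that $$\int_{\mathcal{E}}\langle\psi,S\,\partial_\epsilon v\rangle-\langle\psi,s\cdot\nabla_r v\rangle-\langle\psi,G\cdot(s\times\nabla_s v)\rangle+\langle T\nabla_s\psi,\nabla_s v\rangle\,\mathrm{d}\epsilon=\int_{\mathcal{E}}\langle q,v\rangle\,\mathrm{d}\epsilon$$ for all $v\in C^1(\overline{\mathcal{R}}\times\mathcal{S}\times\overline{\mathcal{E}})$ with $v(\epsilon_{min})=0$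 and $v=0$ on $\Gamma_{out}\times\mathcal{E}$. *)

theory Defs
  imports "HOL-Analysis.Analysis"
begin

subsection \<open>Domains and boundary parts\<close>

text \<open>The condition on boundary points is vacuous for the whole space, the only nonempty open
  connected set with empty boundary; it is excluded so that the domain is bounded and convex.\<close>

definition rho_convex :: "(real^3) set \<Rightarrow> bool" where
  "rho_convex R \<longleftrightarrow>
     R \<noteq> {} \<and> open R \<and> connected R \<and> R \<noteq> UNIV \<and>
     (\<exists>\<rho>>0. \<forall>r\<in>frontier R. \<exists>c. R \<subseteq> cball c \<rho> \<and> r \<in> sphere c \<rho>)"

text \<open>For a convex domain, the boundary is differentiable at \<open>r\<close> exactly if there is only one
  supporting half-space at \<open>r\<close>. The remaining boundary points (edges, vertices) form a null set of
  the boundary, and the normal is undefined there.\<close>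

definition outward_unit_normal :: "(real^3) set \<Rightarrow> (real^3) \<Rightarrow> (real^3) \<Rightarrow> bool" where
  "outward_unit_normal R r n \<longleftrightarrow>
     r \<in> frontier R \<and> {m. norm m = 1 \<and> (\<forall>x\<in>R. m \<bullet> (x - r) \<le> 0)} = {n}"

definition Gamma :: "(real^3) set \<Rightarrow> ((real^3) \<times> (real^3)) set" where
  "Gamma R = frontier R \<times> sphere 0 1"

definition Gamma_in :: "(real^3) set \<Rightarrow> ((real^3) \<times> (real^3)) set" where
  "Gamma_in R = {(r, s) \<in> Gamma R. \<exists>n. outward_unit_normal R r n \<and> n \<bullet> s < 0}"

definition Gamma_out :: "(real^3) set \<Rightarrow> ((real^3) \<times> (real^3)) set" where
  "Gamma_out R = Gamma R - closure (Gamma_in R)"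

subsection \<open>Measures and inner product\<close>

text \<open>Surface measure of the unit sphere as cone measure: a Borel set \<open>A\<close> of directions has
  area three times the volume of \<open>{t *\<^sub>R s | s \<in> A, 0 < t < 1}\<close>.\<close>

definition sphere_measure :: "(real^3) measure" where
  "sphere_measure =
     scale_measure 3
       (distr (restrict_space lborel (ball 0 1 - {0})) (restrict_space borel (sphere 0 1))
         (\<lambda>x. x /\<^sub>R norm x))"

definition phase :: "(real^3) set \<Rightarrow> ((real^3) \<times> (real^3)) measure" where
  "phase R = restrict_space lborel R \<Otimes>\<^sub>M sphere_measure"

definition phase_inner ::
    "(real^3) set \<Rightarrow> ((real^3) \<times> (real^3) \<Rightarrow> 'b) \<Rightarrow> ((real^3) \<times> (real^3) \<Rightarrow> 'b::real_inner) \<Rightarrow> real" where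
  "phase_inner R u w = (LINT x|phase R. u x \<bullet> w x)"

subsection \<open>Bochner spaces of square integrable functions\<close>

text \<open>Elements of \<open>L\<^sup>p(A; L\<^sup>2(M))\<close> are represented by jointly measurable functions. For the
  \<open>\<sigma>\<close>-finite measures used here, for which \<open>L\<^sup>2(M)\<close> is separable, every strongly measurable
  map from \<open>A\<close> to \<open>L\<^sup>2(M)\<close> has such a representative.\<close>

definition L2 :: "'a measure \<Rightarrow> ('a \<Rightarrow> 'b::euclidean_space) set" where
  "L2 M = {f \<in> borel_measurable M. integrable M (\<lambda>x. (norm (f x))\<^sup>2)}"

definition L2_norm :: "'a measure \<Rightarrow> ('a \<Rightarrow> 'b::euclidean_space) \<Rightarrow> real" where
  "L2_norm M f = sqrt (LINT x|M. (norm (f x))\<^sup>2)"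

definition L2_L2 :: "'e measure \<Rightarrow> 'a measure \<Rightarrow> ('e \<Rightarrow> 'a \<Rightarrow> 'b::euclidean_space) set" where
  "L2_L2 A M = {u. case_prod u \<in> borel_measurable (A \<Otimes>\<^sub>M M) \<and>
     (AE e in A. u e \<in> L2 M) \<and> integrable A (\<lambda>e. (L2_norm M (u e))\<^sup>2)}"

definition Linf_L2 :: "'e measure \<Rightarrow> 'a measure \<Rightarrow> ('e \<Rightarrow> 'a \<Rightarrow> 'b::euclidean_space) set" where
  "Linf_L2 A M = {u. case_prod u \<in> borel_measurable (A \<Otimes>\<^sub>M M) \<and>
     (AE e in A. u e \<in> L2 M) \<and> (\<exists>C. AE e in A. L2_norm M (u e) \<le> C)}"

subsection \<open>Smooth functions and Sobolev functions\<close>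

text \<open>Only meaningful for open \<open>U\<close>.\<close>

primrec Ck_on :: "nat \<Rightarrow> 'a::euclidean_space set \<Rightarrow> ('a \<Rightarrow> 'b::real_normed_vector) \<Rightarrow> bool" where
  "Ck_on 0 U f \<longleftrightarrow> continuous_on U f"
| "Ck_on (Suc k) U f \<longleftrightarrow> (\<forall>x\<in>U. f differentiable (at x)) \<and>
     (\<forall>i\<in>Basis. Ck_on k U (\<lambda>x. frechet_derivative f (at x) i))"

definition smooth_on :: "'a::euclidean_space set \<Rightarrow> ('a \<Rightarrow> 'b::real_normed_vector) \<Rightarrow> bool" where
  "smooth_on U f \<longleftrightarrow> (\<forall>k. Ck_on k U f)"

definition test_functions :: "'a::euclidean_space set \<Rightarrow> ('a \<Rightarrow> real) set" where
  "test_functions U = {\<phi>. smooth_on UNIV \<phi> \<and> (\<exists>K. compact K \<and> K \<subseteq> U \<and> (\<forall>x. x \<notin> K \<longrightarrow> \<phi> x = 0))}"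

definition Linf :: "'a::euclidean_space set \<Rightarrow> ('a \<Rightarrow> real) set" where
  "Linf U = {f \<in> borel_measurable (restrict_space lborel U).
     \<exists>C. AE x in restrict_space lborel U. \<bar>f x\<bar> \<le> C}"

definition weak_partial ::
    "'a::euclidean_space set \<Rightarrow> 'a \<Rightarrow> ('a \<Rightarrow> real) \<Rightarrow> ('a \<Rightarrow> real) \<Rightarrow> bool" where
  "weak_partial U i f g \<longleftrightarrow> (\<forall>\<phi>\<in>test_functions U.
     (LINT x|restrict_space lborel U. f x * frechet_derivative \<phi> (at x) i)
     = - (LINT x|restrict_space lborel U. g x * \<phi> x))"

definition W1inf :: "'a::euclidean_space set \<Rightarrow> ('a \<Rightarrow> real) set" where
  "W1inf U = {f \<in> Linf U. \<forall>i\<in>Basis. \<exists>g\<in>Linf U. weak_partial U i f g}"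

text \<open>If \<open>K\<close> is convex with nonempty interior, this is the space of functions that are \<open>C\<^sup>1\<close> in
  the interior and extend with their first derivatives continuously to \<open>K\<close>.\<close>

definition C1_on :: "'a::euclidean_space set \<Rightarrow> ('a \<Rightarrow> real) \<Rightarrow> bool" where
  "C1_on K f \<longleftrightarrow> (\<exists>f'. continuous_on K f' \<and>
     (\<forall>x\<in>K. (f has_derivative blinfun_apply (f' x)) (at x within K)))"

subsection \<open>Calculus on the sphere\<close>

text \<open>Differentiation on the sphere is expressed by the radially constant extension
  \<open>x \<mapsto> f (x / norm x)\<close>: it is differentiable away from the origin iff \<open>f\<close> is differentiable on the
  sphere, and on the sphere its gradient is the surface gradient of \<open>f\<close>, and the divergence of
  the extension of a tangential field is the surface divergence of the field.\<close>

definition gradient :: "('a::real_inner \<Rightarrow> real) \<Rightarrow> 'a \<Rightarrow> 'a" where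
  "gradient f x = (THE D. GDERIV f x :> D)"

definition surf_grad :: "((real^3) \<Rightarrow> real) \<Rightarrow> (real^3) \<Rightarrow> (real^3)" where
  "surf_grad f s = gradient (\<lambda>x. f (x /\<^sub>R norm x)) s"

definition surf_div :: "((real^3) \<Rightarrow> (real^3)) \<Rightarrow> (real^3) \<Rightarrow> real" where
  "surf_div F s = (\<Sum>i\<in>Basis. frechet_derivative (\<lambda>x. F (x /\<^sub>R norm x)) (at s) i \<bullet> i)"

definition radial_ext :: "((real^3) \<times> (real^3) \<times> real \<Rightarrow> 'b) \<Rightarrow> (real^3) \<times> (real^3) \<times> real \<Rightarrow> 'b" where
  "radial_ext v = (\<lambda>(r, x, \<epsilon>). v (r, x /\<^sub>R norm x, \<epsilon>))"

definition tangential_test_fields ::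
    "(real^3) set \<Rightarrow> real set \<Rightarrow> ((real^3) \<times> (real^3) \<times> real \<Rightarrow> (real^3)) set" where
  "tangential_test_fields R E = {\<Phi>.
     smooth_on (UNIV \<times> (- {0}) \<times> UNIV) (radial_ext \<Phi>) \<and>
     (\<exists>K. compact K \<and> K \<subseteq> R \<times> E \<and>
        (\<forall>r \<epsilon>. (r, \<epsilon>) \<notin> K \<longrightarrow> (\<forall>s\<in>sphere 0 1. \<Phi> (r, s, \<epsilon>) = 0))) \<and>
     (\<forall>r \<epsilon>. \<forall>s\<in>sphere 0 1. \<Phi> (r, s, \<epsilon>) \<bullet> s = 0)}"

text \<open>\<open>g\<close> is the surface gradient of \<open>u\<close> in the sense of distributions on \<open>R \<times> sphere 0 1 \<times> E\<close>.\<close>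

definition weak_surf_grad ::
    "(real^3) set \<Rightarrow> real set \<Rightarrow> (real \<Rightarrow> (real^3) \<times> (real^3) \<Rightarrow> real)
      \<Rightarrow> (real \<Rightarrow> (real^3) \<times> (real^3) \<Rightarrow> (real^3)) \<Rightarrow> bool" where
  "weak_surf_grad R E u g \<longleftrightarrow>
     (AE \<epsilon> in restrict_space lborel E. AE (r, s) in phase R. g \<epsilon> (r, s) \<bullet> s = 0) \<and>
     (\<forall>\<Phi>\<in>tangential_test_fields R E.
        (LINT \<epsilon>|restrict_space lborel E.
           phase_inner R (u \<epsilon>) (\<lambda>(r, s). surf_div (\<lambda>s'. \<Phi> (r, s', \<epsilon>)) s))
        = - (LINT \<epsilon>|restrict_space lborel E. phase_inner R (g \<epsilon>) (\<lambda>(r, s). \<Phi> (r, s, \<epsilon>))))"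

subsection \<open>Weak solutions\<close>

definition admissible ::
    "(real^3) set \<Rightarrow> real \<Rightarrow> real \<Rightarrow> ((real^3) \<times> (real^3) \<times> real \<Rightarrow> real) set" where
  "admissible R \<epsilon>min \<epsilon>max = {v.
     C1_on (closure R \<times> (- {0}) \<times> {\<epsilon>min..\<epsilon>max}) (radial_ext v) \<and>
     (\<forall>r\<in>closure R. \<forall>s\<in>sphere 0 1. v (r, s, \<epsilon>min) = 0) \<and>
     (\<forall>(r, s)\<in>Gamma_out R. \<forall>\<epsilon>\<in>{\<epsilon>min<..<\<epsilon>max}. v (r, s, \<epsilon>) = 0)}"

text \<open>The weak gradient \<open>g\<close> is unique up to null sets, so the existential quantifier just names
  \<open>\<nabla>\<^sub>s \<psi>\<close>.\<close>

definition weak_solution ::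
    "(real^3) set \<Rightarrow> real \<Rightarrow> real \<Rightarrow> ((real^3) \<times> real \<Rightarrow> real) \<Rightarrow> ((real^3) \<times> real \<Rightarrow> real)
      \<Rightarrow> ((real^3) \<times> real \<Rightarrow> (real^3)) \<Rightarrow> (real \<Rightarrow> (real^3) \<times> (real^3) \<Rightarrow> real)
      \<Rightarrow> (real \<Rightarrow> (real^3) \<times> (real^3) \<Rightarrow> real) \<Rightarrow> bool" where
  "weak_solution R \<epsilon>min \<epsilon>max T S G q \<psi> \<longleftrightarrow>
     \<psi> \<in> Linf_L2 (restrict_space lborel {\<epsilon>min<..<\<epsilon>max}) (phase R) \<and>
     (\<exists>g \<in> L2_L2 (restrict_space lborel {\<epsilon>min<..<\<epsilon>max}) (phase R).
        weak_surf_grad R {\<epsilon>min<..<\<epsilon>max} \<psi> g \<and>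
        (\<forall>v \<in> admissible R \<epsilon>min \<epsilon>max.
           (LINT \<epsilon>|restrict_space lborel {\<epsilon>min<..<\<epsilon>max}.
                phase_inner R (\<psi> \<epsilon>) (\<lambda>(r, s). S (r, \<epsilon>) * deriv (\<lambda>e. v (r, s, e)) \<epsilon>)
              - phase_inner R (\<psi> \<epsilon>) (\<lambda>(r, s). s \<bullet> gradient (\<lambda>x. v (x, s, \<epsilon>)) r)
              - phase_inner R (\<psi> \<epsilon>)
                  (\<lambda>(r, s). G (r, \<epsilon>) \<bullet> cross3 s (surf_grad (\<lambda>s'. v (r, s', \<epsilon>)) s))
              + phase_inner R (\<lambda>(r, s). T (r, \<epsilon>) *\<^sub>R g \<epsilon> (r, s))
                  (\<lambda>(r, s). surf_grad (\<lambda>s'. v (r, s', \<epsilon>)) s))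
           = (LINT \<epsilon>|restrict_space lborel {\<epsilon>min<..<\<epsilon>max}.
                phase_inner R (q \<epsilon>) (\<lambda>(r, s). v (r, s, \<epsilon>)))))"

end

theory Submission
  imports Defs "HOL-Library.Function_Algebras" "HOL-Computational_Algebra.Polynomial"
begin

text \<open>For an admissible \<open>v\<close> and a tangential field \<open>\<Phi>\<close> put
  \<open>a = S \<partial>\<^sub>\<epsilon>v - s \<bullet> \<nabla>\<^sub>rv - G \<bullet> (s \<times> \<nabla>\<^sub>sv) + div\<^sub>s \<Phi>\<close> and \<open>b = T \<nabla>\<^sub>sv + \<Phi>\<close>. The weak equation together
  with the relation \<open>g = \<nabla>\<^sub>s\<psi>\<close> says that \<open>\<integral>\<psi> a + g \<bullet> b = \<integral>q v\<close> for all \<open>v\<close> and \<open>\<Phi>\<close>, so the pair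
  \<open>(\<psi>, g)\<close> only has to represent the functional \<open>(a, b) \<mapsto> \<integral>q v\<close>.

  Pair \<open>(a, b)\<close> with \<open>(v, \<nabla>\<^sub>sv)\<close> on energies below \<open>t\<close>. The transport term has a sign because \<open>v\<close>
  vanishes where a ray leaves the convex domain, the \<open>G\<close> term vanishes by rotation invariance of the
  sphere, the \<open>\<Phi>\<close> terms cancel, and the first term is bounded below because \<open>S\<close> is Lipschitz in the
  energy. Gronwall's argument then yields \<open>sup\<^sub>t \<parallel>v(t)\<parallel> \<le> C (\<parallel>a\<parallel> + \<parallel>b\<parallel>)\<close> with \<open>a\<close> measured in
  \<open>L\<^sup>1(E; L\<^sup>2)\<close> and \<open>b\<close> in \<open>L\<^sup>2\<close>. By Hahn-Banach and Riesz the functional is represented by some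
  \<open>(\<psi>, g)\<close> in \<open>L\<^sup>2\<close>, and domination by the \<open>L\<^sup>1(E; L\<^sup>2)\<close> norm of \<open>a\<close> means \<open>\<psi> \<in> L\<^sup>\<infinity>(E; L\<^sup>2)\<close>.\<close>

subsection \<open>The Hahn-Banach theorem\<close>

text \<open>The obstacle is regularity: \<open>S\<close> has only weak derivatives and is not
  controlled at a fixed energy, and the boundary of \<open>R\<close> may have points without a
  normal. Every integration by parts is therefore done on difference quotients, with translations of
  Lebesgue measure in position and energy and with rotations on the sphere. Invariance of the
  measure takes the place of traces and of the divergence theorem; only the sign or size of thin
  boundary layers matters, and that survives the limit. Bounded weak derivatives become Lipschitz
  bounds almost everywhere by testing against smoothed boxes, but with a null set for each step
  length, so the steps are taken from the countable family \<open>1 / (n + 1)\<close>. Test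
  functions vanish at the lower end of the energy interval, so the estimate runs upwards from zero
  data although the solution is prescribed at the upper end. Its right-hand side again contains the
  supremum and the gradient of \<open>v\<close>; since \<open>v\<close> is bounded beforehand, these
  can be absorbed by a quadratic argument.\<close>

instantiation "fun" :: (type, real_vector) real_vector
begin
definition scaleR_fun where "c *\<^sub>R f = (\<lambda>x. c *\<^sub>R f x)"
instance
  by standard (auto simp: scaleR_fun_def plus_fun_def fun_eq_iff scaleR_add_right scaleR_add_left)
end

text \<open>Domination of an extension at \<open>z\<close> bounds its value from below by all
  \<open>y - p (x - z)\<close> and from above by all \<open>p (x + z) - y\<close> with
  \<open>(x, y)\<close> in \<open>W\<close>. Subadditivity puts every lower bound below every upper
  bound, and the supremum of the lower ones serves as \<open>a\<close>.\<close>

lemma hahn_banach_gap: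
  fixes p :: "'a::real_vector \<Rightarrow> real"
  assumes V: "subspace V" and W: "subspace (W :: ('a \<times> real) set)" and WV: "fst ` W \<subseteq> V"
    and padd: "\<And>x y. x \<in> V \<Longrightarrow> y \<in> V \<Longrightarrow> p (x + y) \<le> p x + p y"
    and le: "\<And>x y. (x, y) \<in> W \<Longrightarrow> y \<le> p x"
    and z: "z \<in> V"
  shows "\<exists>a. \<forall>(x, y)\<in>W. y + a \<le> p (x + z) \<and> y - a \<le> p (x - z)"
proof -
  have in_V: "x \<in> V" if "(x, y) \<in> W" for x y
    using WV that by (auto simp: image_subset_iff)
  have key: "y1 - p (x1 - z) \<le> p (x2 + z) - y2" if 1: "(x1, y1) \<in> W" and 2: "(x2, y2) \<in> W" for x1 y1 x2 y2
  proof -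
    have "(x1 + x2, y1 + y2) \<in> W"
      using subspace_add[OF W 1 2] by simp
    then have "y1 + y2 \<le> p (x1 + x2)"
      by (rule le)
    also have "x1 + x2 = (x1 - z) + (x2 + z)"
      by simp
    also have "p \<dots> \<le> p (x1 - z) + p (x2 + z)"
      by (intro padd subspace_add subspace_diff V z in_V[OF 1] in_V[OF 2])
    finally show ?thesis
      by simp
  qed
  have 0: "(0, 0) \<in> W"
    using subspace_0[OF W] by (simp add: zero_prod_def)
  define D where "D = (\<lambda>(x, y). y - p (x - z)) ` W"
  have ne: "D \<noteq> {}"
    using 0 by (auto simp: D_def)
  have bdd: "bdd_above D"
    using key[OF _ 0] by (intro bdd_aboveI[of _ "p (0 + z) - 0"]) (auto simp: D_def)
  have "y + Sup D \<le> p (x + z) \<and> y - Sup D \<le> p (x - z)" if xy: "(x, y) \<in> W" for x y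
  proof -
    have "Sup D \<le> p (x + z) - y"
      using key[OF _ xy] by (intro cSup_least ne) (auto simp: D_def)
    moreover have "y - p (x - z) \<le> Sup D"
      using xy by (intro cSup_upper bdd) (auto simp: D_def)
    ultimately show ?thesis
      by simp
  qed
  then show ?thesis
    by blast
qed

text \<open>Adjoining the line through \<open>(z, a)\<close>: for a coefficient
  \<open>c \<noteq> 0\<close>, dividing by its absolute value reduces domination to the two
  inequalities with \<open>x + z\<close> and \<open>x - z\<close>. The case that \<open>z\<close>
  already lies in the domain is covered as well, since a graph may a priori be multivalued.\<close>

lemma hahn_banach_step:
  fixes p :: "'a::real_vector \<Rightarrow> real"
  assumes V: "subspace V" and W: "subspace (W :: ('a \<times> real) set)" and WV: "fst ` W \<subseteq> V"
    and padd: "\<And>x y. x \<in> V \<Longrightarrow> y \<in> V \<Longrightarrow> p (x + y) \<le> p x + p y"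
    and pscale: "\<And>c x. 0 < c \<Longrightarrow> x \<in> V \<Longrightarrow> p (c *\<^sub>R x) = c * p x"
    and le: "\<And>x y. (x, y) \<in> W \<Longrightarrow> y \<le> p x"
    and z: "z \<in> V"
  shows "\<exists>W'. W \<subseteq> W' \<and> subspace W' \<and> fst ` W' \<subseteq> V \<and> (\<forall>(x, y)\<in>W'. y \<le> p x) \<and> z \<in> fst ` W'"
proof -
  have in_V: "x \<in> V" if "(x, y) \<in> W" for x y
    using WV that by (auto simp: image_subset_iff)
  obtain a where a: "\<And>x y. (x, y) \<in> W \<Longrightarrow> y + a \<le> p (x + z)" "\<And>x y. (x, y) \<in> W \<Longrightarrow> y - a \<le> p (x - z)"
    using hahn_banach_gap[OF V W WV padd le z] by blast
  define W' where "W' = {u + v |u v. u \<in> W \<and> v \<in> span {(z, a)}}"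
  have el: "\<exists>x y c. (x, y) \<in> W \<and> w = (x + c *\<^sub>R z, y + c * a)" if "w \<in> W'" for w
    using that unfolding W'_def span_singleton by force
  have "y + c * a \<le> p (x + c *\<^sub>R z)" if xy: "(x, y) \<in> W" for x y c
  proof -
    consider "c = 0" | "c > 0" | "c < 0" by linarith
    then show ?thesis
    proof cases
      case 1
      then show ?thesis using le[OF xy] by simp
    next
      case 2
      have xyc: "((1/c) *\<^sub>R x, (1/c) * y) \<in> W"
        using subspace_scale[OF W xy, of "1/c"] by simp
      have "c * ((1/c) * y + a) \<le> c * p ((1/c) *\<^sub>R x + z)"
        using a(1)[OF xyc] 2 by (intro mult_left_mono) auto
      also have "\<dots> = p (c *\<^sub>R ((1/c) *\<^sub>R x + z))"
        using 2 by (intro pscale[symmetric] subspace_add V in_V[OF xyc] z)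
      finally show ?thesis
        using 2 by (simp add: algebra_simps)
    next
      case 3
      define d where "d = - c"
      have d: "d > 0" "c = - d" using 3 by (auto simp: d_def)
      have xyc: "((1/d) *\<^sub>R x, (1/d) * y) \<in> W"
        using subspace_scale[OF W xy, of "1/d"] by simp
      have "d * ((1/d) * y - a) \<le> d * p ((1/d) *\<^sub>R x - z)"
        using a(2)[OF xyc] d by (intro mult_left_mono) auto
      also have "\<dots> = p (d *\<^sub>R ((1/d) *\<^sub>R x - z))"
        using d by (intro pscale[symmetric] subspace_diff V in_V[OF xyc] z)
      finally show ?thesis
        using d by (simp add: algebra_simps)
    qed
  qed
  then have "\<forall>(x, y)\<in>W'. y \<le> p x"
    using el by blast
  moreover have "subspace W'"
    unfolding W'_def by (intro subspace_sums W subspace_span)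
  moreover have "W \<subseteq> W'"
    unfolding W'_def using span_zero[of "{(z, a)}"] by (force simp: zero_prod_def)
  moreover have "fst ` W' \<subseteq> V"
    using el in_V V z by (fastforce intro: subspace_add subspace_scale)
  moreover have "0 + (z, a) \<in> W'"
    unfolding W'_def using subspace_0[OF W] span_base[of "(z, a)" "{(z, a)}"] by blast
  then have "z \<in> fst ` W'"
    by force
  ultimately show ?thesis
    by blast
qed

lemma subspace_Union_chain:
  assumes "C \<noteq> {}" and "\<And>W. W \<in> C \<Longrightarrow> subspace W"
    and "\<And>W W'. W \<in> C \<Longrightarrow> W' \<in> C \<Longrightarrow> W \<subseteq> W' \<or> W' \<subseteq> W"
  shows "subspace (\<Union>C)"
proof (rule subspaceI)
  show "0 \<in> \<Union>C"
    using assms(1,2) subspace_0 by blast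
  show "x + y \<in> \<Union>C" if xy: "x \<in> \<Union>C" "y \<in> \<Union>C" for x y
  proof -
    obtain X Y where XY: "X \<in> C" "x \<in> X" "Y \<in> C" "y \<in> Y"
      using xy by blast
    then obtain Z where "Z \<in> C" "x \<in> Z" "y \<in> Z"
      using assms(3)[OF XY(1,3)] by blast
    then show ?thesis
      using subspace_add[OF assms(2)] by blast
  qed
  show "c *\<^sub>R x \<in> \<Union>C" if "x \<in> \<Union>C" for c x
    using that assms(2) subspace_scale by blast
qed

text \<open>A linear functional on a subspace is represented by its graph \<open>W\<close>, which need not be
  assumed to be single-valued: this follows from the domination by \<open>p\<close>.\<close>

lemma hahn_banach:
  fixes p :: "'a::real_vector \<Rightarrow> real"
  assumes V: "subspace V" and W: "subspace (W :: ('a \<times> real) set)" and WV: "fst ` W \<subseteq> V"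
    and padd: "\<And>x y. x \<in> V \<Longrightarrow> y \<in> V \<Longrightarrow> p (x + y) \<le> p x + p y"
    and pscale: "\<And>c x. 0 < c \<Longrightarrow> x \<in> V \<Longrightarrow> p (c *\<^sub>R x) = c * p x"
    and le: "\<And>x y. (x, y) \<in> W \<Longrightarrow> y \<le> p x"
  shows "\<exists>F. (\<forall>x\<in>V. \<forall>y\<in>V. F (x + y) = F x + F y) \<and> (\<forall>c. \<forall>x\<in>V. F (c *\<^sub>R x) = c * F x) \<and>
    (\<forall>x\<in>V. F x \<le> p x) \<and> (\<forall>(x, y)\<in>W. F x = y)"
proof -
  define \<A> where "\<A> = {W'. W \<subseteq> W' \<and> subspace W' \<and> fst ` W' \<subseteq> V \<and> (\<forall>(x, y)\<in>W'. y \<le> p x)}"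
  have "\<exists>M\<in>\<A>. \<forall>X\<in>\<A>. M \<subseteq> X \<longrightarrow> X = M"
  proof (rule subset_Zorn_nonempty)
    show "\<A> \<noteq> {}"
      using W WV le by (auto simp: \<A>_def)
  next
    fix C assume C: "C \<noteq> {}" "subset.chain \<A> C"
    then have sub: "C \<subseteq> \<A>" and ch: "\<And>W W'. W \<in> C \<Longrightarrow> W' \<in> C \<Longrightarrow> W \<subseteq> W' \<or> W' \<subseteq> W"
      by (auto simp: subset.chain_def)
    have "subspace (\<Union>C)"
      using sub ch C(1) by (intro subspace_Union_chain) (auto simp: \<A>_def)
    with sub C(1) show "\<Union>C \<in> \<A>"
      by (fastforce simp: \<A>_def)
  qed
  then obtain M where M: "M \<in> \<A>" and max: "\<And>X. X \<in> \<A> \<Longrightarrow> M \<subseteq> X \<Longrightarrow> X = M"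
    by blast
  have M': "W \<subseteq> M" "subspace M" "fst ` M \<subseteq> V" "\<And>x y. (x, y) \<in> M \<Longrightarrow> y \<le> p x"
    using M by (auto simp: \<A>_def)
  have total: "\<exists>y. (z, y) \<in> M" if z: "z \<in> V" for z
  proof -
    obtain W' where W': "M \<subseteq> W'" "subspace W'" "fst ` W' \<subseteq> V" "\<forall>(x, y)\<in>W'. y \<le> p x" "z \<in> fst ` W'"
      using hahn_banach_step[OF V M'(2,3) padd pscale M'(4) z] by blast
    then have "W' = M"
      using M'(1) by (intro max) (auto simp: \<A>_def)
    with W'(5) show ?thesis
      by force
  qed
  have p0: "p 0 = 0"
    using pscale[of 2 0] subspace_0[OF V] by simp
  \<comment> \<open>Both \<open>(0, y)\<close> and \<open>(0, -y)\<close> lie in \<open>M\<close>,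
    so domination by \<open>p 0 = 0\<close> forces \<open>y = 0\<close>; this is the
    single-valuedness.\<close>
  have zero: "y = 0" if "(0, y) \<in> M" for y
    using M'(4)[of 0 y] M'(4)[of 0 "-y"] subspace_scale[OF M'(2) that, of "-1"] that p0 by auto
  have uniq: "y = y'" if "(x, y) \<in> M" "(x, y') \<in> M" for x y y'
    using zero[of "y - y'"] subspace_diff[OF M'(2) that] by auto
  define F where "F x = (THE y. (x, y) \<in> M)" for x
  have FM: "(x, F x) \<in> M" if "x \<in> V" for x
    unfolding F_def using total[OF that] uniq by (metis theI)
  have Feq: "F x = y" if "(x, y) \<in> M" for x y
    using uniq[OF FM that] that M'(3) by (auto simp: image_subset_iff)
  show ?thesis
  proof (intro exI[of _ F] conjI ballI allI)
    show "F (x + y) = F x + F y" if "x \<in> V" "y \<in> V" for x y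
      using subspace_add[OF M'(2) FM[OF that(1)] FM[OF that(2)]] by (intro Feq) simp
    show "F (c *\<^sub>R x) = c * F x" if "x \<in> V" for c x
      using subspace_scale[OF M'(2) FM[OF that], of c] by (intro Feq) simp
    show "F x \<le> p x" if "x \<in> V" for x
      using M'(4) FM[OF that] .
    show "case w of (x, y) \<Rightarrow> F x = y" if "w \<in> W" for w
      using that M'(1) Feq by auto
  qed
qed

subsection \<open>Riesz representation in \<open>L\<^sup>2\<close>\<close>

lemma L2I:
  assumes "f \<in> borel_measurable M" "integrable M (\<lambda>x. (norm (f x))\<^sup>2)"
  shows "f \<in> L2 M"
  using assms by (simp add: L2_def)

lemma L2D:
  assumes "f \<in> L2 M"
  shows "f \<in> borel_measurable M" "integrable M (\<lambda>x. (norm (f x))\<^sup>2)"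
  using assms by (simp_all add: L2_def)

lemma L2_norm_nonneg: "0 \<le> L2_norm M f"
  by (simp add: L2_norm_def integral_nonneg_AE)

lemma L2_norm_power2: "(L2_norm M f)\<^sup>2 = (LINT x|M. (norm (f x))\<^sup>2)"
  by (simp add: L2_norm_def integral_nonneg_AE)

lemma L2_inner_integrable:
  assumes "f \<in> L2 M" "g \<in> L2 M"
  shows "integrable M (\<lambda>x. f x \<bullet> g x)"
proof (rule Bochner_Integration.integrable_bound)
  show "integrable M (\<lambda>x. (norm (f x))\<^sup>2 + (norm (g x))\<^sup>2)"
    using assms by (auto intro: L2D)
  have "\<bar>f x \<bullet> g x\<bar> \<le> (norm (f x))\<^sup>2 + (norm (g x))\<^sup>2" for x
  proof -
    have "\<bar>f x \<bullet> g x\<bar> \<le> norm (f x) * norm (g x)"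
      by (rule Cauchy_Schwarz_ineq2)
    also have "\<dots> \<le> (norm (f x))\<^sup>2 + (norm (g x))\<^sup>2"
      using sum_squares_bound[of "norm (f x)" "norm (g x)"]
        mult_nonneg_nonneg[OF norm_ge_zero[of "f x"] norm_ge_zero[of "g x"]] by linarith
    finally show ?thesis .
  qed
  then show "AE x in M. norm (f x \<bullet> g x) \<le> norm ((norm (f x))\<^sup>2 + (norm (g x))\<^sup>2)"
    by simp
  show "(\<lambda>x. f x \<bullet> g x) \<in> borel_measurable M"
    using L2D(1)[OF assms(1)] L2D(1)[OF assms(2)] by measurable
qed

text \<open>All Hilbert space geometry below comes from this expansion: Cauchy-Schwarz from
  \<open>c = 1\<close> and variable \<open>d\<close>, the triangle inequality from
  \<open>c = d = 1\<close>, the parallelogram law from the pairs \<open>(1, -1)\<close> and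
  \<open>(1/2, 1/2)\<close>.\<close>

lemma L2_lincomb:
  assumes "f \<in> L2 M" "g \<in> L2 M"
  shows "(\<lambda>x. c *\<^sub>R f x + d *\<^sub>R g x) \<in> L2 M"
    and "(L2_norm M (\<lambda>x. c *\<^sub>R f x + d *\<^sub>R g x))\<^sup>2 =
      c\<^sup>2 * (L2_norm M f)\<^sup>2 + 2 * c * d * (LINT x|M. f x \<bullet> g x) + d\<^sup>2 * (L2_norm M g)\<^sup>2"
proof -
  have eq: "(norm (c *\<^sub>R f x + d *\<^sub>R g x))\<^sup>2 = c\<^sup>2 * (norm (f x))\<^sup>2 + 2 * c * d * (f x \<bullet> g x) + d\<^sup>2 *
      (norm (g x))\<^sup>2" for x
    unfolding power2_norm_eq_inner by (simp add: inner_add inner_commute algebra_simps power2_eq_square)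
  have int: "integrable M (\<lambda>x. c\<^sup>2 * (norm (f x))\<^sup>2)" "integrable M (\<lambda>x. 2 * c * d * (f x \<bullet> g x))"
      "integrable M (\<lambda>x. d\<^sup>2 * (norm (g x))\<^sup>2)"
    using assms by (auto intro: L2D L2_inner_integrable)
  show "(\<lambda>x. c *\<^sub>R f x + d *\<^sub>R g x) \<in> L2 M"
  proof (rule L2I)
    show "(\<lambda>x. c *\<^sub>R f x + d *\<^sub>R g x) \<in> borel_measurable M"
      using L2D(1)[OF assms(1)] L2D(1)[OF assms(2)] by measurable
    show "integrable M (\<lambda>x. (norm (c *\<^sub>R f x + d *\<^sub>R g x))\<^sup>2)"
      unfolding eq by (intro Bochner_Integration.integrable_add int)
  qed
  show "(L2_norm M (\<lambda>x. c *\<^sub>R f x + d *\<^sub>R g x))\<^sup>2 =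
      c\<^sup>2 * (L2_norm M f)\<^sup>2 + 2 * c * d * (LINT x|M. f x \<bullet> g x) + d\<^sup>2 * (L2_norm M g)\<^sup>2"
    unfolding L2_norm_power2 eq using int by (simp add: Bochner_Integration.integral_add)
qed

lemma L2_add: "f \<in> L2 M \<Longrightarrow> g \<in> L2 M \<Longrightarrow> (\<lambda>x. f x + g x) \<in> L2 M"
  using L2_lincomb(1)[of f M g 1 1] by simp

lemma L2_diff: "f \<in> L2 M \<Longrightarrow> g \<in> L2 M \<Longrightarrow> (\<lambda>x. f x - g x) \<in> L2 M"
  using L2_lincomb(1)[of f M g 1 "-1"] by simp

lemma L2_scaleR: "f \<in> L2 M \<Longrightarrow> (\<lambda>x. c *\<^sub>R f x) \<in> L2 M"
  using L2_lincomb(1)[of f M f c 0] by simp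

text \<open>Functions are not identified almost everywhere. With the pointwise operations on the
  full function type, \<open>L2_norm\<close> is only a seminorm, which is why later proofs treat or
  avoid a vanishing norm separately.\<close>

lemma subspace_L2: "subspace (L2 M)"
proof (rule subspaceI)
  show "0 \<in> L2 M"
    by (simp add: L2_def zero_fun_def)
qed (simp_all add: plus_fun_def scaleR_fun_def L2_add L2_scaleR)

lemma L2_norm_scaleR: "L2_norm M (\<lambda>x. c *\<^sub>R f x) = \<bar>c\<bar> * L2_norm M f"
  by (simp add: L2_norm_def power_mult_distrib real_sqrt_mult)

lemma L2_Cauchy_Schwarz:
  assumes "f \<in> L2 M" "g \<in> L2 M"
  shows "\<bar>LINT x|M. f x \<bullet> g x\<bar> \<le> L2_norm M f * L2_norm M g"
proof -
  define I where "I = (LINT x|M. f x \<bullet> g x)"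
  have q: "0 \<le> (L2_norm M f)\<^sup>2 + 2 * t * I + t\<^sup>2 * (L2_norm M g)\<^sup>2" for t
    using L2_lincomb(2)[OF assms, of 1 t] by (simp add: I_def) (metis zero_le_power2)
  have "I\<^sup>2 \<le> (L2_norm M f * L2_norm M g)\<^sup>2"
  proof (cases "L2_norm M g = 0")
    case True
    \<comment> \<open>With a vanishing seminorm of \<open>g\<close> the quadratic is affine in
      \<open>t\<close>; for \<open>I \<noteq> 0\<close> the chosen \<open>t\<close> would give it
      the value -1.\<close>
    have "I = 0"
    proof (rule ccontr)
      assume "I \<noteq> 0"
      then show False
        using q[of "- ((L2_norm M f)\<^sup>2 + 1) / (2 * I)"] True by (simp add: field_simps)
    qed
    then show ?thesis by simp
  next
    case False
    then have pos: "(L2_norm M g)\<^sup>2 > 0"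
      by simp
    have "(- I / (L2_norm M g)\<^sup>2)\<^sup>2 * (L2_norm M g)\<^sup>2 = I\<^sup>2 / (L2_norm M g)\<^sup>2"
      using pos by (simp add: power2_eq_square)
    then have "I\<^sup>2 / (L2_norm M g)\<^sup>2 \<le> (L2_norm M f)\<^sup>2"
      using q[of "- I / (L2_norm M g)\<^sup>2"] by (simp add: power2_eq_square)
    then show ?thesis
      using pos by (simp add: pos_divide_le_eq power_mult_distrib)
  qed
  then show ?thesis
    unfolding I_def by (simp add: power2_le_iff_abs_le L2_norm_nonneg)
qed

lemma L2_norm_triangle:
  assumes "f \<in> L2 M" "g \<in> L2 M"
  shows "L2_norm M (\<lambda>x. f x + g x) \<le> L2_norm M f + L2_norm M g"
proof (rule power2_le_imp_le)
  have "(L2_norm M (\<lambda>x. f x + g x))\<^sup>2 = (L2_norm M f)\<^sup>2 + 2 * (LINT x|M. f x \<bullet> g x) + (L2_norm M g)\<^sup>2"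
    using L2_lincomb(2)[OF assms, of 1 1] by simp
  also have "\<dots> \<le> (L2_norm M f + L2_norm M g)\<^sup>2"
    using L2_Cauchy_Schwarz[OF assms] by (simp add: power2_sum)
  finally show "(L2_norm M (\<lambda>x. f x + g x))\<^sup>2 \<le> (L2_norm M f + L2_norm M g)\<^sup>2" .
qed (simp add: L2_norm_nonneg)

lemma (in finite_measure) L2_const: "(\<lambda>x. c) \<in> L2 M"
  by (intro L2I) auto

lemma (in finite_measure) L2_integrable:
  fixes f :: "'a \<Rightarrow> 'b::euclidean_space"
  assumes "f \<in> L2 M"
  shows "integrable M f"
    and "(LINT x|M. norm (f x)) \<le> sqrt (measure M (space M)) * L2_norm M f"
proof -
  have n: "(\<lambda>x. norm (f x)) \<in> L2 M"
    using assms by (auto simp: L2_def)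
  have "integrable M (\<lambda>x. norm (f x))"
    using L2_inner_integrable[OF n L2_const[of 1]] by simp
  then show "integrable M f"
    using assms by (simp add: integrable_norm_iff L2D)
  have "L2_norm M (\<lambda>x. 1::real) = sqrt (measure M (space M))" "L2_norm M (\<lambda>x. norm (f x)) = L2_norm M f"
    by (simp_all add: L2_norm_def)
  then show "(LINT x|M. norm (f x)) \<le> sqrt (measure M (space M)) * L2_norm M f"
    using L2_Cauchy_Schwarz[OF L2_const[of 1] n] by simp
qed

text \<open>Completeness of L2 for rapidly Cauchy sequences. The finite measure turns the geometric
  L2 bounds on the increments into geometric L1 bounds, so the telescoping series converges
  absolutely almost everywhere; Fatou's lemma carries the bounds to the limit.\<close>

lemma (in finite_measure) L2_fast_Cauchy_convergent:
  fixes f :: "nat \<Rightarrow> 'a \<Rightarrow> 'b::euclidean_space"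
  assumes f: "\<And>n. f n \<in> L2 M"
    and C: "\<And>n k. n \<le> k \<Longrightarrow> L2_norm M (\<lambda>x. f k x - f n x) \<le> (1/2)^n"
  shows "\<exists>u\<in>L2 M. \<forall>n. L2_norm M (\<lambda>x. u x - f n x) \<le> (1/2)^n"
proof -
  have [measurable]: "f n \<in> borel_measurable M" for n
    using f by (rule L2D)
  define d where "d i x = f (Suc i) x - f i x" for i x
  have d: "d i \<in> L2 M" for i
    unfolding d_def[abs_def] by (intro L2_diff f)
  have [measurable]: "d n \<in> borel_measurable M" for n
    using d by (rule L2D)
  let ?c = "sqrt (measure M (space M))"
  have di: "(LINT x|M. norm (d i x)) \<le> ?c * (1/2)^i" for i
  proof (rule order_trans[OF L2_integrable(2)[OF d]])
    have "L2_norm M (d i) \<le> (1/2)^i"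
      using C[of i "Suc i"] by (simp add: d_def[abs_def])
    then show "?c * L2_norm M (d i) \<le> ?c * (1/2)^i"
      by (intro mult_left_mono) auto
  qed
  have "(\<integral>\<^sup>+x. (\<Sum>i. ennreal (norm (d i x))) \<partial>M) = (\<Sum>i. \<integral>\<^sup>+x. ennreal (norm (d i x)) \<partial>M)"
    by (rule nn_integral_suminf) measurable
  also have "\<dots> = (\<Sum>i. ennreal (LINT x|M. norm (d i x)))"
    using L2_integrable(1)[OF d] by (intro suminf_cong nn_integral_eq_integral) auto
  also have "\<dots> \<le> (\<Sum>i. ennreal (?c * (1/2)^i))"
    using di by (intro suminf_le ennreal_leI) auto
  also have "\<dots> < \<infinity>"
    by (subst suminf_ennreal2) (auto intro!: summable_mult summable_geometric)
  finally have "AE x in M. (\<Sum>i. ennreal (norm (d i x))) \<noteq> \<infinity>"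
    by (intro nn_integral_PInf_AE) auto
  then have conv: "AE x in M. convergent (\<lambda>n. f n x)"
  proof eventually_elim
    case (elim x)
    then have "summable (\<lambda>i. norm (d i x))"
      by (intro summable_suminf_not_top) auto
    then have "summable (\<lambda>i. d i x)"
      by (rule summable_norm_cancel)
    then have "convergent (\<lambda>n. \<Sum>i<n. d i x)"
      by (simp add: summable_iff_convergent)
    moreover have "(\<Sum>i<n. d i x) = f n x - f 0 x" for n
      unfolding d_def by (rule sum_lessThan_telescope)
    ultimately have "convergent (\<lambda>n. (f n x - f 0 x) + f 0 x)"
      by (intro convergent_add convergent_const) simp
    then show ?case
      by simp
  qed
  \<comment> \<open>\<open>lim\<close> is total, so \<open>u\<close> also has a value on the null
    set of divergence and stays measurable.\<close>
  define u where "u x = lim (\<lambda>n. f n x)" for x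
  have [measurable]: "u \<in> borel_measurable M"
    unfolding u_def[abs_def] by measurable
  have lim: "AE x in M. (\<lambda>n. f n x) \<longlonglongrightarrow> u x"
    using conv by eventually_elim (simp add: u_def convergent_LIMSEQ_iff)
  have bound: "(\<integral>\<^sup>+x. ennreal ((norm (u x - f n x))\<^sup>2) \<partial>M) \<le> ennreal (((1/2)^n)\<^sup>2)" for n
  proof -
    have "(\<integral>\<^sup>+x. ennreal ((norm (u x - f n x))\<^sup>2) \<partial>M)
        = (\<integral>\<^sup>+x. liminf (\<lambda>k. ennreal ((norm (f k x - f n x))\<^sup>2)) \<partial>M)"
    proof (intro nn_integral_cong_AE)
      show "AE x in M. ennreal ((norm (u x - f n x))\<^sup>2) = liminf (\<lambda>k. ennreal ((norm (f k x - f n x))\<^sup>2))"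
        using lim
      proof eventually_elim
        case (elim x)
        then have "(\<lambda>k. ennreal ((norm (f k x - f n x))\<^sup>2)) \<longlonglongrightarrow> ennreal ((norm (u x - f n x))\<^sup>2)"
          by (intro tendsto_intros) auto
        then show ?case
          by (intro lim_imp_Liminf[symmetric]) auto
      qed
    qed
    also have "\<dots> \<le> liminf (\<lambda>k. \<integral>\<^sup>+x. ennreal ((norm (f k x - f n x))\<^sup>2) \<partial>M)"
      by (rule nn_integral_liminf) measurable
    also have "\<dots> \<le> ennreal (((1/2)^n)\<^sup>2)"
    proof (rule Liminf_le)
      have "(\<integral>\<^sup>+x. ennreal ((norm (f k x - f n x))\<^sup>2) \<partial>M) \<le> ennreal (((1/2)^n)\<^sup>2)" if "n \<le> k" for k
      proof -
        have "(\<integral>\<^sup>+x. ennreal ((norm (f k x - f n x))\<^sup>2) \<partial>M) = ennreal ((L2_norm M (\<lambda>x. f k x - f n x))\<^sup>2)"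
          unfolding L2_norm_power2 using L2_diff[OF f f]
          by (intro nn_integral_eq_integral) (auto intro: L2D)
        also have "\<dots> \<le> ennreal (((1/2)^n)\<^sup>2)"
          using C[OF that] by (intro ennreal_leI power_mono L2_norm_nonneg)
        finally show ?thesis .
      qed
      then show "\<forall>\<^sub>F k in sequentially. (\<integral>\<^sup>+x. ennreal ((norm (f k x - f n x))\<^sup>2) \<partial>M) \<le> ennreal (((1/2)^n)\<^sup>2)"
        by (rule eventually_sequentiallyI)
    qed auto
    finally show ?thesis .
  qed
  have uf: "(\<lambda>x. u x - f n x) \<in> L2 M" for n
  proof (rule L2I)
    show "integrable M (\<lambda>x. (norm (u x - f n x))\<^sup>2)"
      using bound[of n] by (intro integrableI_bounded) (auto simp: le_less_trans)
  qed measurable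
  have "L2_norm M (\<lambda>x. u x - f n x) \<le> (1/2)^n" for n
  proof -
    have "ennreal ((L2_norm M (\<lambda>x. u x - f n x))\<^sup>2) \<le> ennreal (((1/2)^n)\<^sup>2)"
      unfolding L2_norm_power2 using bound[of n] L2D[OF uf[of n]]
      by (subst nn_integral_eq_integral[symmetric]) auto
    then have "(L2_norm M (\<lambda>x. u x - f n x))\<^sup>2 \<le> ((1/2)^n)\<^sup>2"
      by (subst (asm) ennreal_le_iff) auto
    then show ?thesis
      by (rule power2_le_imp_le) simp
  qed
  moreover have "u \<in> L2 M"
    using L2_add[OF uf[of 0] f[of 0]] by simp
  ultimately show ?thesis
    by blast
qed

text \<open>Direct method instead of orthogonal complements: \<open>J\<close> is bounded below,
  near-minimizers are Cauchy by the parallelogram law, and stationarity of \<open>J\<close> at the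
  minimizer \<open>u\<close> is the representation.\<close>

lemma (in finite_measure) L2_Riesz:
  fixes F :: "('a \<Rightarrow> 'b::euclidean_space) \<Rightarrow> real"
  assumes add: "\<And>f g. f \<in> L2 M \<Longrightarrow> g \<in> L2 M \<Longrightarrow> F (\<lambda>x. f x + g x) = F f + F g"
    and scale: "\<And>c f. f \<in> L2 M \<Longrightarrow> F (\<lambda>x. c *\<^sub>R f x) = c * F f"
    and bound: "\<And>f. f \<in> L2 M \<Longrightarrow> \<bar>F f\<bar> \<le> K * L2_norm M f"
  shows "\<exists>u\<in>L2 M. \<forall>f\<in>L2 M. F f = (LINT x|M. u x \<bullet> f x)"
proof -
  define J where "J f = (L2_norm M f)\<^sup>2 - 2 * F f" for f
  have lin: "F (\<lambda>x. c *\<^sub>R f x + d *\<^sub>R g x) = c * F f + d * F g" if "f \<in> L2 M" "g \<in> L2 M" for c d f g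
    using add[OF L2_scaleR[OF that(1)] L2_scaleR[OF that(2)]] scale that by simp
  have Jlow: "- K\<^sup>2 \<le> J f" if "f \<in> L2 M" for f
  proof -
    have "0 \<le> (L2_norm M f - K)\<^sup>2"
      by simp
    then show ?thesis
      using bound[OF that] by (simp add: J_def power2_diff algebra_simps)
  qed
  define m where "m = Inf (J ` L2 M)"
  have bdd: "bdd_below (J ` L2 M)"
    using Jlow by (auto intro!: bdd_belowI)
  have ne: "J ` L2 M \<noteq> {}"
    using subspace_L2 subspace_0 by blast
  have mle: "m \<le> J f" if "f \<in> L2 M" for f
    unfolding m_def using that bdd by (auto intro: cINF_lower)
  \<comment> \<open>The tolerance is chosen to fit the parallelogram law: twice the sum of two
    excesses is at most \<open>(1/4)^k / 2 + (1/4)^n / 2\<close>, hence at most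
    \<open>(1/4)^n\<close> for \<open>n \<le> k\<close>, the square of the required rate.\<close>
  have "\<exists>f\<in>L2 M. J f < m + (1/4)^n / 4" for n
    using cInf_lessD[OF ne, of "m + (1/4)^n / 4"] by (auto simp: m_def)
  then obtain f where f: "\<And>n. f n \<in> L2 M" and Jf: "\<And>n. J (f n) < m + (1/4)^n / 4"
    by metis
  have quarter: "((1/2)^n)\<^sup>2 = (1/4::real)^n" for n
    by (simp add: power_even_eq[symmetric] power2_eq_square flip: power_mult_distrib)
  have "L2_norm M (\<lambda>x. f k x - f n x) \<le> (1/2)^n" if nk: "n \<le> k" for n k
  proof -
    have "m \<le> J (\<lambda>x. (1/2) *\<^sub>R f k x + (1/2) *\<^sub>R f n x)"
      by (intro mle L2_lincomb f)
    then have "(L2_norm M (\<lambda>x. f k x - f n x))\<^sup>2 \<le> 2 * J (f k) + 2 * J (f n) - 4 * m"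
      using L2_lincomb(2)[OF f f, of 1 k "-1" n] L2_lincomb(2)[OF f f, of "1/2" k "1/2" n] lin[OF f f, of
          "1/2" k "1/2" n]
      by (simp add: J_def field_simps power2_eq_square)
    also have "\<dots> \<le> (1/4)^k / 2 + (1/4)^n / 2"
      using Jf[of k] Jf[of n] by simp
    also have "\<dots> \<le> (1/4)^n"
    proof -
      have "(1/4::real)^k \<le> (1/4)^n"
        using nk by (intro power_decreasing) auto
      then show ?thesis
        by linarith
    qed
    finally show ?thesis
      unfolding quarter[symmetric] by (rule power2_le_imp_le) simp
  qed
  then have "\<exists>u\<in>L2 M. \<forall>n. L2_norm M (\<lambda>x. u x - f n x) \<le> (1/2)^n"
    by (intro L2_fast_Cauchy_convergent f)
  then obtain u where u: "u \<in> L2 M" and ub: "\<And>n. L2_norm M (\<lambda>x. u x - f n x) \<le> (1/2)^n"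
    by blast
  \<comment> \<open>\<open>J\<close> is continuous along the sequence: passing from
    \<open>f n\<close> to \<open>u\<close> costs a multiple of \<open>(1/2)^n\<close>, with a factor
    independent of \<open>n\<close> since the norms of the \<open>f n\<close> stay below that of
    \<open>u\<close> plus 1.\<close>
  have "J u \<le> m"
  proof -
    have J_le: "J u \<le> (L2_norm M (f n) + (1/2)^n)\<^sup>2 - 2 * F (f n) + 2 * \<bar>K\<bar> * (1/2)^n" for n
    proof -
      have uf: "(\<lambda>x. u x - f n x) \<in> L2 M"
        by (intro L2_diff u f)
      have "L2_norm M u \<le> L2_norm M (f n) + (1/2)^n"
        using L2_norm_triangle[OF f[of n] uf] ub[of n] by simp
      then have "(L2_norm M u)\<^sup>2 \<le> (L2_norm M (f n) + (1/2)^n)\<^sup>2"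
        by (intro power_mono L2_norm_nonneg)
      moreover have "F u = F (f n) + F (\<lambda>x. u x - f n x)"
        using add[OF f[of n] uf] by simp
      moreover have "\<bar>F (\<lambda>x. u x - f n x)\<bar> \<le> \<bar>K\<bar> * (1/2)^n"
      proof -
        have "\<bar>F (\<lambda>x. u x - f n x)\<bar> \<le> \<bar>K\<bar> * L2_norm M (\<lambda>x. u x - f n x)"
          using bound[OF uf] mult_right_mono[OF abs_ge_self[of K] L2_norm_nonneg] by (rule order_trans)
        also have "\<dots> \<le> \<bar>K\<bar> * (1/2)^n"
          using ub[of n] by (intro mult_left_mono) auto
        finally show ?thesis .
      qed
      ultimately show ?thesis
        unfolding J_def by linarith
    qed
    have nb: "L2_norm M (f n) \<le> L2_norm M u + 1" for n
    proof -
      have uf: "(\<lambda>x. (-1) *\<^sub>R (u x - f n x)) \<in> L2 M"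
        by (intro L2_diff u f L2_scaleR)
      have "L2_norm M (f n) \<le> L2_norm M u + (1/2)^n"
        using L2_norm_triangle[OF u uf] ub[of n] by (simp only: L2_norm_scaleR) simp
      also have "(1/2::real)^n \<le> 1"
        by (simp add: power_le_one)
      finally show ?thesis by simp
    qed
    have "J u \<le> m + (1/2)^n * (2 * (L2_norm M u + 1) + 2 * \<bar>K\<bar> + 2)" for n
    proof -
      have "J u \<le> J (f n) + (1/2)^n * (2 * L2_norm M (f n) + (1/2)^n + 2 * \<bar>K\<bar>)"
        using J_le[of n] by (simp add: J_def power2_eq_square algebra_simps)
      also have "J (f n) \<le> m + (1/2)^n * 1"
      proof -
        have "0 \<le> (1/4::real)^n" "(1/4::real)^n \<le> (1/2)^n"
          by (auto intro: power_mono)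
        with Jf[of n] show ?thesis
          by linarith
      qed
      also have "m + (1/2)^n * 1 + (1/2)^n * (2 * L2_norm M (f n) + (1/2)^n + 2 * \<bar>K\<bar>) =
          m + (1/2)^n * (2 * L2_norm M (f n) + (1/2)^n + 2 * \<bar>K\<bar> + 1)"
        by (simp add: algebra_simps)
      also have "\<dots> \<le> m + (1/2)^n * (2 * (L2_norm M u + 1) + 2 * \<bar>K\<bar> + 2)"
        using nb[of n] power_le_one[of "1/2::real" n] by (intro add_left_mono mult_left_mono) auto
      finally show ?thesis by simp
    qed
    moreover have "(\<lambda>n. m + (1/2)^n * (2 * (L2_norm M u + 1) + 2 * \<bar>K\<bar> + 2)) \<longlonglongrightarrow> m + 0 * (2 * (L2_norm M u +
        1) + 2 * \<bar>K\<bar> + 2)"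
      by (intro tendsto_intros LIMSEQ_power_zero) auto
    ultimately show "J u \<le> m"
      by (intro LIMSEQ_le_const[of _ m]) auto
  qed
  have "F g = (LINT x|M. u x \<bullet> g x)" if g: "g \<in> L2 M" for g
  proof -
    define D where "D = (LINT x|M. u x \<bullet> g x) - F g"
    have q: "0 \<le> 2 * t * D + t\<^sup>2 * (L2_norm M g)\<^sup>2" for t
    proof -
      have "m \<le> J (\<lambda>x. 1 *\<^sub>R u x + t *\<^sub>R g x)"
        by (intro mle L2_lincomb u g)
      then show ?thesis
        using \<open>J u \<le> m\<close> unfolding J_def D_def L2_lincomb(2)[OF u g] lin[OF u g]
        by (simp add: algebra_simps)
    qed
    have "D = 0"
    proof (rule ccontr)
      assume D: "D \<noteq> 0"
      \<comment> \<open>The added 1 keeps the denominator positive when the seminorm of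
        \<open>g\<close> is zero; \<open>t = - D / s\<close> then makes the quadratic
        negative.\<close>
      define s where "s = (L2_norm M g)\<^sup>2 + 1"
      have s: "s > 0" "(L2_norm M g)\<^sup>2 < s" by (auto simp: s_def add_nonneg_pos)
      have "2 * (- D / s) * D + (- D / s)\<^sup>2 * (L2_norm M g)\<^sup>2 < 2 * (- D / s) * D + (- D / s)\<^sup>2 * s"
        using s D by (intro add_strict_left_mono mult_strict_left_mono) auto
      also have "\<dots> = - (D\<^sup>2 / s)"
        using s by (simp add: field_simps power2_eq_square)
      also have "\<dots> < 0"
        using s D by simp
      finally show False
        using q[of "- D / s"] by linarith
    qed
    then show ?thesis
      by (simp add: D_def)
  qed
  with u show ?thesis
    by blast
qed

text \<open>Tonelli applied to the squared norm identifies L2 of the product with L2 of the first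
  factor with values in L2 of the second. The last bound is Cauchy-Schwarz on the finite measure
  \<open>A\<close>; it makes the mixed L1-L2 norm continuous for the L2 norm.\<close>

lemma L2_prod_sections:
  fixes f :: "'e \<times> 'x \<Rightarrow> 'b::euclidean_space"
  assumes A: "finite_measure A" and P: "finite_measure P" and f: "f \<in> L2 (A \<Otimes>\<^sub>M P)"
  shows "AE e in A. (\<lambda>x. f (e, x)) \<in> L2 P"
    and "(\<lambda>e. L2_norm P (\<lambda>x. f (e, x))) \<in> L2 A"
    and "L2_norm A (\<lambda>e. L2_norm P (\<lambda>x. f (e, x))) = L2_norm (A \<Otimes>\<^sub>M P) f"
    and "(LINT e|A. L2_norm P (\<lambda>x. f (e, x))) \<le> sqrt (measure A (space A)) * L2_norm (A \<Otimes>\<^sub>M P) f"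
proof -
  interpret A: finite_measure A by fact
  interpret P: finite_measure P by fact
  interpret AP: pair_sigma_finite A P ..
  have [measurable]: "f \<in> borel_measurable (A \<Otimes>\<^sub>M P)"
    using f by (rule L2D)
  have int: "integrable (A \<Otimes>\<^sub>M P) (\<lambda>(e, x). (norm (f (e, x)))\<^sup>2)"
    using L2D(2)[OF f] by (simp add: case_prod_beta')
  show "AE e in A. (\<lambda>x. f (e, x)) \<in> L2 P"
    using AP.AE_integrable_fst[OF int] AE_space
  proof eventually_elim
    case (elim e)
    show ?case
    proof (rule L2I)
      show "(\<lambda>x. f (e, x)) \<in> borel_measurable P"
        using elim(2) by measurable
    qed (use elim in simp)
  qed
  have [measurable]: "(\<lambda>e. L2_norm P (\<lambda>x. f (e, x))) \<in> borel_measurable A"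
    unfolding L2_norm_def by measurable
  show N: "(\<lambda>e. L2_norm P (\<lambda>x. f (e, x))) \<in> L2 A"
  proof (rule L2I)
    show "integrable A (\<lambda>e. (norm (L2_norm P (\<lambda>x. f (e, x))))\<^sup>2)"
      using AP.integrable_fst'[OF int] by (simp add: L2_norm_power2)
  qed measurable
  show eq: "L2_norm A (\<lambda>e. L2_norm P (\<lambda>x. f (e, x))) = L2_norm (A \<Otimes>\<^sub>M P) f"
    using AP.integral_fst'[OF int] by (simp add: L2_norm_def[of A] L2_norm_def[of "A \<Otimes>\<^sub>M P"]
        L2_norm_power2 case_prod_beta')
  show "(LINT e|A. L2_norm P (\<lambda>x. f (e, x))) \<le> sqrt (measure A (space A)) * L2_norm (A \<Otimes>\<^sub>M P) f"
    using A.L2_integrable(2)[OF N] by (simp add: eq L2_norm_nonneg)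
qed

text \<open>The pairs \<open>(a, b)\<close> of the duality argument are functions into a product of
  Euclidean spaces, so that one application of the Riesz theorem represents both components.\<close>

lemma L2_fst_snd:
  assumes "h \<in> L2 M"
  shows "(\<lambda>x. fst (h x)) \<in> L2 M" "(\<lambda>x. snd (h x)) \<in> L2 M"
    and "L2_norm M (\<lambda>x. fst (h x)) \<le> L2_norm M h" "L2_norm M (\<lambda>x. snd (h x)) \<le> L2_norm M h"
proof -
  have m: "h \<in> borel_measurable M" and i: "integrable M (\<lambda>x. (norm (h x))\<^sup>2)"
    using L2D[OF assms] by auto
  have le: "(norm (fst (h x)))\<^sup>2 \<le> (norm (h x))\<^sup>2" "(norm (snd (h x)))\<^sup>2 \<le> (norm (h x))\<^sup>2" for x
    by (auto intro!: power_mono norm_fst_le norm_snd_le simp: norm_prod_def)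
  have mf: "(\<lambda>x. fst (h x)) \<in> borel_measurable M" "(\<lambda>x. snd (h x)) \<in> borel_measurable M"
    using m by (auto simp: borel_prod[symmetric])
  have mi: "integrable M (\<lambda>x. (norm (fst (h x)))\<^sup>2)" "integrable M (\<lambda>x. (norm (snd (h x)))\<^sup>2)"
    using mf le by (auto intro!: Bochner_Integration.integrable_bound[OF i])
  show "(\<lambda>x. fst (h x)) \<in> L2 M" "(\<lambda>x. snd (h x)) \<in> L2 M"
    using mf mi by (auto intro: L2I)
  show "L2_norm M (\<lambda>x. fst (h x)) \<le> L2_norm M h" "L2_norm M (\<lambda>x. snd (h x)) \<le> L2_norm M h"
    unfolding L2_norm_def using mi i le by (auto intro!: integral_mono)
qed

text \<open>Domination by the \<open>L\<^sup>1(A; L\<^sup>2(P))\<close>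
  norm of the first component is what puts \<open>\<psi>\<close> into \<open>L\<^sup>\<infinity>(A; L\<^sup>2(P))\<close>.\<close>

lemma L1_L2_dominated_representation:
  fixes W :: "(('e \<times> 'x \<Rightarrow> real \<times> 'b::euclidean_space) \<times> real) set"
  assumes A: "finite_measure A" and P: "finite_measure P"
    and W: "subspace W" and WL2: "fst ` W \<subseteq> L2 (A \<Otimes>\<^sub>M P)" and K: "0 \<le> K"
    and dom: "\<And>h c. (h, c) \<in> W \<Longrightarrow>
      c \<le> K * ((LINT e|A. L2_norm P (\<lambda>x. fst (h (e, x)))) + L2_norm (A \<Otimes>\<^sub>M P) (\<lambda>y. snd (h y)))"
  shows "\<exists>\<psi> g. \<psi> \<in> L2 (A \<Otimes>\<^sub>M P) \<and> g \<in> L2 (A \<Otimes>\<^sub>M P) \<and>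
    (AE e in A. L2_norm P (\<lambda>x. \<psi> (e, x)) \<le> K) \<and>
    (\<forall>(h, c)\<in>W. c = (LINT y|(A \<Otimes>\<^sub>M P). \<psi> y * fst (h y) + g y \<bullet> snd (h y)))"
proof -
  interpret A: finite_measure A by fact
  interpret P: finite_measure P by fact
  interpret AP: pair_sigma_finite A P ..
  let ?M = "A \<Otimes>\<^sub>M P"
  interpret M: finite_measure ?M
    by (rule finite_measure_pair_measure) fact+
  define N where "N h e = L2_norm P (\<lambda>x. fst (h (e, x)))" for h :: "'e \<times> 'x \<Rightarrow> real \<times> 'b" and e
  define p where "p h = K * ((LINT e|A. N h e) + L2_norm ?M (\<lambda>y. snd (h y)))" for h :: "'e \<times> 'x \<Rightarrow> real \<times> 'b"
  have Nint: "integrable A (N h)" if "h \<in> L2 ?M" for h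
    unfolding N_def[abs_def] using A.L2_integrable(1)[OF L2_prod_sections(2)[OF A P L2_fst_snd(1)[OF
        that]]] by simp
  have padd: "p (h + k) \<le> p h + p k" if h: "h \<in> L2 ?M" and k: "k \<in> L2 ?M" for h k
  proof -
    have "(LINT e|A. N (h + k) e) \<le> (LINT e|A. N h e + N k e)"
    proof (rule integral_mono_AE)
      show "integrable A (N (h + k))"
        using subspace_add[OF subspace_L2 h k] by (rule Nint)
      show "integrable A (\<lambda>e. N h e + N k e)"
        using Nint[OF h] Nint[OF k] by simp
      show "AE e in A. N (h + k) e \<le> N h e + N k e"
        using L2_prod_sections(1)[OF A P L2_fst_snd(1)[OF h]] L2_prod_sections(1)[OF A P L2_fst_snd(1)[OF k]]
        by eventually_elim (use L2_norm_triangle in \<open>auto simp: N_def plus_fun_def\<close>)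
    qed
    also have "\<dots> = (LINT e|A. N h e) + (LINT e|A. N k e)"
      by (intro Bochner_Integration.integral_add Nint h k)
    finally have "(LINT e|A. N (h + k) e) \<le> (LINT e|A. N h e) + (LINT e|A. N k e)" .
    moreover have "L2_norm ?M (\<lambda>y. snd ((h + k) y)) \<le> L2_norm ?M (\<lambda>y. snd (h y)) + L2_norm ?M (\<lambda>y. snd (k y))"
      using L2_norm_triangle[OF L2_fst_snd(2)[OF h] L2_fst_snd(2)[OF k]] by (simp add: plus_fun_def)
    ultimately have "p (h + k) \<le> K * (((LINT e|A. N h e) + L2_norm ?M (\<lambda>y. snd (h y))) + ((LINT e|A. N k
        e) + L2_norm ?M (\<lambda>y. snd (k y))))"
      unfolding p_def using K by (intro mult_left_mono) auto
    then show ?thesis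
      by (simp add: p_def distrib_left)
  qed
  have pscale: "p (c *\<^sub>R h) = \<bar>c\<bar> * p h" for c h
  proof -
    have "N (c *\<^sub>R h) e = \<bar>c\<bar> * N h e" for e
      using L2_norm_scaleR[of P c "\<lambda>x. fst (h (e, x))"] by (simp add: N_def scaleR_fun_def)
    then show ?thesis
      using L2_norm_scaleR[of ?M c "\<lambda>y. snd (h y)"] by (simp add: p_def scaleR_fun_def algebra_simps)
  qed
  \<comment> \<open>Domination by \<open>p\<close> implies boundedness in L2, which the Riesz
    theorem asks for.\<close>
  define K' where "K' = K * (sqrt (measure A (space A)) + 1)"
  have pK: "p h \<le> K' * L2_norm ?M h" if h: "h \<in> L2 ?M" for h
  proof -
    have "(LINT e|A. N h e) \<le> sqrt (measure A (space A)) * L2_norm ?M (\<lambda>y. fst (h y))"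
      unfolding N_def by (rule L2_prod_sections(4)[OF A P L2_fst_snd(1)[OF h]])
    also have "\<dots> \<le> sqrt (measure A (space A)) * L2_norm ?M h"
      by (intro mult_left_mono L2_fst_snd h) auto
    finally have "p h \<le> K * (sqrt (measure A (space A)) * L2_norm ?M h + L2_norm ?M h)"
      unfolding p_def using L2_fst_snd(4)[OF h] K by (intro mult_left_mono) auto
    then show ?thesis
      by (simp add: K'_def algebra_simps)
  qed
  have "\<exists>F. (\<forall>x\<in>L2 ?M. \<forall>y\<in>L2 ?M. F (x + y) = F x + F y) \<and> (\<forall>c. \<forall>x\<in>L2 ?M. F (c *\<^sub>R x) = c * F x) \<and>
    (\<forall>x\<in>L2 ?M. F x \<le> p x) \<and> (\<forall>(x, y)\<in>W. F x = y)"
  proof (rule hahn_banach)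
    show "subspace (L2 ?M)" "subspace W" "fst ` W \<subseteq> L2 ?M"
      by (fact subspace_L2 W WL2)+
    show "p (x + y) \<le> p x + p y" if "x \<in> L2 ?M" "y \<in> L2 ?M" for x y
      using that by (rule padd)
    show "p (c *\<^sub>R x) = c * p x" if "0 < c" for c x
      using pscale[of c x] that by simp
    show "y \<le> p x" if "(x, y) \<in> W" for x y
      unfolding p_def N_def by (rule dom[OF that])
  qed
  then obtain F where F: "(\<forall>x\<in>L2 ?M. \<forall>y\<in>L2 ?M. F (x + y) = F x + F y) \<and>
    (\<forall>c. \<forall>x\<in>L2 ?M. F (c *\<^sub>R x) = c * F x) \<and> (\<forall>x\<in>L2 ?M. F x \<le> p x) \<and> (\<forall>(x, y)\<in>W. F x = y)"
    by (rule exE)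
  then have Fadd: "\<And>x y. x \<in> L2 ?M \<Longrightarrow> y \<in> L2 ?M \<Longrightarrow> F (x + y) = F x + F y"
    and Fscale: "\<And>c x. x \<in> L2 ?M \<Longrightarrow> F (c *\<^sub>R x) = c * F x"
    and Fp: "\<And>x. x \<in> L2 ?M \<Longrightarrow> F x \<le> p x"
    by simp_all
  have FW: "\<And>x y. (x, y) \<in> W \<Longrightarrow> F x = y"
    using F by auto
  have Fbound: "\<bar>F h\<bar> \<le> K' * L2_norm ?M h" if h: "h \<in> L2 ?M" for h
  proof -
    have "- F h = F ((-1) *\<^sub>R h)"
      using Fscale[OF h, of "-1"] by simp
    also have "\<dots> \<le> p ((-1) *\<^sub>R h)"
      by (intro Fp subspace_scale subspace_L2 h)
    finally show ?thesis
      using Fp[OF h] pK[OF h] pscale[of "-1" h] by simp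
  qed
  have "\<exists>u\<in>L2 ?M. \<forall>h\<in>L2 ?M. F h = (LINT y|?M. u y \<bullet> h y)"
    using Fadd Fscale Fbound by (intro M.L2_Riesz[where K = K']) (auto simp: plus_fun_def scaleR_fun_def)
  then obtain u where u: "u \<in> L2 ?M" and Fu: "\<And>h. h \<in> L2 ?M \<Longrightarrow> F h = (LINT y|?M. u y \<bullet> h y)"
    by blast
  define \<psi> where "\<psi> y = fst (u y)" for y
  define g where "g y = snd (u y)" for y
  have \<psi>: "\<psi> \<in> L2 ?M" and g: "g \<in> L2 ?M"
    unfolding \<psi>_def[abs_def] g_def[abs_def] by (intro L2_fst_snd u)+
  have [measurable]: "\<psi> \<in> borel_measurable ?M"
    using \<psi> by (rule L2D)
  define n where "n e = L2_norm P (\<lambda>x. \<psi> (e, x))" for e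
  have nL2: "n \<in> L2 A"
    unfolding n_def[abs_def] by (rule L2_prod_sections(2)[OF A P \<psi>])
  have [measurable]: "n \<in> borel_measurable A"
    using nL2 by (rule L2D)
  have nint: "integrable A n" "integrable A (\<lambda>e. (n e)\<^sup>2)"
    using A.L2_integrable(1)[OF nL2] L2D(2)[OF nL2] by auto
  \<comment> \<open>\<open>B\<close> consists of the energies where the norm exceeds
    \<open>K\<close>. Testing \<open>F\<close> with \<open>\<psi>\<close> cut off to
    \<open>B\<close> makes the integral of \<open>n^2\<close> over \<open>B\<close> at most
    \<open>K\<close> times that of \<open>n\<close>; since \<open>n > K\<close> there,
    \<open>B\<close> is a null set.\<close>
  define B where "B = {e \<in> space A. K < n e}"
  have [measurable]: "B \<in> sets A"
    unfolding B_def by measurable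
  define h :: "'e \<times> 'x \<Rightarrow> real \<times> 'b" where "h y = (indicator B (fst y) * \<psi> y, 0)" for y
  have h: "h \<in> L2 ?M"
  proof (rule L2I)
    have "(\<lambda>y. indicator B (fst y) * \<psi> y) \<in> borel_measurable ?M"
      by measurable
    then have "h \<in> ?M \<rightarrow>\<^sub>M (borel \<Otimes>\<^sub>M borel)"
      unfolding h_def[abs_def] by (intro measurable_Pair) auto
    then show hm: "h \<in> borel_measurable ?M"
      by (simp add: borel_prod)
    show "integrable ?M (\<lambda>y. (norm (h y))\<^sup>2)"
      using hm by (intro Bochner_Integration.integrable_bound[OF L2D(2)[OF \<psi>]])
        (auto simp: h_def norm_prod_def indicator_def)
  qed
  have sq: "(LINT x|P. (indicator B e * \<psi> (e, x))\<^sup>2) = indicator B e * (n e)\<^sup>2" for e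
    by (simp add: n_def L2_norm_power2 power_mult_distrib indicator_def)
  have "F h = (LINT y|?M. (indicator B (fst y) * \<psi> y)\<^sup>2)"
    unfolding Fu[OF h] by (intro Bochner_Integration.integral_cong)
      (auto simp: h_def \<psi>_def inner_prod_def indicator_def power2_eq_square)
  also have "\<dots> = (LINT e|A. (LINT x|P. (indicator B e * \<psi> (e, x))\<^sup>2))"
    using AP.integral_fst'[of "\<lambda>y. (indicator B (fst y) * \<psi> y)\<^sup>2"] L2D(2)[OF L2_fst_snd(1)[OF h]]
    by (simp add: h_def)
  finally have "F h = (LINT e|A. indicator B e * (n e)\<^sup>2)"
    by (simp add: sq)
  moreover have "p h = K * (LINT e|A. indicator B e * n e)"
  proof -
    have "N h e = indicator B e * n e" for e
      using L2_norm_scaleR[of P "indicator B e" "\<lambda>x. \<psi> (e, x)"] by (simp add: N_def h_def n_def)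
    then show ?thesis
      by (simp add: p_def h_def L2_norm_def)
  qed
  ultimately have "(LINT e|A. indicator B e * (n e)\<^sup>2) \<le> K * (LINT e|A. indicator B e * n e)"
    using Fp[OF h] by simp
  moreover have i1: "integrable A (\<lambda>e. indicator B e * (n e)\<^sup>2)" and i2: "integrable A (\<lambda>e. indicator B e
      * n e)"
    using integrable_real_mult_indicator[OF \<open>B \<in> sets A\<close> nint(1)] integrable_real_mult_indicator[OF \<open>B \<in>
        sets A\<close> nint(2)]
    by (simp_all add: mult.commute)
  ultimately have le0: "(LINT e|A. indicator B e * (n e)\<^sup>2 - K * (indicator B e * n e)) \<le> 0"
    by (subst Bochner_Integration.integral_diff) auto
  have nn: "0 \<le> indicator B e * (n e)\<^sup>2 - K * (indicator B e * n e)" for e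
    using K by (auto simp: indicator_def B_def power2_eq_square intro!: mult_right_mono)
  have "(LINT e|A. indicator B e * (n e)\<^sup>2 - K * (indicator B e * n e)) = 0"
    using le0 nn by (intro antisym integral_nonneg_AE) auto
  then have "AE e in A. indicator B e * (n e)\<^sup>2 - K * (indicator B e * n e) = 0"
    using nn i1 i2 by (subst (asm) integral_nonneg_eq_0_iff_AE) auto
  then have "AE e in A. n e \<le> K"
    using AE_space
  proof eventually_elim
    case (elim e)
    show ?case
    proof (rule ccontr)
      assume "\<not> n e \<le> K"
      then have "e \<in> B" "K < n e" "0 < n e"
        using elim(2) K by (auto simp: B_def)
      with elim(1) show False
        by (simp add: power2_eq_square)
    qed
  qed
  moreover have "c = (LINT y|?M. \<psi> y * fst (k y) + g y \<bullet> snd (k y))" if kc: "(k, c) \<in> W" for k c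
  proof -
    have "k \<in> L2 ?M"
      using WL2 kc by (auto simp: image_subset_iff)
    then show ?thesis
      using FW[OF kc] Fu by (simp add: \<psi>_def g_def inner_prod_def)
  qed
  ultimately show ?thesis
    using \<psi> g by (intro exI[of _ \<psi>] exI[of _ g]) (auto simp: n_def)
qed

subsection \<open>Rotations of the sphere\<close>

text \<open>The starting point is invariance for images of sets of finite Lebesgue measure.
  Boundedness supplies finiteness, and surjectivity makes \<open>X\<close> the image of its
  preimage; preimages are what push-forward measures require.\<close>

lemma emeasure_lborel_orthogonal_vimage:
  fixes T :: "real^3 \<Rightarrow> real^3"
  assumes T: "orthogonal_transformation T" and X: "X \<in> sets borel" "bounded X"
  shows "emeasure lborel (T -` X) = emeasure lborel X"
proof -
  have "continuous_on UNIV T"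
    using T by (intro linear_continuous_on) (simp add: orthogonal_transformation_linear linear_linear)
  then have Tm: "T \<in> borel_measurable borel"
    by (intro borel_measurable_continuous_onI)
  have Y: "T -` X \<in> sets borel"
    using measurable_sets[OF Tm X(1)] by simp
  have nT: "norm (T x) = norm x" for x
    using T by (simp add: orthogonal_transformation_norm)
  have bY: "bounded (T -` X)"
  proof -
    obtain b where "\<And>x. x \<in> X \<Longrightarrow> norm x \<le> b"
      using X(2) unfolding bounded_iff by blast
    then have "norm x \<le> b" if "x \<in> T -` X" for x
      using that nT[of x] by force
    then show ?thesis
      unfolding bounded_iff by blast
  qed
  have lm: "T -` X \<in> lmeasurable" "X \<in> lmeasurable"
    using Y X bY by (auto intro!: bounded_set_imp_lmeasurable)
  have "T ` (T -` X) = X"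
    using orthogonal_transformation_surj[OF T] by (simp add: image_vimage_eq)
  then have "measure lebesgue (T -` X) = measure lebesgue X"
    using measure_orthogonal_image[OF T lm(1)] by simp
  then have "emeasure lebesgue (T -` X) = emeasure lebesgue X"
    using lm by (simp add: emeasure_eq_measure2)
  then show ?thesis
    using Y X by simp
qed

lemma space_sphere_measure [simp]: "space sphere_measure = sphere 0 1"
  and sets_sphere_measure [measurable_cong]: "sets sphere_measure = sets (restrict_space borel (sphere 0 1))"
  by (simp_all add: sphere_measure_def space_restrict_space space_scale_measure)

lemma measurable_radial_projection:
  "(\<lambda>x::real^3. x /\<^sub>R norm x) \<in> restrict_space lborel (ball 0 1 - {0}) \<rightarrow>\<^sub>M restrict_space borel (sphere 0 1)"
proof (rule measurable_restrict_space2)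
  show "(\<lambda>x::real^3. x /\<^sub>R norm x) \<in> restrict_space lborel (ball 0 1 - {0}) \<rightarrow>\<^sub>M borel"
    by (intro measurable_restrict_space1) measurable
qed (auto simp: space_restrict_space)

lemma emeasure_sphere_measure:
  assumes "A \<in> sets borel" "A \<subseteq> sphere 0 1"
  shows "emeasure sphere_measure A = 3 * emeasure lborel {x. norm x < 1 \<and> x \<noteq> 0 \<and> x /\<^sub>R norm x \<in> A}"
proof -
  have A: "A \<in> sets (restrict_space borel (sphere 0 1))"
    using assms by (subst sets_restrict_space_iff) auto
  have eq: "(\<lambda>x. x /\<^sub>R norm x) -` A \<inter> space (restrict_space lborel (ball 0 1 - {0})) =
      {x. norm x < 1 \<and> x \<noteq> 0 \<and> x /\<^sub>R norm x \<in> A}"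
    by (auto simp: space_restrict_space)
  have "emeasure sphere_measure A = 3 * emeasure (restrict_space lborel (ball 0 1 - {0})) {x. norm x < 1 \<and>
      x \<noteq> 0 \<and> x /\<^sub>R norm x \<in> A}"
    unfolding sphere_measure_def using A
    by (simp only: emeasure_scale_measure emeasure_distr[OF measurable_radial_projection] eq)
  also have "emeasure (restrict_space lborel (ball 0 1 - {0})) {x. norm x < 1 \<and> x \<noteq> 0 \<and> x /\<^sub>R norm x \<in> A} =
      emeasure lborel {x. norm x < 1 \<and> x \<noteq> 0 \<and> x /\<^sub>R norm x \<in> A}"
    by (rule emeasure_restrict_space) auto
  finally show ?thesis .
qed

lemma finite_sphere_measure: "finite_measure sphere_measure"
proof
  have "emeasure lborel {x::real^3. norm x < 1 \<and> x \<noteq> 0 \<and> x /\<^sub>R norm x \<in> sphere 0 1} \<le> emeasure lborel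
      (ball (0::real^3) 1)"
    by (intro emeasure_mono) auto
  also have "\<dots> < \<infinity>"
    by (rule emeasure_bounded_finite) simp
  finally show "emeasure sphere_measure (space sphere_measure) \<noteq> \<infinity>"
    using emeasure_sphere_measure[of "sphere 0 1"] by (simp add: ennreal_mult_eq_top_iff)
qed

interpretation sphere_measure: finite_measure sphere_measure
  by (rule finite_sphere_measure)

lemma continuous_on_sphere_measurable:
  fixes f :: "real^3 \<Rightarrow> 'b::topological_space"
  assumes "continuous_on (sphere 0 1) f"
  shows "f \<in> borel_measurable sphere_measure"
  unfolding measurable_cong_sets[OF sets_sphere_measure refl]
  by (rule borel_measurable_continuous_on_restrict[OF assms])

lemma continuous_on_sphere_integrable:
  fixes f :: "real^3 \<Rightarrow> real"
  assumes "continuous_on (sphere 0 1) f"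
  shows "integrable sphere_measure f"
proof -
  have "compact (f ` sphere 0 1)"
    using assms by (intro compact_continuous_image) auto
  then have "bounded (f ` sphere 0 1)"
    by (rule compact_imp_bounded)
  then obtain B where "\<And>s. s \<in> sphere 0 1 \<Longrightarrow> \<bar>f s\<bar> \<le> B"
    unfolding bounded_iff real_norm_def by blast
  then show ?thesis
    by (intro sphere_measure.integrable_const_bound[of _ B] continuous_on_sphere_measurable assms AE_I2) auto
qed

text \<open>The surface measure is a cone measure, and the cone over a preimage is the preimage of
  the cone because \<open>T\<close> is linear and preserves norms. Invariance of volume does the
  rest.\<close>

lemma distr_sphere_measure_orthogonal:
  assumes T: "orthogonal_transformation T"
  shows "distr sphere_measure sphere_measure T = sphere_measure"
    and "T \<in> sphere_measure \<rightarrow>\<^sub>M sphere_measure"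
proof -
  have nT: "norm (T x) = norm x" for x
    using T by (simp add: orthogonal_transformation_norm)
  have lT: "linear T"
    using T by (rule orthogonal_transformation_linear)
  have cT: "continuous_on S T" for S
    using lT by (intro linear_continuous_on) (simp add: linear_linear)
  have Tb: "T \<in> borel_measurable borel"
    using cT by (intro borel_measurable_continuous_onI)
  have "T \<in> restrict_space borel (sphere 0 1) \<rightarrow>\<^sub>M restrict_space borel (sphere 0 1)"
    using Tb by (intro measurable_restrict_space2 measurable_restrict_space1) (auto simp:
        space_restrict_space nT)
  then show T': "T \<in> sphere_measure \<rightarrow>\<^sub>M sphere_measure"
    unfolding measurable_cong_sets[OF sets_sphere_measure sets_sphere_measure] .
  show "distr sphere_measure sphere_measure T = sphere_measure"
  proof (rule measure_eqI)
    fix A assume "A \<in> sets (distr sphere_measure sphere_measure T)"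
    then have A: "A \<in> sets sphere_measure"
      by simp
    then have Ab: "A \<in> sets borel" "A \<subseteq> sphere 0 1"
      by (auto simp: sets_sphere_measure sets_restrict_space_iff)
    have Bb: "T -` A \<inter> sphere 0 1 \<in> sets borel"
      using measurable_sets[OF Tb Ab(1)] by simp
    let ?X = "{x. norm x < 1 \<and> x \<noteq> 0 \<and> x /\<^sub>R norm x \<in> A}"
    have "?X = (\<lambda>x. x /\<^sub>R norm x) -` A \<inter> (ball 0 1 - {0})"
      by auto
    moreover have "(\<lambda>x::real^3. x /\<^sub>R norm x) -` A \<inter> space borel \<in> sets borel"
      by (rule measurable_sets[OF _ Ab(1)]) measurable
    ultimately have X: "?X \<in> sets borel" "bounded ?X"
      by (auto intro: bounded_subset[of "ball 0 1"])
    have "emeasure (distr sphere_measure sphere_measure T) A = emeasure sphere_measure (T -` A \<inter> sphere 0 1)"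
      using A T' by (simp add: emeasure_distr)
    also have "\<dots> = 3 * emeasure lborel {x. norm x < 1 \<and> x \<noteq> 0 \<and> x /\<^sub>R norm x \<in> T -` A \<inter> sphere 0 1}"
      using Bb by (rule emeasure_sphere_measure) auto
    also have "{x. norm x < 1 \<and> x \<noteq> 0 \<and> x /\<^sub>R norm x \<in> T -` A \<inter> sphere 0 1} = T -` ?X"
    proof -
      have 0: "T x = 0 \<longleftrightarrow> x = 0" for x
        using nT[of x] norm_eq_zero[of x] norm_eq_zero[of "T x"] by simp
      have "x \<in> {x. norm x < 1 \<and> x \<noteq> 0 \<and> x /\<^sub>R norm x \<in> T -` A \<inter> sphere 0 1} \<longleftrightarrow> x \<in> T -` ?X" for x
        using linear_cmul[OF lT, of "inverse (norm x)" x] by (cases "x = 0") (simp_all add: nT 0)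
      then show ?thesis
        by blast
    qed
    also have "emeasure lborel \<dots> = emeasure lborel ?X"
      by (rule emeasure_lborel_orthogonal_vimage[OF T X])
    also have "3 * \<dots> = emeasure sphere_measure A"
      using Ab by (rule emeasure_sphere_measure[symmetric])
    finally show "emeasure (distr sphere_measure sphere_measure T) A = emeasure sphere_measure A" .
  qed simp
qed

text \<open>Rodrigues' formula: for a unit vector \<open>w\<close>, the rotation about the axis
  \<open>w\<close> by the angle \<open>t\<close>.\<close>

definition rot :: "real^3 \<Rightarrow> real \<Rightarrow> real^3 \<Rightarrow> real^3" where
  "rot w t x = cos t *\<^sub>R x + sin t *\<^sub>R cross3 w x + ((1 - cos t) * (w \<bullet> x)) *\<^sub>R w"

lemma norm_rot:
  assumes "norm w = 1"
  shows "norm (rot w t x) = norm x"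
proof -
  have w: "w \<bullet> w = 1"
    using assms by (simp add: norm_eq_1)
  have y: "cross3 w x \<bullet> cross3 w x = x \<bullet> x - (w \<bullet> x)\<^sup>2"
    using norm_cross_dot[of w x] assms by (simp add: power2_norm_eq_inner[symmetric] power_mult_distrib)
  have o: "cross3 w x \<bullet> w = 0" "cross3 w x \<bullet> x = 0" "w \<bullet> cross3 w x = 0" "x \<bullet> cross3 w x = 0"
    by (simp_all add: dot_cross_self)
  have sc: "(sin t)\<^sup>2 = 1 - (cos t)\<^sup>2"
    by (simp add: sin_squared_eq)
  have "rot w t x \<bullet> rot w t x = (cos t)\<^sup>2 * (x \<bullet> x) + (sin t)\<^sup>2 * (x \<bullet> x - (w \<bullet> x)\<^sup>2)
      + ((1 - cos t) * (w \<bullet> x))\<^sup>2 + 2 * cos t * ((1 - cos t) * (w \<bullet> x)) * (w \<bullet> x)"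
    by (simp add: rot_def inner_add inner_commute[of x w] o y w power2_eq_square algebra_simps)
  also have "\<dots> = x \<bullet> x"
    unfolding sc by (simp add: power2_eq_square algebra_simps)
  finally show ?thesis
    by (simp add: norm_eq_sqrt_inner)
qed

lemma orthogonal_rot:
  assumes "norm w = 1"
  shows "orthogonal_transformation (rot w t)"
proof -
  have "linear (rot w t)"
    by (rule linearI) (simp_all add: rot_def cross_add_right cross_mult_right inner_add algebra_simps)
  with norm_rot[OF assms] show ?thesis
    by (simp add: orthogonal_transformation)
qed

text \<open>The rotations form the flow of the linear field \<open>cross3 w\<close>; the
  verification rests on the identity
  \<open>w \<times> (w \<times> x) = (w \<bullet> x) w - x\<close> for unit
  \<open>w\<close>.\<close>

lemma rot_has_vector_derivative:
  assumes "norm w = 1"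
  shows "((\<lambda>t. rot w t x) has_vector_derivative cross3 w (rot w t x)) (at t)"
proof -
  have w: "w \<bullet> w = 1"
    using assms by (simp add: norm_eq_1)
  have ww: "cross3 w (cross3 w x) = (w \<bullet> x) *\<^sub>R w - x"
    using Lagrange[of w w x] by (simp add: w)
  have eq: "cross3 w (rot w t x) = - sin t *\<^sub>R x + cos t *\<^sub>R cross3 w x + (sin t * (w \<bullet> x)) *\<^sub>R w"
  proof -
    have "cross3 w (rot w t x) = cos t *\<^sub>R cross3 w x + sin t *\<^sub>R cross3 w (cross3 w x)"
      by (simp add: rot_def cross_add_right cross_mult_right)
    then show ?thesis
      by (simp add: ww scaleR_diff_right algebra_simps)
  qed
  show ?thesis
    unfolding eq unfolding rot_def
    by (auto intro!: derivative_eq_intros simp: algebra_simps)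
qed

text \<open>The rotations about the axis \<open>w\<close> preserve the surface measure, and \<open>s \<mapsto> w \<times> s\<close> is the
  vector field that generates them.\<close>

lemma integral_rotation_derivative_eq_0:
  fixes f :: "real^3 \<Rightarrow> real"
  assumes w: "norm w = 1"
    and f': "\<And>s. s \<in> sphere 0 1 \<Longrightarrow> (f has_derivative f' s) (at s)"
    and bd: "\<And>s. s \<in> sphere 0 1 \<Longrightarrow> \<bar>f' s (cross3 w s)\<bar> \<le> B"
  shows "(LINT s|sphere_measure. f' s (cross3 w s)) = 0"
proof -
  have cf: "continuous_on (sphere 0 1) f"
    by (intro continuous_at_imp_continuous_on ballI has_derivative_continuous[OF f'])
  define h where "h n = 1 / real (Suc n)" for n
  have h: "h n > 0" "h \<longlonglongrightarrow> 0" for n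
    unfolding h_def using LIMSEQ_inverse_real_of_nat by (auto simp: inverse_eq_divide)
  define g where "g n s = (f (rot w (h n) s) - f s) / h n" for n s
  have der: "((\<lambda>t. f (rot w t s)) has_real_derivative f' (rot w t s) (cross3 w (rot w t s))) (at t)"
    if "s \<in> sphere 0 1" for s t
  proof -
    have "rot w t s \<in> sphere 0 1"
      using that norm_rot[OF w] by simp
    then have fr: "(f has_derivative f' (rot w t s)) (at (rot w t s))"
      by (rule f')
    have "((\<lambda>t. f (rot w t s)) has_derivative (\<lambda>d. f' (rot w t s) (d *\<^sub>R cross3 w (rot w t s)))) (at t)"
      using rot_has_vector_derivative[OF w, of s t] fr
      unfolding has_vector_derivative_def by (rule has_derivative_compose)
    moreover have "(\<lambda>d. f' (rot w t s) (d *\<^sub>R cross3 w (rot w t s))) = (*) (f' (rot w t s) (cross3 w (rot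
        w t s)))"
      using linear_cmul[OF has_derivative_linear[OF fr]] by (auto simp: mult.commute)
    ultimately show ?thesis
      by (simp add: has_field_derivative_def)
  qed
  \<comment> \<open>Orbits stay on the sphere, so the mean value theorem along an orbit bounds the
    quotients by \<open>B\<close>; a constant is integrable for the finite surface measure.\<close>
  have gbd: "\<bar>g n s\<bar> \<le> B" if s: "s \<in> sphere 0 1" for n s
  proof -
    obtain z where "f (rot w (h n) s) - f (rot w 0 s) = (h n - 0) * f' (rot w z s) (cross3 w (rot w z s))"
      using MVT2[OF h(1)[of n] der[OF s]] by blast
    moreover have "\<bar>f' (rot w z s) (cross3 w (rot w z s))\<bar> \<le> B"
      using s by (intro bd) (simp add: norm_rot[OF w])
    ultimately show ?thesis
      using h(1)[of n] by (simp add: g_def rot_def[of w 0 s])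
  qed
  have glim: "(\<lambda>n. g n s) \<longlonglongrightarrow> f' s (cross3 w s)" if s: "s \<in> sphere 0 1" for s
  proof -
    have "((\<lambda>t. (f (rot w t s) - f (rot w 0 s)) / (t - 0)) \<longlongrightarrow> f' (rot w 0 s) (cross3 w (rot w 0 s))) (at 0)"
      using der[OF s, of 0] by (simp add: has_field_derivative_iff)
    moreover have "filterlim h (at 0) sequentially"
      by (intro filterlim_atI h(2) always_eventually allI less_imp_neq[OF h(1), symmetric])
    ultimately have "((\<lambda>n. (f (rot w (h n) s) - f (rot w 0 s)) / (h n - 0)) \<longlonglongrightarrow> f' (rot w 0 s) (cross3 w
        (rot w 0 s)))"
      by (rule filterlim_compose)
    then show ?thesis
      by (simp add: g_def rot_def[of w 0 s])
  qed
  have fm: "f \<in> borel_measurable sphere_measure"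
    by (rule continuous_on_sphere_measurable[OF cf])
  have rm: "rot w t \<in> sphere_measure \<rightarrow>\<^sub>M sphere_measure" for t
    by (rule distr_sphere_measure_orthogonal(2)[OF orthogonal_rot[OF w]])
  have frm: "(\<lambda>s. f (rot w t s)) \<in> borel_measurable sphere_measure" for t
    by (rule measurable_compose[OF rm fm])
  have gm: "g n \<in> borel_measurable sphere_measure" for n
    unfolding g_def[abs_def] using fm frm by measurable
  have fi: "integrable sphere_measure f"
    by (rule continuous_on_sphere_integrable[OF cf])
  have fr: "integrable sphere_measure (\<lambda>s. f (rot w t s))" "(LINT s|sphere_measure. f (rot w t s)) = (LINT
      s|sphere_measure. f s)" for t
    using integrable_distr_eq[OF rm[of t] fm] integral_distr[OF rm[of t] fm] fi
    by (simp_all add: distr_sphere_measure_orthogonal(1)[OF orthogonal_rot[OF w]])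
  \<comment> \<open>Rotation invariance cancels the two terms of each difference quotient before the
    limit is taken.\<close>
  have "(LINT s|sphere_measure. g n s) = 0" for n
    unfolding g_def using fr fi by simp
  moreover have "(\<lambda>n. LINT s|sphere_measure. g n s) \<longlonglongrightarrow> (LINT s|sphere_measure. f' s (cross3 w s))"
  proof (rule integral_dominated_convergence)
    show "(\<lambda>s. f' s (cross3 w s)) \<in> borel_measurable sphere_measure"
      by (rule borel_measurable_LIMSEQ_real[OF _ gm]) (use glim in auto)
    show "integrable sphere_measure (\<lambda>_. B)"
      by simp
    show "AE s in sphere_measure. (\<lambda>n. g n s) \<longlonglongrightarrow> f' s (cross3 w s)"
      using glim by (intro AE_I2) auto
    show "AE s in sphere_measure. norm (g n s) \<le> B" for n
      using gbd by (intro AE_I2) auto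
  qed (rule gm)
  ultimately show ?thesis
    by (simp add: LIMSEQ_const_iff)
qed

section \<open>Integration by parts on the sphere\<close>

lemma Basis_vec_real: "(Basis :: (real^'n) set) = range (\<lambda>i. axis i 1)"
  by (auto simp: Basis_vec_def)

lemma sum_Basis_axis: "(\<Sum>i\<in>(Basis :: (real^'n) set). f i) = (\<Sum>i\<in>UNIV. f (axis i 1))"
  unfolding Basis_vec_real by (subst sum.reindex) (auto simp: inj_on_def axis_eq_axis)

lemma linear_expansion_axis:
  fixes D :: "real^'n \<Rightarrow> 'b::real_vector"
  assumes "linear D"
  shows "D k = (\<Sum>j\<in>UNIV. k $ j *\<^sub>R D (axis j 1))"
proof -
  have "D k = D (\<Sum>j\<in>UNIV. k $ j *\<^sub>R axis j 1)"
    by (simp add: basis_expansion flip: scalar_mult_eq_scaleR)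
  also have "\<dots> = (\<Sum>j\<in>UNIV. k $ j *\<^sub>R D (axis j 1))"
    by (simp add: linear_sum[OF assms] linear_cmul[OF assms])
  finally show ?thesis .
qed

lemma bounded_bilinear_cross3: "bounded_bilinear cross3"
  using bilinear_cross by (simp add: bilinear_conv_bounded_bilinear)

text \<open>The extension is constant along the ray through \<open>s\<close>, so its derivative in
  the direction \<open>s\<close> vanishes. This makes surface gradients tangential and removes the
  radial part of the derivative of a field.\<close>

lemma radially_constant_derivative_eq_0:
  assumes s: "norm (s :: 'a::real_normed_vector) = 1" and D: "((\<lambda>x. F (x /\<^sub>R norm x)) has_derivative D)
      (at s)"
  shows "D s = 0"
proof -
  have "((\<lambda>t. (1 + t) *\<^sub>R s) has_derivative (\<lambda>t. t *\<^sub>R s)) (at 0)"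
    by (auto intro!: derivative_eq_intros)
  moreover have "((\<lambda>x. F (x /\<^sub>R norm x)) has_derivative D) (at ((1 + 0) *\<^sub>R s))"
    using D by simp
  ultimately have "((\<lambda>t. F (((1 + t) *\<^sub>R s) /\<^sub>R norm ((1 + t) *\<^sub>R s))) has_derivative (\<lambda>t. D (t *\<^sub>R s)))
      (at 0)"
    by (rule has_derivative_compose)
  moreover have "eventually (\<lambda>t::real. -1 < t) (at 0)"
    by (rule order_tendstoD(1)[OF tendsto_ident_at]) simp
  then have "eventually (\<lambda>t. F (((1 + t) *\<^sub>R s) /\<^sub>R norm ((1 + t) *\<^sub>R s)) = F s) (at 0)"
    by eventually_elim (simp add: s)
  ultimately have "((\<lambda>t. F s) has_derivative (\<lambda>t. D (t *\<^sub>R s))) (at 0)"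
    by (rule has_derivative_transform_eventually) (simp_all add: s)
  then have "(\<lambda>t. D (t *\<^sub>R s)) = (\<lambda>t::real. 0)"
    by (rule has_derivative_unique) simp
  then show ?thesis
    by (metis scaleR_one)
qed

text \<open>Tangential fields satisfy \<open>F = (s \<times> F) \<times> s\<close>, so the surface divergence is a combination of
  derivatives along the three rotation fields \<open>s \<mapsto> axis i 1 \<times> s\<close>.\<close>

lemma sphere_integration_by_parts:
  fixes u :: "real^3 \<Rightarrow> real" and F :: "real^3 \<Rightarrow> real^3"
  assumes u: "\<And>s. s \<in> sphere 0 1 \<Longrightarrow> ((\<lambda>x. u (x /\<^sub>R norm x)) has_derivative (\<lambda>k. us s \<bullet> k)) (at s)"
    and F: "\<And>s. s \<in> sphere 0 1 \<Longrightarrow> ((\<lambda>x. F (x /\<^sub>R norm x)) has_derivative D s) (at s)"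
    and tang: "\<And>s. s \<in> sphere 0 1 \<Longrightarrow> F s \<bullet> s = 0"
    and cus: "continuous_on (sphere 0 1) us"
    and cD: "\<And>i. continuous_on (sphere 0 1) (\<lambda>s. D s (axis i 1))"
  shows "(LINT s|sphere_measure. u s * surf_div F s + us s \<bullet> F s) = 0"
proof -
  \<comment> \<open>\<open>f i\<close> is component \<open>i\<close> of
    \<open>u (x \<times> F)\<close>; the derivatives along the fields
    \<open>axis i 1 \<times> s\<close>, summed over \<open>i\<close>, give the integrand. The outer
    factor \<open>x\<close> can be left unnormalized because only derivatives at points of the
    sphere in tangential directions enter.\<close>
  define f where "f i x = u (x /\<^sub>R norm x) * (cross3 x (F (x /\<^sub>R norm x))) $ i" for i x
  define f' where "f' i s k = u s * (cross3 s (D s k) + cross3 k (F s)) $ i + (us s \<bullet> k) * (cross3 s (F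
      s)) $ i" for i s k
  have linD: "linear (D s)" if "s \<in> sphere 0 1" for s
    using F[OF that] by (rule has_derivative_linear)
  have cu: "continuous_on (sphere 0 1) u"
  proof -
    have "continuous_on (sphere 0 1) (\<lambda>x. u (x /\<^sub>R norm x))"
      by (intro continuous_at_imp_continuous_on ballI has_derivative_continuous[OF u])
    then show ?thesis
      by (rule continuous_on_eq) auto
  qed
  have cF: "continuous_on (sphere 0 1) F"
  proof -
    have "continuous_on (sphere 0 1) (\<lambda>x. F (x /\<^sub>R norm x))"
      by (intro continuous_at_imp_continuous_on ballI has_derivative_continuous[OF F])
    then show ?thesis
      by (rule continuous_on_eq) auto
  qed
  have df: "(f i has_derivative f' i s) (at s)" if s: "s \<in> sphere 0 1" for s i
  proof -
    have "((\<lambda>x. cross3 x (F (x /\<^sub>R norm x))) has_derivative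
        (\<lambda>k. cross3 s (D s k) + cross3 k (F (s /\<^sub>R norm s)))) (at s)"
      by (rule bounded_bilinear.FDERIV[OF bounded_bilinear_cross3 has_derivative_ident F[OF s]])
    from bounded_linear.has_derivative[OF bounded_linear_vec_nth this, of i]
    have "((\<lambda>x. cross3 x (F (x /\<^sub>R norm x)) $ i) has_derivative
        (\<lambda>k. (cross3 s (D s k) + cross3 k (F (s /\<^sub>R norm s))) $ i)) (at s)" .
    from has_derivative_mult[OF u[OF s] this] s show ?thesis
      by (simp add: f_def[abs_def] f'_def[abs_def])
  qed
  have cDk: "continuous_on (sphere 0 1) (\<lambda>s. D s (cross3 e s))" for e
  proof -
    have "continuous_on (sphere 0 1) (\<lambda>s. \<Sum>j\<in>UNIV. (cross3 e s) $ j *\<^sub>R D s (axis j 1))"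
      by (intro continuous_intros cD continuous_on_cross continuous_on_component)
    then show ?thesis
      by (rule continuous_on_eq) (metis linear_expansion_axis linD)
  qed
  have cf': "continuous_on (sphere 0 1) (\<lambda>s. f' i s (cross3 (axis i 1) s))" for i
    unfolding f'_def
    by (intro continuous_intros cDk cu cF cus continuous_on_cross continuous_on_component)
  have int0: "(LINT s|sphere_measure. f' i s (cross3 (axis i 1) s)) = 0" for i
  proof -
    have "bounded ((\<lambda>s. f' i s (cross3 (axis i 1) s)) ` sphere 0 1)"
      by (intro compact_imp_bounded compact_continuous_image cf') simp
    then obtain B where "\<And>s. s \<in> sphere 0 1 \<Longrightarrow> \<bar>f' i s (cross3 (axis i 1) s)\<bar> \<le> B"
      unfolding bounded_iff real_norm_def by blast
    then show ?thesis
      using df by (intro integral_rotation_derivative_eq_0[of _ "f i"]) (auto simp: norm_eq_1 inner_axis_axis)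
  qed
  have key: "u s * surf_div F s + us s \<bullet> F s = (\<Sum>i\<in>UNIV. f' i s (cross3 (axis i 1) s))"
    if s: "s \<in> sphere 0 1" for s
  proof -
    define d where "d j = D s (axis j 1)" for j
    have Dk: "D s k = k $ 1 *\<^sub>R d 1 + k $ 2 *\<^sub>R d 2 + k $ 3 *\<^sub>R d 3" for k
      using linear_expansion_axis[OF linD[OF s], of k] by (simp add: sum_3 d_def)
    have ss: "s $ 1 * s $ 1 + s $ 2 * s $ 2 + s $ 3 * s $ 3 = 1"
      using s by (simp add: norm_eq_1 inner_vec_def sum_3)
    have Fs: "F s $ 1 * s $ 1 + F s $ 2 * s $ 2 + F s $ 3 * s $ 3 = 0"
      using tang[OF s] by (simp add: inner_vec_def sum_3)
    have "D s s = 0"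
      using s F by (intro radially_constant_derivative_eq_0) auto
    then have Ds: "s $ 1 * d 1 $ i + s $ 2 * d 2 $ i + s $ 3 * d 3 $ i = 0" for i
      unfolding Dk by (auto simp: vec_eq_iff)
    have "frechet_derivative (\<lambda>x. F (x /\<^sub>R norm x)) (at s) = D s"
      using frechet_derivative_at[OF F[OF s]] by simp
    then have div: "surf_div F s = d 1 $ 1 + d 2 $ 2 + d 3 $ 3"
      unfolding surf_div_def sum_Basis_axis
      by (simp add: sum_3 d_def inner_axis)
    have 1: "(\<Sum>i\<in>UNIV. (us s \<bullet> cross3 (axis i 1) s) * cross3 s (F s) $ i) =
      (us s \<bullet> F s) * (s $ 1 * s $ 1 + s $ 2 * s $ 2 + s $ 3 * s $ 3) -
      (us s \<bullet> s) * (F s $ 1 * s $ 1 + F s $ 2 * s $ 2 + F s $ 3 * s $ 3)"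
      by (simp add: cross3_def inner_vec_def sum_3 axis_def algebra_simps)
    have 2: "(\<Sum>i\<in>UNIV. cross3 (cross3 (axis i 1) s) (F s) $ i) = -2 * (F s $ 1 * s $ 1 + F s $ 2 * s $ 2 +
        F s $ 3 * s $ 3)"
      by (simp add: cross3_def sum_3 axis_def algebra_simps)
    \<comment> \<open>This is the trace of \<open>D s\<close> times the square of
      \<open>norm s\<close>, minus \<open>s \<bullet> D s s\<close>; the latter vanishes since the
      extension is radially constant. The two sums before it reduce through
      \<open>norm s = 1\<close> and \<open>F s \<bullet> s = 0\<close>.\<close>
    have 3: "(\<Sum>i\<in>UNIV. cross3 s (D s (cross3 (axis i 1) s)) $ i) =
      (d 1 $ 1 + d 2 $ 2 + d 3 $ 3) * (s $ 1 * s $ 1 + s $ 2 * s $ 2 + s $ 3 * s $ 3)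
      - (s $ 1 * (s $ 1 * d 1 $ 1 + s $ 2 * d 2 $ 1 + s $ 3 * d 3 $ 1)
        + s $ 2 * (s $ 1 * d 1 $ 2 + s $ 2 * d 2 $ 2 + s $ 3 * d 3 $ 2)
        + s $ 3 * (s $ 1 * d 1 $ 3 + s $ 2 * d 2 $ 3 + s $ 3 * d 3 $ 3))"
      unfolding Dk by (simp add: cross3_def sum_3 axis_def algebra_simps)
    have "(\<Sum>i\<in>UNIV. f' i s (cross3 (axis i 1) s)) =
      u s * ((\<Sum>i\<in>UNIV. cross3 s (D s (cross3 (axis i 1) s)) $ i) + (\<Sum>i\<in>UNIV. cross3 (cross3 (axis i 1) s)
          (F s) $ i)) +
      (\<Sum>i\<in>UNIV. (us s \<bullet> cross3 (axis i 1) s) * cross3 s (F s) $ i)"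
      by (simp add: f'_def sum_distrib_left sum.distrib distrib_left)
    also have "\<dots> = u s * surf_div F s + us s \<bullet> F s"
      unfolding 1 2 3 unfolding ss Fs Ds div by simp
    finally show ?thesis
      by simp
  qed
  have "(LINT s|sphere_measure. u s * surf_div F s + us s \<bullet> F s) =
      (LINT s|sphere_measure. (\<Sum>i\<in>UNIV. f' i s (cross3 (axis i 1) s)))"
    by (intro Bochner_Integration.integral_cong refl key) simp
  also have "\<dots> = (\<Sum>i\<in>UNIV. LINT s|sphere_measure. f' i s (cross3 (axis i 1) s))"
    by (intro Bochner_Integration.integral_sum continuous_on_sphere_integrable cf')
  finally show ?thesis
    by (simp add: int0)
qed

text \<open>By the triple product, the integrand is \<open>norm G / 2\<close> times the derivative
  of \<open>u^2\<close> along the rotation field about the axis \<open>G\<close>, and such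
  derivatives integrate to zero.\<close>

lemma sphere_integral_cross_gradient_eq_0:
  fixes u :: "real^3 \<Rightarrow> real"
  assumes u: "\<And>s. s \<in> sphere 0 1 \<Longrightarrow> ((\<lambda>x. u (x /\<^sub>R norm x)) has_derivative (\<lambda>k. us s \<bullet> k)) (at s)"
    and cus: "continuous_on (sphere 0 1) us"
  shows "(LINT s|sphere_measure. u s * (G \<bullet> cross3 s (us s))) = 0"
proof (cases "G = 0")
  case False
  define w where "w = G /\<^sub>R norm G"
  have G: "G = norm G *\<^sub>R w" and w: "norm w = 1"
    using False by (auto simp: w_def)
  have cu: "continuous_on (sphere 0 1) u"
  proof -
    have "continuous_on (sphere 0 1) (\<lambda>x. u (x /\<^sub>R norm x))"
      by (intro continuous_at_imp_continuous_on ballI has_derivative_continuous[OF u])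
    then show ?thesis
      by (rule continuous_on_eq) auto
  qed
  have d: "((\<lambda>x. (u (x /\<^sub>R norm x))\<^sup>2) has_derivative (\<lambda>k. 2 * u s * (us s \<bullet> k))) (at s)" if s: "s \<in>
      sphere 0 1" for s
    using has_derivative_power[OF u[OF s], of 2] s by (simp add: algebra_simps)
  have "bounded ((\<lambda>s. 2 * u s * (us s \<bullet> cross3 w s)) ` sphere 0 1)"
    by (intro compact_imp_bounded compact_continuous_image continuous_intros cu cus continuous_on_cross) simp
  then obtain B where B: "\<And>s. s \<in> sphere 0 1 \<Longrightarrow> \<bar>2 * u s * (us s \<bullet> cross3 w s)\<bar> \<le> B"
    unfolding bounded_iff real_norm_def by blast
  have "(LINT s|sphere_measure. 2 * u s * (us s \<bullet> cross3 w s)) = 0"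
    by (rule integral_rotation_derivative_eq_0[OF w d B])
  then have "(LINT s|sphere_measure. u s * (us s \<bullet> cross3 w s)) = 0"
    by (simp add: mult.assoc)
  moreover have "u s * (G \<bullet> cross3 s (us s)) = norm G * (u s * (us s \<bullet> cross3 w s))" for s
  proof -
    have "G \<bullet> cross3 s (us s) = us s \<bullet> cross3 G s"
      by (simp add: cross3_simps)
    also have "\<dots> = norm G * (us s \<bullet> cross3 w s)"
      by (subst G) (simp add: cross_mult_left)
    finally show ?thesis
      by simp
  qed
  ultimately show ?thesis
    by (simp only: Bochner_Integration.integral_mult_right_zero)
qed simp

section \<open>Transport along lines in a convex domain\<close>

lemma lborel_shift:
  fixes F :: "'a::euclidean_space \<Rightarrow> 'b::{banach, second_countable_topology}"
  assumes "F \<in> borel_measurable borel"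
  shows "integrable lborel (\<lambda>x. F (x + c)) \<longleftrightarrow> integrable lborel F"
    and "(LINT x|lborel. F (x + c)) = (LINT x|lborel. F x)"
proof -
  have m: "(+) c \<in> lborel \<rightarrow>\<^sub>M borel"
    by measurable
  show "integrable lborel (\<lambda>x. F (x + c)) \<longleftrightarrow> integrable lborel F"
    using integrable_distr_eq[OF m assms] by (simp add: lborel_distr_plus add.commute)
  show "(LINT x|lborel. F (x + c)) = (LINT x|lborel. F x)"
    using integral_distr[OF m assms] by (simp add: lborel_distr_plus add.commute)
qed

text \<open>Difference quotients along \<open>s\<close>, with \<open>f\<close> extended by zero: the extension stays Lipschitz along
  rays because \<open>f\<close> vanishes where they leave \<open>R\<close>, and a shift does not increase its integral over \<open>R\<close>.\<close>

lemma integral_directional_derivative_le_0: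
  fixes f :: "'a::euclidean_space \<Rightarrow> real"
  assumes R: "open R" "convex R" "bounded R"
    and f': "\<And>x. x \<in> closure R \<Longrightarrow> (f has_derivative (\<lambda>k. f' x \<bullet> k)) (at x within closure R)"
    and cont: "continuous_on (closure R) f'"
    and nn: "\<And>x. x \<in> R \<Longrightarrow> 0 \<le> f x"
    and exit: "\<And>b t. b \<in> frontier R \<Longrightarrow> 0 < t \<Longrightarrow> b - t *\<^sub>R s \<in> R \<Longrightarrow> f b = 0"
  shows "(LINT x|restrict_space lborel R. s \<bullet> f' x) \<le> 0"
proof -
  have sub: "R \<subseteq> closure R"
    by (rule closure_subset)
  have comp: "compact (closure R)"
    using R(3) by (simp add: compact_closure)
  have cf: "continuous_on (closure R) f"
    using f' by (meson has_derivative_continuous_on)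
  have "bounded (f' ` closure R)"
    by (intro compact_imp_bounded compact_continuous_image cont comp)
  then obtain B where B: "\<And>x. x \<in> closure R \<Longrightarrow> norm (f' x) \<le> B"
    unfolding bounded_iff by blast
  have "bounded (f ` closure R)"
    by (intro compact_imp_bounded compact_continuous_image cf comp)
  then obtain C where C: "\<And>x. x \<in> closure R \<Longrightarrow> \<bar>f x\<bar> \<le> C"
    unfolding bounded_iff real_norm_def by blast
  have lips: "\<bar>f y - f x\<bar> \<le> B * norm (y - x)" if "x \<in> closure R" "y \<in> closure R" for x y
  proof -
    have "norm (f y - f x) \<le> B * norm (y - x)"
    proof (rule differentiable_bound[OF convex_closure[OF R(2)] f'])
      show "onorm (\<lambda>k. f' z \<bullet> k) \<le> B" if "z \<in> closure R" for z
        using B[OF that] by (intro onorm_le) (metis Cauchy_Schwarz_ineq2 mult_right_mono norm_ge_zero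
            order_trans real_norm_def)
    qed (use that in auto)
    then show ?thesis
      by simp
  qed
  have mR: "R \<in> sets borel" "R \<in> sets lborel"
    using R(1) by auto
  have finR: "emeasure lborel R < \<infinity>"
    using R(3) by (rule emeasure_bounded_finite)
  define F where "F x = indicator R x * f x" for x
  have Fm [measurable]: "F \<in> borel_measurable borel"
    unfolding F_def[abs_def] using borel_measurable_continuous_on_indicator[OF mR(1)
        continuous_on_subset[OF cf sub]]
    by simp
  have indint: "integrable lborel (\<lambda>x. indicator R x * c)" for c :: real
    using mR finR by (intro integrable_mult_left) (simp add: integrable_indicator_iff)
  have Fint: "integrable lborel F"
    using C sub by (intro Bochner_Integration.integrable_bound[OF indint[of C]]) (auto simp: F_def
        indicator_def intro!: AE_I2 order_trans[OF C abs_ge_self])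
  have Fnn: "0 \<le> F x" for x
    using nn by (simp add: F_def indicator_def)
  define h where "h n = 1 / real (Suc n)" for n
  have h: "h n > 0" "h \<longlonglongrightarrow> 0" for n
    unfolding h_def using LIMSEQ_inverse_real_of_nat by (auto simp: inverse_eq_divide)
  define g where "g n x = indicator R x * ((F (x + h n *\<^sub>R s) - F x) / h n)" for n x
  have gm: "g n \<in> borel_measurable lborel" for n
    unfolding g_def[abs_def] using mR by measurable
  have gbd: "\<bar>g n x\<bar> \<le> indicator R x * (B * norm s)" for n x
  proof (cases "x \<in> R")
    case True
    define y where "y = x + h n *\<^sub>R s"
    have "\<bar>F y - F x\<bar> \<le> B * (h n * norm s)"
    proof (cases "y \<in> R")
      case yR: True
      show ?thesis
        using lips[of x y] True yR sub h(1)[of n] by (auto simp: F_def y_def)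
    next
      case False
      \<comment> \<open>A step that leaves \<open>R\<close> crosses the boundary at some
        \<open>b\<close>, an exit point of the ray, where \<open>f\<close> vanishes. The Lipschitz
        bound from \<open>x\<close> to \<open>b\<close> then covers the passage to the value zero at
        \<open>y\<close>.\<close>
      have "closed_segment x y \<inter> frontier R \<noteq> {}"
        using True False by (intro connected_Int_frontier) auto
      then obtain b where b: "b \<in> closed_segment x y" "b \<in> frontier R"
        by auto
      then obtain t where t: "0 \<le> t" "t \<le> 1" "b = x + t *\<^sub>R (y - x)"
        by (auto simp: in_segment algebra_simps)
      have bR: "b \<notin> R"
        using b(2) R(1) by (simp add: frontier_def interior_open)
      then have "t \<noteq> 0"
        using True t by auto
      then have "f b = 0"
        using t True h(1)[of n] by (intro exit[OF b(2), of "t * h n"]) (auto simp: y_def)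
      moreover have "\<bar>f b - f x\<bar> \<le> B * norm (b - x)"
        using True sub b(2) by (intro lips) (auto simp: frontier_def)
      moreover have "norm (b - x) \<le> h n * norm s"
        using t h(1)[of n] by (simp add: y_def mult_left_le_one_le)
      moreover have "0 \<le> B"
        using B[of x] True sub by (meson norm_ge_zero order_trans subsetD)
      ultimately show ?thesis
        using True False by (simp add: F_def) (meson mult_left_mono order_trans)
    qed
    then show ?thesis
      using True h(1)[of n] by (simp add: g_def y_def abs_divide pos_divide_le_eq mult_ac)
  qed (simp add: g_def)
  have glim: "(\<lambda>n. g n x) \<longlonglongrightarrow> indicator R x * (s \<bullet> f' x)" for x
  proof (cases "x \<in> R")
    case True
    have "(f has_derivative (\<lambda>k. f' x \<bullet> k)) (at x)"
    proof -
      have "(f has_derivative (\<lambda>k. f' x \<bullet> k)) (at x within R)"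
        using True sub by (intro has_derivative_subset[OF f'[of x]]) auto
      then show ?thesis
        by (simp only: at_within_open[OF True R(1)])
    qed
    then have d: "(f has_derivative (\<lambda>k. f' x \<bullet> k)) (at (x + 0 *\<^sub>R s))"
      by simp
    have "((\<lambda>t. x + t *\<^sub>R s) has_derivative (\<lambda>t. t *\<^sub>R s)) (at 0)"
      by (auto intro!: derivative_eq_intros)
    from has_derivative_compose[OF this d]
    have "((\<lambda>t. f (x + t *\<^sub>R s)) has_derivative (\<lambda>t. f' x \<bullet> (t *\<^sub>R s))) (at 0)" .
    moreover have "(\<lambda>t. f' x \<bullet> (t *\<^sub>R s)) = (*) (s \<bullet> f' x)"
      by (auto simp: inner_commute[of s])
    ultimately have "((\<lambda>t. f (x + t *\<^sub>R s)) has_real_derivative (s \<bullet> f' x)) (at 0)"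
      by (simp add: has_field_derivative_def)
    then have "((\<lambda>t. (f (x + t *\<^sub>R s) - f x) / t) \<longlongrightarrow> s \<bullet> f' x) (at 0)"
      by (simp add: has_field_derivative_iff)
    moreover have "filterlim h (at 0) sequentially"
      by (intro filterlim_atI h(2) always_eventually allI less_imp_neq[OF h(1), symmetric])
    ultimately have l: "(\<lambda>n. (f (x + h n *\<^sub>R s) - f x) / h n) \<longlonglongrightarrow> s \<bullet> f' x"
      by (rule filterlim_compose)
    have "(\<lambda>n. x + h n *\<^sub>R s) \<longlonglongrightarrow> x + 0 *\<^sub>R s"
      by (intro tendsto_intros h)
    then have "eventually (\<lambda>n. x + h n *\<^sub>R s \<in> R) sequentially"
      using R(1) True by (intro topological_tendstoD) auto
    then have "eventually (\<lambda>n. g n x = (f (x + h n *\<^sub>R s) - f x) / h n) sequentially"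
      by eventually_elim (simp add: g_def F_def True)
    then have "(\<lambda>n. g n x) \<longlonglongrightarrow> s \<bullet> f' x"
      using l by (simp add: tendsto_cong)
    then show ?thesis
      using True by simp
  qed (simp add: g_def)
  have trans: "integrable lborel (\<lambda>x. F (x + c))" "(LINT x|lborel. F (x + c)) = (LINT x|lborel. F x)" for c
    using lborel_shift[OF Fm, of c] Fint by simp_all
  have "(LINT x|lborel. g n x) \<le> 0" for n
  proof -
    \<comment> \<open>Dropping the cut-off to \<open>R\<close> only adds the nonnegative shifted
      values of \<open>F\<close> at points outside \<open>R\<close>; over the whole space the shift
      leaves the integral of \<open>F\<close> unchanged.\<close>
    have "(LINT x|lborel. g n x) \<le> (LINT x|lborel. (F (x + h n *\<^sub>R s) - F x) / h n)"
    proof (rule integral_mono)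
      show "integrable lborel (g n)"
      proof (rule Bochner_Integration.integrable_bound[OF indint gm])
        show "AE x in lborel. norm (g n x) \<le> norm (indicator R x * (B * norm s))"
          unfolding real_norm_def by (intro AE_I2 order_trans[OF gbd abs_ge_self])
      qed
      show "integrable lborel (\<lambda>x. (F (x + h n *\<^sub>R s) - F x) / h n)"
        using trans(1)[of "h n *\<^sub>R s"] Fint by simp
      show "g n x \<le> (F (x + h n *\<^sub>R s) - F x) / h n" for x
        using Fnn[of "x + h n *\<^sub>R s"] h(1)[of n] by (cases "x \<in> R") (auto simp: g_def F_def[of x])
    qed
    also have "\<dots> = 0"
      using trans[of "h n *\<^sub>R s"] Fint by simp
    finally show ?thesis .
  qed
  moreover have "(\<lambda>n. LINT x|lborel. g n x) \<longlonglongrightarrow> (LINT x|lborel. indicator R x * (s \<bullet> f' x))"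
  proof (rule integral_dominated_convergence)
    show "(\<lambda>x. indicator R x * (s \<bullet> f' x)) \<in> borel_measurable lborel"
      by (rule borel_measurable_LIMSEQ_real[OF _ gm]) (use glim in auto)
    show "integrable lborel (\<lambda>x. indicator R x * (B * norm s))"
      by (rule indint)
    show "AE x in lborel. (\<lambda>n. g n x) \<longlonglongrightarrow> indicator R x * (s \<bullet> f' x)"
      using glim by simp
    show "AE x in lborel. norm (g n x) \<le> indicator R x * (B * norm s)" for n
      using gbd by simp
  qed (rule gm)
  ultimately have "(LINT x|lborel. indicator R x * (s \<bullet> f' x)) \<le> 0"
    by (intro LIMSEQ_le_const2) auto
  then show ?thesis
    using mR by (simp add: integral_restrict_space)
qed

subsection \<open>Rho-convex domains\<close>

text \<open>The interior \<open>I\<close> of the intersection of all supporting balls is convex and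
  contains \<open>R\<close>. If it were larger, connectedness would give a boundary point of
  \<open>R\<close> in \<open>I\<close>; but each boundary point lies on the sphere of its own ball,
  hence outside the interior of that ball.\<close>

lemma rho_convexD:
  assumes "rho_convex R"
  shows "open R" "convex R" "bounded R" "R \<noteq> {}"
proof -
  from assms obtain \<rho> where R: "R \<noteq> {}" "open R" "connected R" "R \<noteq> UNIV"
    and "\<forall>r\<in>frontier R. \<exists>c. R \<subseteq> cball c \<rho> \<and> r \<in> sphere c \<rho>"
    unfolding rho_convex_def by blast
  then obtain c where c: "\<And>r. r \<in> frontier R \<Longrightarrow> R \<subseteq> cball (c r) \<rho>" "\<And>r. r \<in> frontier R \<Longrightarrow> r \<in> sphere (c r) \<rho>"
    by metis
  show "open R" "R \<noteq> {}"
    by fact+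
  obtain r where "r \<in> frontier R"
    using frontier_not_empty[OF R(1,4)] by auto
  then show "bounded R"
    using c(1) bounded_cball bounded_subset by blast
  define I where "I = interior (\<Inter>r\<in>frontier R. cball (c r) \<rho>)"
  have "convex I"
    unfolding I_def by (intro convex_interior convex_INT) auto
  have "R \<subseteq> I"
    unfolding I_def using c(1) R(2) by (intro interior_maximal) auto
  moreover have "I - R = {}"
  proof (rule ccontr)
    assume "I - R \<noteq> {}"
    then have "I \<inter> frontier R \<noteq> {}"
      using \<open>R \<subseteq> I\<close> R(1) \<open>convex I\<close> by (intro connected_Int_frontier convex_connected) auto
    then obtain r where r: "r \<in> I" "r \<in> frontier R"
      by auto
    have "I \<subseteq> interior (cball (c r) \<rho>)"
      unfolding I_def using r(2) by (intro interior_mono) auto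
    then show False
      using r c(2)[OF r(2)] by auto
  qed
  ultimately show "convex R"
    using \<open>convex I\<close> by (metis Diff_eq_empty_iff subset_antisym)
qed

text \<open>If \<open>r' - t s'\<close> lies in \<open>R\<close> for the given \<open>t > 0\<close>,
  an outward normal \<open>n\<close> at \<open>r'\<close> satisfies
  \<open>n \<bullet> s' \<ge> 0\<close>. The condition on \<open>(r', s')\<close> is open, so a
  whole neighbourhood of \<open>(b, s)\<close> misses \<open>Gamma_in R\<close>, as the closure in
  the definition of \<open>Gamma_out\<close> demands.\<close>

lemma exit_point_in_Gamma_out:
  assumes R: "open R" and b: "b \<in> frontier R" and s: "s \<in> sphere 0 1" and t: "0 < t" "b - t *\<^sub>R s \<in> R"
  shows "(b, s) \<in> Gamma_out R"
proof -
  define N where "N = (\<lambda>(r, s). r - t *\<^sub>R s) -` R"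
  have "open N"
    unfolding N_def by (intro open_vimage R) (auto simp: case_prod_beta' intro!: continuous_intros)
  moreover have "N \<inter> Gamma_in R = {}"
  proof -
    have False if rs: "(r', s') \<in> N" "(r', s') \<in> Gamma_in R" for r' s'
    proof -
      obtain n where n: "outward_unit_normal R r' n" "n \<bullet> s' < 0"
        using rs(2) by (auto simp: Gamma_in_def)
      have "n \<in> {m. norm m = 1 \<and> (\<forall>x\<in>R. m \<bullet> (x - r') \<le> 0)}"
        using n(1) by (simp add: outward_unit_normal_def)
      moreover have "r' - t *\<^sub>R s' \<in> R"
        using rs(1) by (simp add: N_def)
      ultimately have "n \<bullet> ((r' - t *\<^sub>R s') - r') \<le> 0"
        by blast
      then show False
        using n(2) t(1) by (simp add: zero_le_mult_iff)
    qed
    then show ?thesis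
      by auto
  qed
  ultimately have "N \<inter> closure (Gamma_in R) = {}"
    by (simp add: open_Int_closure_eq_empty)
  moreover have "(b, s) \<in> N"
    using t by (simp add: N_def)
  ultimately show ?thesis
    using b s by (auto simp: Gamma_out_def Gamma_def)
qed

subsection \<open>Weak derivatives and difference quotients\<close>

lemma exp_ge_power_div_fact:
  fixes z :: real
  assumes "0 \<le> z"
  shows "z ^ n / fact n \<le> exp z"
proof -
  have "(\<lambda>n. z ^ n /\<^sub>R fact n) sums exp z"
    by (rule exp_converges)
  then have "sum (\<lambda>n. z ^ n /\<^sub>R fact n) {n} \<le> exp z"
    using assms by (metis (mono_tags, lifting) finite.intros sums_iff sum_le_suminf scaleR_nonneg_nonneg
        zero_le_power fact_ge_zero inverse_nonnegative_iff_nonnegative)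
  then show ?thesis
    by (simp add: divide_inverse_commute)
qed

text \<open>The class of functions \<open>P w\<^sup>-\<^sup>k exp (- 1 / w)\<close> is closed under differentiation.\<close>

definition bump_term :: "real poly \<Rightarrow> real poly \<Rightarrow> nat \<Rightarrow> real \<Rightarrow> real" where
  "bump_term w P k x = (if poly w x > 0 then poly P x / poly w x ^ k * exp (- 1 / poly w x) else 0)"

text \<open>With \<open>z = 1 / w\<close> the exponential series gives
  \<open>z^k exp (- z) \<le> (k + 2)! / z^2\<close>. The term of order \<open>k + 2\<close> is
  chosen to leave a factor \<open>w^2\<close>, whose derivative vanishes wherever \<open>w\<close>
  does.\<close>

lemma bump_term_bound: "\<bar>bump_term w P k x\<bar> \<le> \<bar>poly P x * fact (k + 2) * (poly w x)\<^sup>2\<bar>"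
proof (cases "poly w x > 0")
  case True
  define z where "z = 1 / poly w x"
  have z: "z > 0" "poly w x = 1 / z"
    using True by (auto simp: z_def)
  define c where "c = (fact (k + 2) :: real)"
  have c: "c > 0"
    unfolding c_def by (rule fact_gt_zero)
  have "z ^ (k + 2) / c \<le> exp z"
    unfolding c_def using z(1) by (intro exp_ge_power_div_fact) simp
  then have "z ^ k * exp (- z) \<le> c * (1 / z)\<^sup>2"
    using z(1) c by (simp add: field_simps exp_minus power2_eq_square)
  then have "\<bar>poly P x\<bar> * (z ^ k * exp (- z)) \<le> \<bar>poly P x\<bar> * (c * (1 / z)\<^sup>2)"
    by (rule mult_left_mono) simp
  moreover have "\<bar>bump_term w P k x\<bar> = \<bar>poly P x\<bar> * (z ^ k * exp (- z))"
    using z True by (simp add: bump_term_def abs_mult power_one_over divide_inverse power_inverse)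
  moreover have "\<bar>poly P x * fact (k + 2) * (poly w x)\<^sup>2\<bar> = \<bar>poly P x\<bar> * (c * (1 / z)\<^sup>2)"
    unfolding c_def[symmetric] z(2) using c by (simp add: abs_mult)
  ultimately show ?thesis
    by (simp only:)
qed (simp add: bump_term_def)

lemma has_real_derivative_0_by_comparison:
  fixes f G :: "real \<Rightarrow> real"
  assumes le: "\<And>y. \<bar>f y\<bar> \<le> \<bar>G y\<bar>" and G: "G x = 0" "(G has_real_derivative 0) (at x)"
  shows "(f has_real_derivative 0) (at x)"
proof -
  have f: "f x = 0"
    using le[of x] G by simp
  have "((\<lambda>y. (G y - G x) / (y - x)) \<longlongrightarrow> 0) (at x)"
    using G(2) by (simp add: has_field_derivative_iff)
  moreover have "\<forall>\<^sub>F y in at x. norm ((f y - f x) / (y - x)) \<le> norm ((G y - G x) / (y - x)) * 1"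
    using le by (intro always_eventually) (simp add: f G(1) divide_right_mono)
  ultimately have "((\<lambda>y. (f y - f x) / (y - x)) \<longlongrightarrow> 0) (at x)"
    by (rule tendsto_0_le)
  then show ?thesis
    by (simp add: has_field_derivative_iff)
qed

text \<open>Where \<open>w > 0\<close> this is the quotient rule over the common denominator
  \<open>w^(k+2)\<close>, and where \<open>w < 0\<close> everything is locally zero. At a zero of
  \<open>w\<close> the function is squeezed by a multiple of \<open>P w^2\<close>, so its derivative
  is zero, as the formula says.\<close>

lemma bump_term_derivative:
  "(bump_term w P k has_real_derivative
    bump_term w (pderiv P * w\<^sup>2 - smult (real k) (P * pderiv w * w) + P * pderiv w) (k + 2) x) (at x)"
proof -
  let ?Q = "pderiv P * w\<^sup>2 - smult (real k) (P * pderiv w * w) + P * pderiv w"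
  have cont: "(poly w \<longlongrightarrow> poly w x) (nhds x)"
    unfolding tendsto_at_iff_tendsto_nhds[symmetric] isCont_def[symmetric] by simp
  consider "poly w x > 0" | "poly w x < 0" | "poly w x = 0"
    by linarith
  then show ?thesis
  proof cases
    case 1
    have ev: "eventually (\<lambda>y. bump_term w P k y = poly P y / poly w y ^ k * exp (- 1 / poly w y)) (nhds x)"
    proof -
      have "eventually (\<lambda>y. poly w y > 0) (nhds x)"
        by (rule order_tendstoD(1)[OF cont 1])
      then show ?thesis
        by eventually_elim (simp add: bump_term_def)
    qed
    have "((\<lambda>y. poly P y / poly w y ^ k * exp (- 1 / poly w y)) has_real_derivative
        poly ?Q x / poly w x ^ (k + 2) * exp (- 1 / poly w x)) (at x)"
    proof (cases k)
      case 0
      then show ?thesis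
        using 1 by (auto intro!: derivative_eq_intros poly_DERIV simp: field_simps power2_eq_square)
    next
      case (Suc j)
      have "0 < j \<Longrightarrow> poly w x ^ j = poly w x * poly w x ^ (j - Suc 0)"
        by (cases j) auto
      with Suc show ?thesis
        using 1 by (auto intro!: derivative_eq_intros poly_DERIV simp: field_simps power2_eq_square)
    qed
    moreover have "bump_term w ?Q (k + 2) x = poly ?Q x / poly w x ^ (k + 2) * exp (- 1 / poly w x)"
      using 1 unfolding bump_term_def by (rule if_P)
    ultimately show ?thesis
      using iffD2[OF DERIV_cong_ev[OF refl ev]] by blast
  next
    case 2
    have ev: "eventually (\<lambda>y. bump_term w P k y = 0) (nhds x)"
    proof -
      have "eventually (\<lambda>y. poly w y < 0) (nhds x)"
        by (rule order_tendstoD(2)[OF cont 2])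
      then show ?thesis
        by eventually_elim (simp add: bump_term_def)
    qed
    have "bump_term w ?Q (k + 2) x = 0"
      using 2 by (simp add: bump_term_def)
    then show ?thesis
      using iffD2[OF DERIV_cong_ev[OF refl ev], of "bump_term w ?Q (k + 2) x" 0] by simp
  next
    case 3
    define c where "c = (fact (k + 2) :: real)"
    have "(poly (smult c (P * w\<^sup>2)) has_real_derivative poly (pderiv (smult c (P * w\<^sup>2))) x) (at x)"
      by (rule poly_DERIV)
    moreover have "poly (pderiv (smult c (P * w\<^sup>2))) x = 0"
      using 3 by (simp add: pderiv_smult pderiv_mult power2_eq_square)
    moreover have "\<bar>bump_term w P k y\<bar> \<le> \<bar>poly (smult c (P * w\<^sup>2)) y\<bar>" for y
      using bump_term_bound[of w P k y] unfolding c_def[symmetric] by (simp only: poly_smult poly_mult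
          poly_power mult_ac)
    moreover have "poly (smult c (P * w\<^sup>2)) x = 0"
      using 3 by simp
    ultimately have "(bump_term w P k has_real_derivative 0) (at x)"
      using has_real_derivative_0_by_comparison[of "bump_term w P k" "poly (smult c (P * w\<^sup>2))" x] by simp
    then show ?thesis
      using 3 by (simp add: bump_term_def)
  qed
qed

text \<open>For \<open>a < b\<close>, \<open>\<beta> m n\<close> is the derivative of order
  \<open>n\<close> of \<open>exp (- 1 / ((m + 1) (x - a) (b - x)))\<close>, extended by zero; large
  \<open>m\<close> sharpens the bump towards the indicator of the interval. All derivatives are
  carried along explicitly so that smoothness of products can be read off.\<close>

lemma smooth_bumps_exist:
  fixes a b :: real
  shows "\<exists>\<beta>::nat \<Rightarrow> nat \<Rightarrow> real \<Rightarrow> real. (\<forall>m n x. (\<beta> m n has_real_derivative \<beta> m (Suc n) x) (at x)) \<and>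
    (\<forall>m x. 0 \<le> \<beta> m 0 x \<and> \<beta> m 0 x \<le> 1) \<and> (\<forall>m n x. x \<notin> {a<..<b} \<longrightarrow> \<beta> m n x = 0) \<and>
    (\<forall>x\<in>{a<..<b}. (\<lambda>m. \<beta> m 0 x) \<longlonglongrightarrow> 1)"
proof (cases "a < b")
  case ab: True
  define w where "w m = smult (real (Suc m)) ([:- a, 1:] * [:b, - 1:])" for m
  have w: "poly (w m) x = real (Suc m) * ((x - a) * (b - x))" for m x
    by (simp add: w_def algebra_simps)
  have wpos: "poly (w m) x > 0 \<longleftrightarrow> x \<in> {a<..<b}" for m x
    unfolding w using ab by (auto simp: zero_less_mult_iff)
  \<comment> \<open>Each differentiation changes the numerator by the derivative formula and raises
    the power of \<open>w m\<close> in the denominator by 2; after \<open>n\<close> of them the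
    power is \<open>2 * n\<close>.\<close>
  define Q where "Q m = rec_nat 1 (\<lambda>n P. pderiv P * (w m)\<^sup>2 - smult (real (2 * n)) (P * pderiv (w m) * w
      m) + P * pderiv (w m))" for m
  define \<beta> where "\<beta> m n = bump_term (w m) (Q m n) (2 * n)" for m n
  have d: "(\<beta> m n has_real_derivative \<beta> m (Suc n) x) (at x)" for m n x
    using bump_term_derivative[of "w m" "Q m n" "2 * n" x] by (simp add: \<beta>_def Q_def)
  have \<beta>0: "\<beta> m 0 x = (if x \<in> {a<..<b} then exp (- 1 / poly (w m) x) else 0)" for m x
    using wpos[of m x] by (simp add: \<beta>_def bump_term_def Q_def)
  have lim: "(\<lambda>m. \<beta> m 0 x) \<longlonglongrightarrow> 1" if x: "x \<in> {a<..<b}" for x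
  proof -
    have "(\<lambda>m. exp (- (1 / real (Suc m)) * (1 / ((x - a) * (b - x))))) \<longlonglongrightarrow> exp (- 0 * (1 / ((x - a) * (b -
        x))))"
      using LIMSEQ_inverse_real_of_nat by (intro tendsto_intros) (simp add: inverse_eq_divide)
    moreover have "\<beta> m 0 x = exp (- (1 / real (Suc m)) * (1 / ((x - a) * (b - x))))" for m
      unfolding \<beta>0 w using x by simp
    ultimately show ?thesis
      by simp
  qed
  have "0 \<le> \<beta> m 0 x \<and> \<beta> m 0 x \<le> 1" for m x
    unfolding \<beta>0 using wpos[of m x] by auto
  moreover have "\<beta> m n x = 0" if "x \<notin> {a<..<b}" for m n x
  proof -
    have "\<not> poly (w m) x > 0"
      using wpos[of m x] that by simp
    then show ?thesis
      unfolding \<beta>_def bump_term_def by (rule if_not_P)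
  qed
  ultimately show ?thesis
    using d lim by (intro exI[of _ \<beta>]) blast
next
  case False
  then show ?thesis
    by (intro exI[of _ "\<lambda>_ _ _. 0"]) auto
qed

text \<open>The multi-index \<open>k\<close> records the order of differentiation in each
  coordinate. A partial derivative raises one entry by one, so these products are closed under
  differentiation and smoothness follows by induction.\<close>

lemma prod_coords_has_derivative:
  fixes b :: "'a::euclidean_space \<Rightarrow> nat \<Rightarrow> real \<Rightarrow> real"
  assumes b: "\<And>i n x. i \<in> Basis \<Longrightarrow> (b i n has_real_derivative b i (Suc n) x) (at x)"
  shows "(\<lambda>x. \<Prod>i\<in>Basis. b i (k i) (x \<bullet> i)) differentiable (at x)"
    and "e \<in> Basis \<Longrightarrow> frechet_derivative (\<lambda>x. \<Prod>i\<in>Basis. b i (k i) (x \<bullet> i)) (at x) e =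
      (\<Prod>i\<in>Basis. b i ((k(e := Suc (k e))) i) (x \<bullet> i))"
proof -
  let ?D = "\<lambda>y. \<Sum>i\<in>Basis. ((y \<bullet> i) * b i (Suc (k i)) (x \<bullet> i)) * (\<Prod>j\<in>Basis - {i}. b j (k j) (x \<bullet> j))"
  have D: "((\<lambda>x. \<Prod>i\<in>Basis. b i (k i) (x \<bullet> i)) has_derivative ?D) (at x)"
    by (intro has_derivative_prod DERIV_compose_FDERIV[OF b] has_derivative_inner_left has_derivative_ident)
  then show "(\<lambda>x. \<Prod>i\<in>Basis. b i (k i) (x \<bullet> i)) differentiable (at x)"
    by (rule differentiableI)
  assume e: "e \<in> Basis"
  have "frechet_derivative (\<lambda>x. \<Prod>i\<in>Basis. b i (k i) (x \<bullet> i)) (at x) e = ?D e"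
    by (rule fun_cong[OF frechet_derivative_at[OF D], symmetric])
  also have "\<dots> = (\<Sum>i\<in>Basis. if i = e then b i (Suc (k i)) (x \<bullet> i) * (\<Prod>j\<in>Basis - {i}. b j (k j) (x \<bullet> j))
      else 0)"
    using e by (intro sum.cong) (auto simp: inner_Basis)
  also have "\<dots> = b e (Suc (k e)) (x \<bullet> e) * (\<Prod>j\<in>Basis - {e}. b j (k j) (x \<bullet> j))"
    using e by simp
  also have "\<dots> = (\<Prod>i\<in>Basis. b i ((k(e := Suc (k e))) i) (x \<bullet> i))"
    using e by (subst prod.remove[of Basis e]) (auto intro!: prod.cong)
  finally show "frechet_derivative (\<lambda>x. \<Prod>i\<in>Basis. b i (k i) (x \<bullet> i)) (at x) e =
      (\<Prod>i\<in>Basis. b i ((k(e := Suc (k e))) i) (x \<bullet> i))" .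
qed

lemma smooth_on_prod_coords:
  fixes b :: "'a::euclidean_space \<Rightarrow> nat \<Rightarrow> real \<Rightarrow> real"
  assumes b: "\<And>i n x. i \<in> Basis \<Longrightarrow> (b i n has_real_derivative b i (Suc n) x) (at x)"
  shows "smooth_on UNIV (\<lambda>x. \<Prod>i\<in>Basis. b i (k i) (x \<bullet> i))"
proof -
  have "Ck_on m UNIV (\<lambda>x. \<Prod>i\<in>Basis. b i (k i) (x \<bullet> i))" for m k
  proof (induction m arbitrary: k)
    case 0
    show ?case
      using differentiable_imp_continuous_within[OF prod_coords_has_derivative(1)[of b k, OF b]]
      by (auto intro!: continuous_at_imp_continuous_on)
  next
    case (Suc m)
    have "Ck_on m UNIV (\<lambda>x. frechet_derivative (\<lambda>x. \<Prod>i\<in>Basis. b i (k i) (x \<bullet> i)) (at x) e)" if e: "e \<in>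
        Basis" for e
    proof -
      have "(\<lambda>x. frechet_derivative (\<lambda>x. \<Prod>i\<in>Basis. b i (k i) (x \<bullet> i)) (at x) e) =
          (\<lambda>x. \<Prod>i\<in>Basis. b i ((k(e := Suc (k e))) i) (x \<bullet> i))"
        by (intro ext prod_coords_has_derivative(2) b e)
      then show ?thesis
        using Suc[of "k(e := Suc (k e))"] by (simp only:)
    qed
    moreover have "(\<lambda>x. \<Prod>i\<in>Basis. b i (k i) (x \<bullet> i)) differentiable (at x)" for x
      by (rule prod_coords_has_derivative(1)[of b, OF b])
    ultimately show ?case
      by simp
  qed
  then show ?thesis
    by (simp add: smooth_on_def)
qed

section \<open>Lipschitz bounds for functions with bounded weak derivatives\<close>

lemma nn_integral_lborel_shift:
  fixes F :: "'a::euclidean_space \<Rightarrow> ennreal"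
  assumes "F \<in> borel_measurable borel"
  shows "(\<integral>\<^sup>+x. F (x + c) \<partial>lborel) = (\<integral>\<^sup>+x. F x \<partial>lborel)"
proof -
  have m: "(+) c \<in> lborel \<rightarrow>\<^sub>M borel"
    by measurable
  show ?thesis
    using nn_integral_distr[OF m, of F] assms by (simp add: lborel_distr_plus add.commute)
qed

text \<open>\<open>\<Phi> x\<close> is the integral of the shifts \<open>\<phi> (x - \<tau> e)\<close> over \<open>0 \<le> \<tau> \<le> h\<close>; this turns a weak derivative
  into a difference quotient.\<close>

lemma shifted_bump_test_function:
  fixes a b e :: "'a::euclidean_space" and \<beta> :: "'a \<Rightarrow> nat \<Rightarrow> real \<Rightarrow> real"
  assumes e: "e \<in> Basis" and h: "0 < h" and U: "cbox a (b + h *\<^sub>R e) \<subseteq> U"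
    and \<beta>: "\<And>i n x. (\<beta> i n has_real_derivative \<beta> i (Suc n) x) (at x)"
    and \<beta>01: "\<And>i x. 0 \<le> \<beta> i 0 x \<and> \<beta> i 0 x \<le> 1"
    and \<beta>0: "\<And>i n x. i \<in> Basis \<Longrightarrow> x \<notin> {a \<bullet> i<..<b \<bullet> i} \<Longrightarrow> \<beta> i n x = 0"
  defines "\<phi> x \<equiv> \<Prod>i\<in>Basis. \<beta> i 0 (x \<bullet> i)"
  shows "\<exists>\<Phi>\<in>test_functions U. (\<forall>x. frechet_derivative \<Phi> (at x) e = \<phi> x - \<phi> (x - h *\<^sub>R e)) \<and>
    (\<forall>x. 0 \<le> \<Phi> x) \<and> \<Phi> \<in> borel_measurable borel \<and>
    (\<integral>\<^sup>+x. ennreal (\<Phi> x) \<partial>lborel) = ennreal h * (\<integral>\<^sup>+x. ennreal (\<phi> x) \<partial>lborel)"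
proof -
  have c\<beta>: "isCont (\<beta> i n) x" for i n x
    using \<beta> by (rule DERIV_isCont)
  have c\<beta>': "continuous_on A (\<beta> i n)" for A i n
    using c\<beta> by (simp add: continuous_at_imp_continuous_on)
  have [measurable]: "\<beta> i n \<in> borel_measurable borel" for i n
    by (intro borel_measurable_continuous_onI c\<beta>')
  have [measurable]: "\<phi> \<in> borel_measurable borel"
    unfolding \<phi>_def[abs_def] by measurable
  have \<phi>nn: "0 \<le> \<phi> x" for x
    unfolding \<phi>_def using \<beta>01 by (intro prod_nonneg) auto
  obtain B where B: "\<And>x. (B has_real_derivative \<beta> e 0 x) (at x)"
    using einterval_antiderivative[of "-\<infinity>" \<infinity> "\<beta> e 0"] c\<beta>
    by (auto simp: has_real_derivative_iff_has_vector_derivative)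
  \<comment> \<open>In the direction \<open>e\<close> the factor is replaced by
    \<open>B x - B (x - h)\<close>, the integral of \<open>\<beta> e 0\<close> over an interval of
    length \<open>h\<close>; its derivative is the difference of the bump and its shift.\<close>
  define bb where "bb i n x = (if i = e then (case n of 0 \<Rightarrow> B x - B (x - h) | Suc n \<Rightarrow> \<beta> e n x - \<beta> e n (x - h))
    else \<beta> i n x)" for i n x
  have shift: "((\<lambda>x. f (x - h)) has_real_derivative D) (at x)" if "(f has_real_derivative D) (at (x - h))"
      for f D x
    using DERIV_shift[of f D x "-h"] that by simp
  have bbd: "(bb i n has_real_derivative bb i (Suc n) x) (at x)" for i n x
    unfolding bb_def[abs_def] using \<beta> B shift by (cases n) (auto intro!: DERIV_diff)
  define \<Phi> where "\<Phi> x = (\<Prod>i\<in>Basis. bb i 0 (x \<bullet> i))" for x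
  have \<Phi>d: "\<Phi> differentiable (at x)" for x
    using prod_coords_has_derivative(1)[of bb "\<lambda>_. 0" x] bbd unfolding \<Phi>_def[abs_def] by simp
  then have "continuous_on UNIV \<Phi>"
    by (simp add: continuous_at_imp_continuous_on differentiable_imp_continuous_within)
  then have \<Phi>m: "\<Phi> \<in> borel_measurable borel"
    by (rule borel_measurable_continuous_onI)
  have FTC: "has_bochner_integral lborel (\<lambda>\<tau>. indicator {0..h} \<tau> *\<^sub>R \<beta> e 0 (x - \<tau>)) (B x - B (x - h))" for x
  proof -
    have "has_bochner_integral lborel (\<lambda>\<tau>. indicator {0..h} \<tau> *\<^sub>R \<beta> e 0 (x - \<tau>)) (- B (x - h) - (- B (x -
        0)))"
    proof (rule has_bochner_integral_FTC_Icc)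
      show "((\<lambda>\<tau>. - B (x - \<tau>)) has_vector_derivative \<beta> e 0 (x - t)) (at t within {0..h})" for t
        unfolding has_real_derivative_iff_has_vector_derivative[symmetric]
        by (rule has_field_derivative_at_within) (auto intro!: derivative_eq_intros DERIV_chain2[OF B])
      show "continuous_on {0..h} (\<lambda>\<tau>. \<beta> e 0 (x - \<tau>))"
        by (intro continuous_on_compose2[OF c\<beta>'[of UNIV]] continuous_intros) auto
    qed (use h in simp)
    then show ?thesis
      by simp
  qed
  have \<Phi>eq: "has_bochner_integral lborel (\<lambda>\<tau>. indicator {0..h} \<tau> * \<phi> (x - \<tau> *\<^sub>R e)) (\<Phi> x)" for x
  proof -
    have 1: "\<phi> (x - \<tau> *\<^sub>R e) = \<beta> e 0 (x \<bullet> e - \<tau>) * (\<Prod>i\<in>Basis - {e}. \<beta> i 0 (x \<bullet> i))" for \<tau>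
      unfolding \<phi>_def using e
      by (subst prod.remove[of Basis e]) (auto simp: inner_diff_left inner_Basis split: if_splits intro!:
          prod.cong arg_cong2[where f = "(*)"])
    have 2: "\<Phi> x = (B (x \<bullet> e) - B (x \<bullet> e - h)) * (\<Prod>i\<in>Basis - {e}. \<beta> i 0 (x \<bullet> i))"
      unfolding \<Phi>_def using e by (subst prod.remove[of Basis e]) (auto simp: bb_def intro!: prod.cong)
    show ?thesis
      unfolding 1 2 using has_bochner_integral_mult_left[OF FTC[of "x \<bullet> e"], of "\<Prod>i\<in>Basis - {e}. \<beta> i 0 (x
          \<bullet> i)"]
      by (simp add: mult_ac)
  qed
  have \<Phi>nn: "0 \<le> \<Phi> x" for x
    using \<Phi>eq[of x] \<phi>nn by (metis (no_types, lifting) has_bochner_integral_integral_eq indicator_pos_le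
        integral_nonneg_AE AE_I2 mult_nonneg_nonneg)
  have \<phi>0: "\<phi> x = 0" if "x \<notin> box a b" for x
    using that \<beta>0 unfolding \<phi>_def by (auto simp: mem_box)
  have \<Phi>0: "\<Phi> x = 0" if x: "x \<notin> cbox a (b + h *\<^sub>R e)" for x
  proof -
    have "indicator {0..h} \<tau> * \<phi> (x - \<tau> *\<^sub>R e) = 0" for \<tau>
    proof (rule ccontr)
      assume "indicator {0..h} \<tau> * \<phi> (x - \<tau> *\<^sub>R e) \<noteq> 0"
      then have \<tau>: "0 \<le> \<tau>" "\<tau> \<le> h" and box: "x - \<tau> *\<^sub>R e \<in> box a b"
        using \<phi>0 by (auto simp: indicator_def split: if_splits)
      have "a \<bullet> i \<le> x \<bullet> i \<and> x \<bullet> i \<le> (b + h *\<^sub>R e) \<bullet> i" if i: "i \<in> Basis" for i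
        using box i \<tau> e unfolding mem_box
        by (cases "i = e") (force simp: inner_diff_left inner_add_left inner_Basis)+
      then show False
        using x by (auto simp: mem_box)
    qed
    then have "(LINT \<tau>|lborel. indicator {0..h} \<tau> * \<phi> (x - \<tau> *\<^sub>R e)) = 0"
      by (simp only: Bochner_Integration.integral_zero)
    then show ?thesis
      using has_bochner_integral_integral_eq[OF \<Phi>eq[of x]] by simp
  qed
  have "\<Phi> \<in> test_functions U"
    unfolding test_functions_def using smooth_on_prod_coords[of bb "\<lambda>_. 0"] bbd \<Phi>0 U
    by (auto simp: \<Phi>_def[abs_def] intro!: exI[of _ "cbox a (b + h *\<^sub>R e)"])
  moreover have "frechet_derivative \<Phi> (at x) e = \<phi> x - \<phi> (x - h *\<^sub>R e)" for x
  proof -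
    have "frechet_derivative \<Phi> (at x) e = (\<Prod>i\<in>Basis. bb i (((\<lambda>_. 0)(e := Suc 0)) i) (x \<bullet> i))"
      unfolding \<Phi>_def[abs_def] using prod_coords_has_derivative(2)[of bb e "\<lambda>_. 0" x] bbd e by simp
    also have "\<dots> = (\<beta> e 0 (x \<bullet> e) - \<beta> e 0 (x \<bullet> e - h)) * (\<Prod>i\<in>Basis - {e}. \<beta> i 0 (x \<bullet> i))"
      using e by (subst prod.remove[of Basis e]) (auto simp: bb_def intro!: prod.cong)
    also have "\<dots> = \<phi> x - \<phi> (x - h *\<^sub>R e)"
    proof -
      have "\<phi> (x - h *\<^sub>R e) = \<beta> e 0 (x \<bullet> e - h) * (\<Prod>i\<in>Basis - {e}. \<beta> i 0 (x \<bullet> i))"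
        unfolding \<phi>_def using e
        by (subst prod.remove[of Basis e]) (auto simp: inner_diff_left inner_Basis split: if_splits
            intro!: prod.cong arg_cong2[where f = "(*)"])
      moreover have "\<phi> x = \<beta> e 0 (x \<bullet> e) * (\<Prod>i\<in>Basis - {e}. \<beta> i 0 (x \<bullet> i))"
        unfolding \<phi>_def using e by (subst prod.remove[of Basis e]) auto
      ultimately show ?thesis
        by (simp add: algebra_simps)
    qed
    finally show ?thesis .
  qed
  moreover have "(\<integral>\<^sup>+x. ennreal (\<Phi> x) \<partial>lborel) = ennreal h * (\<integral>\<^sup>+x. ennreal (\<phi> x) \<partial>lborel)"
  proof -
    \<comment> \<open>Tonelli and translation invariance: all shifts have the same integral, and
      \<open>\<tau>\<close> ranges over an interval of length \<open>h\<close>.\<close>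
    have "(\<integral>\<^sup>+x. ennreal (\<Phi> x) \<partial>lborel) = (\<integral>\<^sup>+x. (\<integral>\<^sup>+\<tau>. ennreal (indicator {0..h} \<tau> * \<phi> (x - \<tau> *\<^sub>R e))
        \<partial>lborel) \<partial>lborel)"
    proof (intro nn_integral_cong)
      fix x
      show "ennreal (\<Phi> x) = (\<integral>\<^sup>+\<tau>. ennreal (indicator {0..h} \<tau> * \<phi> (x - \<tau> *\<^sub>R e)) \<partial>lborel)"
        using \<Phi>eq[of x] \<phi>nn by (subst nn_integral_eq_integral) (auto simp: has_bochner_integral_iff)
    qed
    also have "\<dots> = (\<integral>\<^sup>+\<tau>. (\<integral>\<^sup>+x. ennreal (indicator {0..h} \<tau> * \<phi> (x - \<tau> *\<^sub>R e)) \<partial>lborel) \<partial>lborel)"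
      by (rule lborel_pair.Fubini') measurable
    also have "\<dots> = (\<integral>\<^sup>+\<tau>. indicator {0..h} \<tau> * (\<integral>\<^sup>+x. ennreal (\<phi> x) \<partial>lborel) \<partial>lborel)"
    proof (intro nn_integral_cong)
      fix \<tau> :: real
      have "(\<integral>\<^sup>+x. ennreal (indicator {0..h} \<tau> * \<phi> (x - \<tau> *\<^sub>R e)) \<partial>lborel) =
          (\<integral>\<^sup>+x. indicator {0..h} \<tau> * ennreal (\<phi> (x + - \<tau> *\<^sub>R e)) \<partial>lborel)"
        by (intro nn_integral_cong) (auto simp: indicator_def)
      also have "\<dots> = indicator {0..h} \<tau> * (\<integral>\<^sup>+x. ennreal (\<phi> (x + - \<tau> *\<^sub>R e)) \<partial>lborel)"
        by (rule nn_integral_cmult) measurable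
      also have "(\<integral>\<^sup>+x. ennreal (\<phi> (x + - \<tau> *\<^sub>R e)) \<partial>lborel) = (\<integral>\<^sup>+x. ennreal (\<phi> x) \<partial>lborel)"
        by (rule nn_integral_lborel_shift[of "\<lambda>x. ennreal (\<phi> x)"]) measurable
      finally show "(\<integral>\<^sup>+x. ennreal (indicator {0..h} \<tau> * \<phi> (x - \<tau> *\<^sub>R e)) \<partial>lborel) =
          indicator {0..h} \<tau> * (\<integral>\<^sup>+x. ennreal (\<phi> x) \<partial>lborel)" .
    qed
    also have "\<dots> = ennreal h * (\<integral>\<^sup>+x. ennreal (\<phi> x) \<partial>lborel)"
      using h by (subst nn_integral_multc) auto
    finally show ?thesis .
  qed
  ultimately show ?thesis
    using \<Phi>nn \<Phi>m by (intro bexI[of _ \<Phi>]) auto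
qed

lemma Linf_zero_extension:
  assumes U: "open U" and f: "f \<in> Linf U"
  shows "\<exists>C\<ge>0. (\<lambda>x. indicator U x * f x) \<in> borel_measurable borel \<and>
    (AE x in lborel. \<bar>indicator U x * f x\<bar> \<le> C)"
proof -
  obtain C where C: "AE x in restrict_space lborel U. \<bar>f x\<bar> \<le> C" and m: "f \<in> borel_measurable
      (restrict_space lborel U)"
    using f by (auto simp: Linf_def)
  have Us: "U \<in> sets borel"
    using U by simp
  have "(\<lambda>x. indicator U x * f x) \<in> borel_measurable borel"
    using m Us borel_measurable_restrict_space_iff[of U lborel f] by simp
  moreover have "AE x in lborel. \<bar>indicator U x * f x\<bar> \<le> \<bar>C\<bar>"
    using C Us by (auto simp: AE_restrict_space_iff indicator_def elim!: eventually_mono)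
  ultimately show ?thesis
    by (intro exI[of _ "\<bar>C\<bar>"]) auto
qed

text \<open>Testing the weak derivative with shifted bumps that increase to the indicator of a box.\<close>

lemma weak_partial_box_difference:
  fixes f g :: "'a::euclidean_space \<Rightarrow> real"
  assumes U: "open U" and e: "e \<in> Basis" and h: "0 < h"
    and wp: "weak_partial U e f g"
    and fm: "(\<lambda>x. indicator U x * f x) \<in> borel_measurable borel"
    and fC: "AE x in lborel. \<bar>indicator U x * f x\<bar> \<le> C"
    and gm: "(\<lambda>x. indicator U x * g x) \<in> borel_measurable borel"
    and gL: "AE x in lborel. \<bar>indicator U x * g x\<bar> \<le> L" and L: "0 \<le> L"
    and sub: "cbox a (b + h *\<^sub>R e) \<subseteq> U"
  defines "F x \<equiv> indicator U x * f x"
  shows "\<bar>LINT x|lborel. indicator (box a b) x * (F (x + h *\<^sub>R e) - F x)\<bar> \<le> L * h * measure lborel (box a b)"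
proof -
  have Us: "U \<in> sets borel"
    using U by simp
  have [measurable]: "F \<in> borel_measurable borel"
    using fm by (simp add: F_def[abs_def])
  have FC: "AE x in lborel. \<bar>F x\<bar> \<le> C"
    using fC by (simp add: F_def)
  have FC': "AE x in lborel. \<bar>F (x + c)\<bar> \<le> C" for c
  proof -
    have "AE x in distr lborel borel ((+) c). \<bar>F x\<bar> \<le> C"
      unfolding lborel_distr_plus by (rule FC)
    then show ?thesis
      by (subst (asm) AE_distr_iff) (auto simp: add.commute)
  qed
  define bumps where "bumps u v \<beta> \<longleftrightarrow> (\<forall>m n x. (\<beta> m n has_real_derivative \<beta> m (Suc n) x) (at x)) \<and>
    (\<forall>m x. 0 \<le> \<beta> m 0 x \<and> \<beta> m 0 x \<le> 1) \<and> (\<forall>m n x. x \<notin> {u<..<v} \<longrightarrow> \<beta> m n x = 0) \<and>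
    (\<forall>x\<in>{u<..<v}. (\<lambda>m. \<beta> m 0 x) \<longlonglongrightarrow> 1)" for u v :: real and \<beta> :: "nat \<Rightarrow> nat \<Rightarrow> real \<Rightarrow> real"
  have "\<forall>i. \<exists>\<beta>. bumps (a \<bullet> i) (b \<bullet> i) \<beta>"
    unfolding bumps_def by (intro allI smooth_bumps_exist)
  then obtain \<beta> where bumps: "\<And>i. bumps (a \<bullet> i) (b \<bullet> i) (\<beta> i)"
    by metis
  have \<beta>: "(\<beta> i m n has_real_derivative \<beta> i m (Suc n) x) (at x)"
    and \<beta>01: "0 \<le> \<beta> i m 0 x \<and> \<beta> i m 0 x \<le> 1" for i m n x
    using bumps[of i] unfolding bumps_def by simp_all
  have \<beta>0: "\<beta> i m n x = 0" if "x \<notin> {a \<bullet> i<..<b \<bullet> i}" for i m n x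
    using bumps[of i] that unfolding bumps_def by simp
  have \<beta>1: "(\<lambda>m. \<beta> i m 0 x) \<longlonglongrightarrow> 1" if "x \<in> {a \<bullet> i<..<b \<bullet> i}" for i x
    using bumps[of i] that unfolding bumps_def by simp
  define \<phi> where "\<phi> m x = (\<Prod>i\<in>Basis. \<beta> i m 0 (x \<bullet> i))" for m and x :: 'a
  have "isCont (\<beta> i m n) x" for i m n x
    using \<beta> by (rule DERIV_isCont)
  then have [measurable]: "\<beta> i m n \<in> borel_measurable borel" for i m n
    by (intro borel_measurable_continuous_onI) (simp add: continuous_at_imp_continuous_on)
  have [measurable]: "\<phi> m \<in> borel_measurable borel" for m
    unfolding \<phi>_def[abs_def] by measurable
  have \<phi>01: "0 \<le> \<phi> m x" "\<phi> m x \<le> indicator (box a b) x" for m x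
  proof -
    show nn: "0 \<le> \<phi> m x"
      unfolding \<phi>_def using \<beta>01 by (intro prod_nonneg) auto
    have "\<phi> m x \<le> 1"
      unfolding \<phi>_def using \<beta>01 by (intro prod_le_1) auto
    moreover have "\<phi> m x = 0" if nb: "x \<notin> box a b"
    proof -
      obtain i where i: "i \<in> Basis" "x \<bullet> i \<notin> {a \<bullet> i<..<b \<bullet> i}"
        using nb by (auto simp: mem_box)
      then show ?thesis
        unfolding \<phi>_def using \<beta>0[OF i(2)] i(1) by (intro prod_zero bexI[of _ i]) auto
    qed
    ultimately show "\<phi> m x \<le> indicator (box a b) x"
      by (cases "x \<in> box a b") auto
  qed
  have \<phi>1: "(\<lambda>m. \<phi> m x) \<longlonglongrightarrow> indicator (box a b) x" for x
  proof (cases "x \<in> box a b")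
    case True
    then have "(\<lambda>m. \<phi> m x) \<longlonglongrightarrow> (\<Prod>i\<in>(Basis::'a set). 1)"
      unfolding \<phi>_def by (intro tendsto_prod \<beta>1) (auto simp: mem_box)
    with True show ?thesis
      by simp
  next
    case False
    then have "\<phi> m x = 0" for m
      using \<phi>01[of m x] by simp
    with False show ?thesis
      by simp
  qed
  have fin: "emeasure lborel (box a b) < \<infinity>"
    by (rule emeasure_lborel_box_finite)
  have ib: "integrable lborel (\<lambda>x. indicator (box a b) x * c)" for c :: real
    using fin by (intro integrable_mult_left) (simp add: integrable_indicator_iff)
  have i\<phi>: "integrable lborel (\<phi> m)" for m
    using \<phi>01[of m] by (intro Bochner_Integration.integrable_bound[OF ib[of 1]]) auto
  have iF: "integrable lborel (\<lambda>x. F (x + c) * \<phi> m x)" for c m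
  proof (rule Bochner_Integration.integrable_bound[OF ib[of C]])
    show "AE x in lborel. norm (F (x + c) * \<phi> m x) \<le> norm (indicator (box a b) x * C)"
      using FC'[of c]
    proof eventually_elim
      case (elim x)
      have "\<bar>F (x + c)\<bar> * \<bar>\<phi> m x\<bar> \<le> \<bar>C\<bar> * indicator (box a b) x"
        using elim \<phi>01[of m x] by (intro mult_mono) auto
      then show ?case
        by (simp add: abs_mult mult.commute)
    qed
  qed measurable
  have step: "\<bar>LINT x|lborel. (F (x + h *\<^sub>R e) - F x) * \<phi> m x\<bar> \<le> L * h * measure lborel (box a b)" for m
  proof -
    obtain \<Phi> where \<Phi>: "\<Phi> \<in> test_functions U" "\<And>x. frechet_derivative \<Phi> (at x) e = \<phi> m x - \<phi> m (x - h *\<^sub>R e)"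
      "\<And>x. 0 \<le> \<Phi> x" "\<Phi> \<in> borel_measurable borel"
      "(\<integral>\<^sup>+x. ennreal (\<Phi> x) \<partial>lborel) = ennreal h * (\<integral>\<^sup>+x. ennreal (\<phi> m x) \<partial>lborel)"
      using shifted_bump_test_function[OF e h sub, of "\<lambda>i. \<beta> i m"] \<beta> \<beta>01 \<beta>0 unfolding \<phi>_def by blast
    have nn: "(\<integral>\<^sup>+x. ennreal (\<Phi> x) \<partial>lborel) = ennreal (h * (LINT x|lborel. \<phi> m x))"
      unfolding \<Phi>(5) using h by (subst nn_integral_eq_integral[OF i\<phi>]) (auto simp: \<phi>01 ennreal_mult
          integral_nonneg_AE)
    then have i\<Phi>: "integrable lborel \<Phi>"
      using \<Phi>(3,4) by (intro integrableI_nonneg) auto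
    have \<Phi>int: "(LINT x|lborel. \<Phi> x) = h * (LINT x|lborel. \<phi> m x)"
      using nn h nn_integral_eq_integral[OF i\<Phi>] \<Phi>(3) by (simp add: \<phi>01 integral_nonneg_AE)
    have "(LINT x|lborel. indicator U x * (f x * (\<phi> m x - \<phi> m (x - h *\<^sub>R e)))) = - (LINT x|lborel.
        indicator U x * (g x * \<Phi> x))"
      using wp[unfolded weak_partial_def, rule_format, OF \<Phi>(1)] Us by (simp add: integral_restrict_space \<Phi>(2))
    then have eq: "(LINT x|lborel. F x * (\<phi> m x - \<phi> m (x - h *\<^sub>R e))) = - (LINT x|lborel. (indicator U x *
        g x) * \<Phi> x)"
      by (simp add: F_def mult_ac)
    \<comment> \<open>Discrete integration by parts: translation by \<open>h *\<^sub>R e\<close>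
      moves the difference from the bump to \<open>F\<close>.\<close>
    have sh: "integrable lborel (\<lambda>x. F x * \<phi> m (x - h *\<^sub>R e))"
        "(LINT x|lborel. F x * \<phi> m (x - h *\<^sub>R e)) = (LINT x|lborel. F (x + h *\<^sub>R e) * \<phi> m x)"
      using lborel_shift[of "\<lambda>x. F x * \<phi> m (x - h *\<^sub>R e)" "h *\<^sub>R e"] iF[of "h *\<^sub>R e" m] by simp_all
    have "(LINT x|lborel. (F (x + h *\<^sub>R e) - F x) * \<phi> m x) = (LINT x|lborel. F (x + h *\<^sub>R e) * \<phi> m x) -
        (LINT x|lborel. F x * \<phi> m x)"
      using iF[of "h *\<^sub>R e" m] iF[of 0 m] by (simp add: left_diff_distrib)
    also have "\<dots> = - (LINT x|lborel. F x * (\<phi> m x - \<phi> m (x - h *\<^sub>R e)))"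
      using sh iF[of 0 m] by (simp add: right_diff_distrib)
    also have "\<dots> = (LINT x|lborel. (indicator U x * g x) * \<Phi> x)"
      unfolding eq by simp
    also have "\<bar>\<dots>\<bar> \<le> (LINT x|lborel. \<bar>(indicator U x * g x) * \<Phi> x\<bar>)"
      by (rule integral_abs_bound)
    also have "\<dots> \<le> (LINT x|lborel. L * \<Phi> x)"
    proof (rule integral_mono_AE)
      show le: "AE x in lborel. \<bar>(indicator U x * g x) * \<Phi> x\<bar> \<le> L * \<Phi> x"
        using gL by eventually_elim (auto simp: abs_mult \<Phi>(3) intro!: mult_right_mono)
      show "integrable lborel (\<lambda>x. L * \<Phi> x)"
        using i\<Phi> by simp
      show "integrable lborel (\<lambda>x. \<bar>(indicator U x * g x) * \<Phi> x\<bar>)"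
      proof (rule Bochner_Integration.integrable_bound[of _ "\<lambda>x. L * \<Phi> x"])
        show "(\<lambda>x. \<bar>(indicator U x * g x) * \<Phi> x\<bar>) \<in> borel_measurable lborel"
          using gm \<Phi>(4) by measurable
        show "AE x in lborel. norm \<bar>(indicator U x * g x) * \<Phi> x\<bar> \<le> norm (L * \<Phi> x)"
          using le by eventually_elim simp
      qed (use i\<Phi> in simp)
    qed
    also have "\<dots> = L * h * (LINT x|lborel. \<phi> m x)"
      by (simp add: \<Phi>int)
    also have "\<dots> \<le> L * h * (LINT x|lborel. indicator (box a b) x)"
      using L h i\<phi> ib[of 1] \<phi>01 by (intro mult_left_mono integral_mono) auto
    finally show ?thesis
      by simp
  qed
  have "(\<lambda>m. LINT x|lborel. (F (x + h *\<^sub>R e) - F x) * \<phi> m x) \<longlonglongrightarrow>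
      (LINT x|lborel. (F (x + h *\<^sub>R e) - F x) * indicator (box a b) x)"
  proof (rule integral_dominated_convergence)
    show "AE x in lborel. norm ((F (x + h *\<^sub>R e) - F x) * \<phi> m x) \<le> indicator (box a b) x * (2 * C)" for m
      using FC'[of "h *\<^sub>R e"] FC
    proof eventually_elim
      case (elim x)
      have "\<bar>F (x + h *\<^sub>R e) - F x\<bar> * \<bar>\<phi> m x\<bar> \<le> (2 * C) * indicator (box a b) x"
        using elim \<phi>01[of m x] by (intro mult_mono) auto
      then show ?case
        by (simp add: abs_mult mult_ac)
    qed
    show "AE x in lborel. (\<lambda>m. (F (x + h *\<^sub>R e) - F x) * \<phi> m x) \<longlonglongrightarrow> (F (x + h *\<^sub>R e) - F x) * indicator (box
        a b) x"
      by (intro AE_I2 tendsto_intros \<phi>1)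
  qed (use ib in measurable)
  from tendsto_rabs[OF this] show ?thesis
    using step by (intro LIMSEQ_le_const2[of _ _ "L * h * measure lborel (box a b)"]) (auto simp:
        mult.commute)
qed

text \<open>Averages of the difference \<open>k\<close> over small boxes with corner
  \<open>x\<close> are bounded by \<open>L * h\<close> through the weak derivative, and for almost
  every \<open>x\<close> they converge to \<open>k x\<close> by Lebesgue differentiation. The
  exceptional null set depends on \<open>h\<close>, hence the quantifier order.\<close>

lemma W1inf_difference_quotient_bounded:
  fixes f :: "'a::euclidean_space \<Rightarrow> real"
  assumes U: "open U" and f: "f \<in> W1inf U" and e: "e \<in> Basis"
  shows "\<exists>L\<ge>0. \<forall>h>0. AE x in lborel. closed_segment x (x + h *\<^sub>R e) \<subseteq> U \<longrightarrow> \<bar>f (x + h *\<^sub>R e) - f x\<bar> \<le> L * h"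
proof -
  obtain g where g: "g \<in> Linf U" and wp: "weak_partial U e f g"
    using f e by (auto simp: W1inf_def)
  define F where "F x = indicator U x * f x" for x
  obtain C where fm: "(\<lambda>x. indicator U x * f x) \<in> borel_measurable borel" and fC: "AE x in lborel.
      \<bar>indicator U x * f x\<bar> \<le> C"
    using Linf_zero_extension[OF U, of f] f by (auto simp: W1inf_def)
  obtain L where L: "0 \<le> L" and gm: "(\<lambda>x. indicator U x * g x) \<in> borel_measurable borel" and gL: "AE x in
      lborel. \<bar>indicator U x * g x\<bar> \<le> L"
    using Linf_zero_extension[OF U g] by auto
  have Fm [measurable]: "F \<in> borel_measurable borel"
    using fm by (simp add: F_def[abs_def])
  have "AE x in lborel. closed_segment x (x + h *\<^sub>R e) \<subseteq> U \<longrightarrow> \<bar>f (x + h *\<^sub>R e) - f x\<bar> \<le> L * h" if h: "0 <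
      h" for h
  proof -
    define k where "k x = F (x + h *\<^sub>R e) - F x" for x
    have [measurable]: "k \<in> borel_measurable borel"
      unfolding k_def[abs_def] by measurable
    have "AE x in distr lborel borel ((+) (h *\<^sub>R e)). \<bar>F x\<bar> \<le> C"
      unfolding lborel_distr_plus F_def by (rule fC)
    then have "AE x in lborel. \<bar>F (x + h *\<^sub>R e)\<bar> \<le> C"
      by (subst (asm) AE_distr_iff) (auto simp: add.commute)
    then have kC: "AE x in lborel. \<bar>k x\<bar> \<le> 2 * C"
      using fC by eventually_elim (simp add: k_def F_def)
    have kint: "set_integrable lborel (cbox a b) k" for a b
      unfolding set_integrable_def
    proof (rule Bochner_Integration.integrable_bound[of _ "\<lambda>x. indicator (cbox a b) x * (2 * C)"])
      show "integrable lborel (\<lambda>x. indicator (cbox a b) x * (2 * C) :: real)"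
        using emeasure_lborel_cbox_finite[of a b] by (intro integrable_mult_left) (simp add:
            integrable_indicator_iff)
      show "AE x in lborel. norm (indicator (cbox a b) x *\<^sub>R k x) \<le> norm (indicator (cbox a b) x * (2 * C))"
        using kC by eventually_elim (auto simp: indicator_def)
    qed measurable
    have kI: "k integrable_on cbox a b" "integral (cbox a b) k = (LINT x|lborel. indicator (cbox a b) x *
        k x)" for a b
      using set_borel_integral_eq_integral[OF kint] by (auto simp: set_lebesgue_integral_def)
    obtain N where N: "negligible N"
      and ld: "\<And>x \<epsilon>. x \<notin> N \<Longrightarrow> 0 < \<epsilon> \<Longrightarrow> \<exists>d>0. \<forall>\<eta>. 0 < \<eta> \<and> \<eta> < d \<longrightarrow>
        norm (integral (cbox x (x + \<eta> *\<^sub>R One)) k /\<^sub>R \<eta> ^ DIM('a) - k x) < \<epsilon>"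
      using integrable_ccontinuous_explicit[of k] kI(1) by blast
    have "AE x in lborel. x \<notin> N"
    proof -
      have "AE x in lebesgue. x \<notin> N"
        using N by (intro AE_not_in) (simp add: negligible_iff_null_sets)
      then show ?thesis
        by (simp add: AE_completion_iff)
    qed
    then show ?thesis
    proof eventually_elim
      case (elim x)
      show ?case
      proof
        assume seg: "closed_segment x (x + h *\<^sub>R e) \<subseteq> U"
        obtain d where d: "0 < d" "(\<Union>y\<in>closed_segment x (x + h *\<^sub>R e). ball y d) \<subseteq> U"
          using compact_subset_open_imp_ball_epsilon_subset[OF compact_segment U seg] by blast
        have box: "cbox x ((x + \<eta> *\<^sub>R One) + h *\<^sub>R e) \<subseteq> U" if \<eta>: "0 < \<eta>" "\<eta> * real DIM('a) < d" for \<eta>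
        proof
          fix y assume y: "y \<in> cbox x ((x + \<eta> *\<^sub>R One) + h *\<^sub>R e)"
          \<comment> \<open>\<open>p\<close> is the point of the segment at the height of
            \<open>y\<close> in direction \<open>e\<close>, cut off at the end of the segment; every
            coordinate of \<open>y - p\<close> is then at most \<open>\<eta>\<close>, which keeps
            \<open>y\<close> in the tube around the segment.\<close>
          define t where "t = min h ((y - x) \<bullet> e)"
          define p where "p = x + t *\<^sub>R e"
          have yi: "0 \<le> (y - x) \<bullet> i \<and> (y - x) \<bullet> i \<le> \<eta> + (if i = e then h else 0)" if "i \<in> Basis" for i
            using y that e by (force simp: mem_box inner_diff_left inner_add_left inner_Basis)
          have t: "0 \<le> t" "t \<le> h"
            using yi[OF e] h by (auto simp: t_def)
          have "p = (1 - t / h) *\<^sub>R x + (t / h) *\<^sub>R (x + h *\<^sub>R e)"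
            using h by (simp add: p_def algebra_simps)
          then have p: "p \<in> closed_segment x (x + h *\<^sub>R e)"
            using t h unfolding in_segment by (intro exI[of _ "t / h"]) auto
          have "\<bar>(y - p) \<bullet> i\<bar> \<le> \<eta>" if i: "i \<in> Basis" for i
            using yi[OF i] yi[OF e] e i \<eta>(1) by (cases "i = e") (auto simp: p_def t_def inner_diff_left
                inner_add_left inner_Basis min_def)
          then have "norm (y - p) \<le> (\<Sum>i\<in>(Basis::'a set). \<eta>)"
            by (intro order_trans[OF norm_le_l1] sum_mono)
          then have "dist p y < d"
            using \<eta>(2) by (simp add: dist_norm norm_minus_commute mult.commute)
          then show "y \<in> U"
            using d(2) p by (auto simp: subset_iff)
        qed
        have "\<bar>k x\<bar> \<le> L * h + \<epsilon>" if \<epsilon>: "0 < \<epsilon>" for \<epsilon>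
        proof -
          obtain d' where d': "0 < d'" "\<And>\<eta>. 0 < \<eta> \<Longrightarrow> \<eta> < d' \<Longrightarrow> norm (integral (cbox x (x + \<eta> *\<^sub>R One)) k /\<^sub>R
              \<eta> ^ DIM('a) - k x) < \<epsilon>"
            using ld[OF elim \<epsilon>] by blast
          define \<eta> where "\<eta> = min (d' / 2) (d / (2 * real DIM('a)))"
          have \<eta>: "0 < \<eta>" "\<eta> < d'" "\<eta> * real DIM('a) < d"
            using d' d by (auto simp: \<eta>_def min_def field_simps)
          have meas: "measure lborel (box x (x + \<eta> *\<^sub>R One)) = \<eta> ^ DIM('a)"
            using \<eta> by (simp add: measure_lborel_box_eq inner_add_left)
          have "integral (cbox x (x + \<eta> *\<^sub>R One)) k = (LINT y|lborel. indicator (box x (x + \<eta> *\<^sub>R One)) y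
              * k y)"
            unfolding kI(2)
          proof (rule integral_cong_AE)
            have "AE y in lborel. y \<notin> cbox x (x + \<eta> *\<^sub>R One) - box x (x + \<eta> *\<^sub>R One)"
              using negligible_frontier_interval[of x "x + \<eta> *\<^sub>R One"]
              by (intro AE_not_in) (auto simp: negligible_iff_null_sets null_sets_completion_iff)
            then show "AE y in lborel. indicator (cbox x (x + \<eta> *\<^sub>R One)) y * k y = indicator (box x (x +
                \<eta> *\<^sub>R One)) y * k y"
              by eventually_elim (use box_subset_cbox[of x "x + \<eta> *\<^sub>R One"] in \<open>auto simp: indicator_def\<close>)
          qed measurable
          also have "\<bar>\<dots>\<bar> \<le> L * h * \<eta> ^ DIM('a)"
            using weak_partial_box_difference[OF U e h wp fm fC gm gL L box[OF \<eta>(1,3)]]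
            by (simp add: meas k_def F_def)
          finally have "\<bar>integral (cbox x (x + \<eta> *\<^sub>R One)) k /\<^sub>R \<eta> ^ DIM('a)\<bar> \<le> L * h"
            using \<eta>(1) by (simp add: abs_mult field_simps)
          with d'(2)[OF \<eta>(1,2)] show ?thesis
            by simp
        qed
        then have "\<bar>k x\<bar> \<le> L * h"
          by (rule field_le_epsilon)
        moreover have "x \<in> U" "x + h *\<^sub>R e \<in> U"
          using seg by auto
        ultimately show "\<bar>f (x + h *\<^sub>R e) - f x\<bar> \<le> L * h"
          by (simp add: k_def F_def)
      qed
    qed
  qed
  with L show ?thesis
    by blast
qed

text \<open>For smooth \<open>\<sigma>\<close> this is integration by parts with
  \<open>\<sigma> \<ge> c\<close> at \<open>t\<close>. Here the bounds on \<open>\<sigma>\<close>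
  hold only off null sets and say nothing about the point \<open>t\<close>, so \<open>u'\<close> is
  replaced by difference quotients: moving the shift onto \<open>\<sigma>\<close> costs
  \<open>L\<close> times the integral of \<open>u\<close>, a layer of width \<open>h\<close> before
  \<open>t\<close> supplies \<open>c * u t\<close>, and the layer after \<open>a\<close> is
  negligible because \<open>u a = 0\<close>.\<close>

lemma weighted_integral_derivative_ge:
  fixes \<sigma> u u' :: "real \<Rightarrow> real"
  assumes t: "a < t" "t < b"
    and u: "\<And>x. x \<in> {a..b} \<Longrightarrow> (u has_real_derivative u' x) (at x within {a..b})"
    and cu': "continuous_on {a..b} u'"
    and unn: "\<And>x. x \<in> {a..b} \<Longrightarrow> 0 \<le> u x" and ua: "u a = 0"
    and \<sigma>m [measurable]: "\<sigma> \<in> borel_measurable borel"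
    and \<sigma>: "AE x in lborel. x \<in> {a<..<b} \<longrightarrow> c \<le> \<sigma> x \<and> \<bar>\<sigma> x\<bar> \<le> C" and c: "0 \<le> c" and C: "0 \<le> C" and L: "0 \<le> L"
    and lip: "\<And>n. AE x in lborel. a < x \<and> x + 1 / real (Suc n) < b \<longrightarrow> \<bar>\<sigma> (x + 1 / real (Suc n)) - \<sigma> x\<bar> \<le> L
        * (1 / real (Suc n))"
  shows "c * u t - L * (LINT x|lborel. indicator {a<..<t} x * u x) \<le> (LINT x|lborel. indicator {a<..<t} x
      * (\<sigma> x * u' x))"
proof -
  have cu: "continuous_on {a..b} u"
    using u by (meson DERIV_continuous_on)
  obtain M where "\<forall>x\<in>{a..b}. \<bar>u' x\<bar> \<le> M"
    using compact_imp_bounded[OF compact_continuous_image[OF cu' compact_Icc]] unfolding bounded_iff by auto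
  then have M: "\<And>x. x \<in> {a..b} \<Longrightarrow> \<bar>u' x\<bar> \<le> M"
    by blast
  have M0: "0 \<le> M"
    using M[of t] t by auto
  obtain B where "\<forall>x\<in>{a..b}. \<bar>u x\<bar> \<le> B"
    using compact_imp_bounded[OF compact_continuous_image[OF cu compact_Icc]] unfolding bounded_iff by auto
  then have B: "\<And>x. x \<in> {a..b} \<Longrightarrow> \<bar>u x\<bar> \<le> B"
    by blast
  have B0: "0 \<le> B"
    using B[of t] t by auto
  have ulip: "\<bar>u y - u x\<bar> \<le> M * \<bar>y - x\<bar>" if "x \<in> {a..b}" "y \<in> {a..b}" for x y
    using field_differentiable_bound[of "{a..b}" u u' M y x] u M that by simp
  define w where "w x = indicator {a..b} x * u x" for x
  have [measurable]: "w \<in> borel_measurable borel"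
    unfolding w_def[abs_def] using borel_measurable_continuous_on_indicator[OF _ cu] by simp
  have wu: "w x = u x" if "x \<in> {a..b}" for x
    using that by (simp add: w_def)
  have wB: "\<bar>w x\<bar> \<le> B" for x
    using B[of x] B0 by (simp add: w_def indicator_def)
  define h where "h n = 1 / real (Suc n)" for n
  have h: "h n > 0" "h \<longlonglongrightarrow> 0" for n
    unfolding h_def using LIMSEQ_inverse_real_of_nat by (auto simp: inverse_eq_divide)
  have hsmall: "eventually (\<lambda>n. h n < b - t \<and> h n < t - a) sequentially"
    using order_tendstoD(2)[OF h(2), of "b - t"] order_tendstoD(2)[OF h(2), of "t - a"] t
    by (auto intro: eventually_conj)
  have bint: "integrable lborel f" if "f \<in> borel_measurable borel" "AE x in lborel. \<bar>f x\<bar> \<le> indicator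
      {a..b} x * D" for f :: "real \<Rightarrow> real" and D
  proof (rule Bochner_Integration.integrable_bound[of _ "\<lambda>x. indicator {a..b} x * D"])
    show "integrable lborel (\<lambda>x. indicator {a..b} x * D)"
      using t by (intro integrable_mult_left) (simp add: integrable_indicator_iff)
    show "AE x in lborel. norm (f x) \<le> norm (indicator {a..b} x * D)"
      using that(2) by eventually_elim simp
  qed (use that in measurable)
  define q where "q n x = indicator {a<..<t} x * (\<sigma> x * ((w (x + h n) - w x) / h n))" for n x
  have qlow: "- L * (LINT x|lborel. indicator {a<..<t} x * u x) + c * (u t - M * h n) - C * M * h n \<le>
      (LINT x|lborel. q n x)"
    if n: "h n < b - t" "h n < t - a" for n
  proof -
    let ?h = "h n"
    \<comment> \<open>\<open>f1\<close> is the first term of the quotient and \<open>f3 + f4\<close>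
      the second, split off near \<open>a\<close>. Shifting \<open>f4\<close> by one step gives
      \<open>f2\<close>, so that \<open>f1 - f2\<close> compares \<open>\<sigma>\<close> at
      \<open>x\<close> and at \<open>x + ?h\<close> against the same value of
      \<open>w\<close>.\<close>
    define f1 where "f1 x = indicator {a<..<t} x * (\<sigma> x * w (x + ?h))" for x
    define f2 where "f2 x = indicator {a<..<t - ?h} x * (\<sigma> (x + ?h) * w (x + ?h))" for x
    define f3 where "f3 x = indicator {a<..a + ?h} x * (\<sigma> x * w x)" for x
    define f4 where "f4 x = indicator {a + ?h<..<t} x * (\<sigma> x * w x)" for x
    have [measurable]: "f1 \<in> borel_measurable borel" "f2 \<in> borel_measurable borel" "f3 \<in> borel_measurable
        borel" "f4 \<in> borel_measurable borel"
      unfolding f1_def[abs_def] f2_def[abs_def] f3_def[abs_def] f4_def[abs_def] by measurable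
    have \<sigma>w: "\<bar>\<sigma> x\<bar> * \<bar>w y\<bar> \<le> C * B" if "\<bar>\<sigma> x\<bar> \<le> C" for x y
      using that wB[of y] C by (intro mult_mono) auto
    have i1: "integrable lborel f1"
      by (rule bint[of _ "C * B"], measurable, use \<sigma> in eventually_elim) (use t \<sigma>w C B0 in \<open>auto simp:
          f1_def indicator_def abs_mult\<close>)
    have i3: "integrable lborel f3"
      by (rule bint[of _ "C * B"], measurable, use \<sigma> in eventually_elim) (use t n h \<sigma>w C B0 in \<open>auto simp:
          f3_def indicator_def abs_mult\<close>)
    have i4: "integrable lborel f4"
      by (rule bint[of _ "C * B"], measurable, use \<sigma> in eventually_elim) (use t n h(1)[of n] \<sigma>w C B0 in
          \<open>auto simp: f4_def indicator_def abs_mult\<close>)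
    have f24: "f2 x = f4 (x + ?h)" for x
      by (auto simp: f2_def f4_def indicator_def)
    have i2: "integrable lborel f2" and e2: "(LINT x|lborel. f2 x) = (LINT x|lborel. f4 x)"
      using lborel_shift[of f4 ?h] i4 by (simp_all add: f24[abs_def])
    have qeq: "?h * q n x = f1 x - (f3 x + f4 x)" for x
    proof -
      have "indicator {a<..<t} x * (\<sigma> x * w x) = f3 x + f4 x"
        using n h(1)[of n] by (auto simp: f3_def f4_def indicator_def)
      then show ?thesis
        using h(1)[of n] by (simp add: q_def f1_def field_simps)
    qed
    have "?h * (LINT x|lborel. q n x) = (LINT x|lborel. f1 x) - ((LINT x|lborel. f3 x) + (LINT x|lborel.
        f4 x))"
      using i1 i3 i4 by (simp add: qeq flip: integral_mult_right_zero)
    also have "\<dots> = (LINT x|lborel. f1 x - f2 x - f3 x)"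
      using i1 i2 i3 by (simp add: e2)
    finally have eq: "?h * (LINT x|lborel. q n x) = (LINT x|lborel. f1 x - f2 x - f3 x)" .
    \<comment> \<open>Pointwise bounds for these pieces: \<open>L * ?h * k1\<close> is the Lipschitz
      loss, \<open>k2\<close> the gain in the last layer, \<open>k3\<close> the error in the first
      layer, of order \<open>?h^2\<close> after integration. \<open>k4\<close> is \<open>k1\<close>
      shifted back.\<close>
    define k1 where "k1 x = indicator {a<..<t - ?h} x * w (x + ?h)" for x
    define k2 where "k2 x = indicator {t - ?h..<t} x * (c * (u t - M * ?h))" for x
    define k3 where "k3 x = indicator {a<..a + ?h} x * (C * M * ?h)" for x
    define k4 where "k4 x = indicator {a + ?h<..<t} x * w x" for x
    have [measurable]: "k1 \<in> borel_measurable borel" "k4 \<in> borel_measurable borel"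
      unfolding k1_def[abs_def] k4_def[abs_def] by measurable
    have j4: "integrable lborel k4"
      by (rule bint[of _ B], measurable, intro AE_I2) (use t n h(1)[of n] wB B0 in \<open>auto simp: k4_def
          indicator_def\<close>)
    have k14: "k1 x = k4 (x + ?h)" for x
      by (auto simp: k1_def k4_def indicator_def)
    have j1: "integrable lborel k1" and e1: "(LINT x|lborel. k1 x) = (LINT x|lborel. k4 x)"
      using lborel_shift[of k4 ?h] j4 by (simp_all add: k14[abs_def])
    have j2: "integrable lborel k2" and e2': "(LINT x|lborel. k2 x) = ?h * (c * (u t - M * ?h))"
      using h(1)[of n] by (auto simp: k2_def[abs_def] integrable_indicator_iff intro!: integrable_mult_left)
    have j3: "integrable lborel k3" and e3: "(LINT x|lborel. k3 x) = ?h * (C * M * ?h)"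
      using h(1)[of n] by (auto simp: k3_def[abs_def] integrable_indicator_iff intro!: integrable_mult_left)
    have "(LINT x|lborel. - (L * ?h) * k1 x + k2 x - k3 x) \<le> (LINT x|lborel. f1 x - f2 x - f3 x)"
    proof (rule integral_mono_AE)
      show "integrable lborel (\<lambda>x. - (L * ?h) * k1 x + k2 x - k3 x)"
        using j1 j2 j3 by (intro Bochner_Integration.integrable_diff Bochner_Integration.integrable_add
            integrable_mult_right)
      show "integrable lborel (\<lambda>x. f1 x - f2 x - f3 x)"
        using i1 i2 i3 by simp
      show "AE x in lborel. - (L * ?h) * k1 x + k2 x - k3 x \<le> f1 x - f2 x - f3 x"
        using \<sigma> lip[of n]
      proof eventually_elim
        case (elim x)
        have "- (L * ?h) * k1 x + k2 x \<le> f1 x - f2 x"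
        proof (cases "x \<in> {a<..<t}")
          case x: True
          have xh: "x + ?h \<in> {a..b}"
            using x n h(1)[of n] by auto
          have wnn: "0 \<le> w (x + ?h)"
            using unn[OF xh] by (simp add: wu[OF xh])
          show ?thesis
          proof (cases "x < t - ?h")
            case True
            then have "\<bar>\<sigma> (x + ?h) - \<sigma> x\<bar> \<le> L * ?h"
              using elim(2) x n by (simp add: h_def)
            then have "(\<sigma> (x + ?h) - \<sigma> x) * w (x + ?h) \<le> (L * ?h) * w (x + ?h)"
              using wnn by (intro mult_right_mono) auto
            then show ?thesis
              using True x by (simp add: k1_def k2_def f1_def f2_def algebra_simps)
          next
            case False
            have "\<bar>u t - u (x + ?h)\<bar> \<le> M * \<bar>t - (x + ?h)\<bar>"
              using xh t by (intro ulip) auto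
            also have "\<dots> \<le> M * ?h"
              using x False M0 by (intro mult_left_mono) auto
            finally have "u t - M * ?h \<le> w (x + ?h)"
              by (simp add: wu[OF xh])
            then have "c * (u t - M * ?h) \<le> c * w (x + ?h)"
              using c by (rule mult_left_mono)
            also have "\<dots> \<le> \<sigma> x * w (x + ?h)"
              using elim(1) x t wnn by (intro mult_right_mono) auto
            finally show ?thesis
              using False x by (simp add: k1_def k2_def f1_def f2_def)
          qed
        qed (use n h(1)[of n] in \<open>auto simp: k1_def k2_def f1_def f2_def indicator_def\<close>)
        moreover have "f3 x \<le> k3 x"
        proof (cases "x \<in> {a<..a + ?h}")
          case x: True
          then have xab: "x \<in> {a..b}"
            using n t by auto
          have "\<bar>u x - u a\<bar> \<le> M * \<bar>x - a\<bar>"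
            using xab t by (intro ulip) auto
          also have "\<dots> \<le> M * ?h"
            using x M0 by (intro mult_left_mono) auto
          finally have "\<bar>w x\<bar> \<le> M * ?h"
            by (simp add: wu[OF xab] ua)
          then have "\<bar>\<sigma> x\<bar> * \<bar>w x\<bar> \<le> C * (M * ?h)"
            using elim(1) x n t C by (intro mult_mono) auto
          then show ?thesis
            using x abs_ge_self[of "\<sigma> x * w x"] by (simp add: f3_def k3_def abs_mult)
        qed (simp add: f3_def k3_def)
        ultimately show ?case
          by simp
      qed
    qed
    also have "(LINT x|lborel. - (L * ?h) * k1 x + k2 x - k3 x) =
        - (L * ?h) * (LINT x|lborel. k4 x) + ?h * (c * (u t - M * ?h)) - ?h * (C * M * ?h)"
      using j1 j2 j3 by (simp add: e1 e2' e3 flip: minus_mult_left)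
    finally have "?h * (- L * (LINT x|lborel. k4 x) + c * (u t - M * ?h) - C * M * ?h) \<le> ?h * (LINT
        x|lborel. q n x)"
      unfolding eq by (simp add: algebra_simps)
    then have "- L * (LINT x|lborel. k4 x) + c * (u t - M * ?h) - C * M * ?h \<le> (LINT x|lborel. q n x)"
      using h(1)[of n] by (simp only: mult_le_cancel_left_pos)
    moreover have "(LINT x|lborel. k4 x) \<le> (LINT x|lborel. indicator {a<..<t} x * u x)"
    proof -
      have eq: "(\<lambda>x. indicator {a<..<t} x * u x) = (\<lambda>x. indicator {a<..<t} x * w x)"
        using t by (auto simp: w_def indicator_def)
      show ?thesis
      proof (rule integral_mono[OF j4])
        show "integrable lborel (\<lambda>x. indicator {a<..<t} x * u x)"
          unfolding eq by (rule bint[of _ B], measurable, intro AE_I2) (use t wB B0 in \<open>auto simp: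
              indicator_def\<close>)
        show "k4 x \<le> indicator {a<..<t} x * u x" for x
          using t n h(1)[of n] unn[of x] by (auto simp: k4_def indicator_def w_def)
      qed
    qed
    then have "L * (LINT x|lborel. k4 x) \<le> L * (LINT x|lborel. indicator {a<..<t} x * u x)"
      using L by (rule mult_left_mono)
    ultimately show ?thesis
      by simp
  qed
  have qlim: "(\<lambda>n. LINT x|lborel. q n x) \<longlonglongrightarrow> (LINT x|lborel. indicator {a<..<t} x * (\<sigma> x * u' x))"
  proof (rule integral_dominated_convergence)
    have d: "(\<lambda>n. q n x) \<longlonglongrightarrow> indicator {a<..<t} x * (\<sigma> x * u' x)" for x
    proof (cases "x \<in> {a<..<t}")
      case True
      have "(u has_real_derivative u' x) (at x)"
      proof -
        have "x \<in> interior {a..b}"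
          using True t by simp
        from at_within_interior[OF this] show ?thesis
          using u[of x] True t by simp
      qed
      moreover have "eventually (\<lambda>y. w y = u y) (nhds x)"
      proof -
        have "eventually (\<lambda>y. y \<in> {a<..<b}) (nhds x)"
          using True t by (intro eventually_nhds_in_open) auto
        then show ?thesis
          by eventually_elim (simp add: w_def)
      qed
      ultimately have "(w has_real_derivative u' x) (at x)"
        using DERIV_cong_ev[of x x w u "u' x" "u' x"] by blast
      then have "((\<lambda>s. (w (x + s) - w x) / s) \<longlongrightarrow> u' x) (at 0)"
        by (simp add: DERIV_def)
      moreover have "filterlim h (at 0) sequentially"
        by (intro filterlim_atI h(2) always_eventually allI less_imp_neq[OF h(1), symmetric])
      ultimately have "(\<lambda>n. (w (x + h n) - w x) / h n) \<longlonglongrightarrow> u' x"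
        by (rule filterlim_compose)
      then show ?thesis
        unfolding q_def by (intro tendsto_intros)
    qed (simp add: q_def)
    show qm: "q n \<in> borel_measurable lborel" for n
      unfolding q_def[abs_def] by measurable
    show "(\<lambda>x. indicator {a<..<t} x * (\<sigma> x * u' x)) \<in> borel_measurable lborel"
      by (rule borel_measurable_LIMSEQ_real[OF d qm])
    show "AE x in lborel. (\<lambda>n. q n x) \<longlonglongrightarrow> indicator {a<..<t} x * (\<sigma> x * u' x)"
      using d by simp
    \<comment> \<open>Dominating constant: \<open>M\<close> bounds the quotient while
      \<open>x + h n \<le> b\<close>; beyond \<open>b\<close> the extension by zero changes by at
      most \<open>2 * B\<close>, but then \<open>h n > b - t\<close>.\<close>
    show "integrable lborel (\<lambda>x. indicator {a..b} x * (C * (M + 2 * B / (b - t))))"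
      using t by (intro integrable_mult_left) (simp add: integrable_indicator_iff)
    show "AE x in lborel. norm (q n x) \<le> indicator {a..b} x * (C * (M + 2 * B / (b - t)))" for n
      using \<sigma>
    proof eventually_elim
      case (elim x)
      show ?case
      proof (cases "x \<in> {a<..<t}")
        case True
        have "\<bar>w (x + h n) - w x\<bar> \<le> h n * (M + 2 * B / (b - t))"
        proof (cases "x + h n \<le> b")
          case le: True
          have "\<bar>u (x + h n) - u x\<bar> \<le> M * \<bar>x + h n - x\<bar>"
            using True le t h(1)[of n] by (intro ulip) auto
          also have "\<dots> \<le> h n * (M + 2 * B / (b - t))"
            using h(1)[of n] B0 t by (simp add: algebra_simps)
          finally show ?thesis
            using True le t h(1)[of n] by (simp add: wu)
        next
          case False
          have "\<bar>w (x + h n) - w x\<bar> \<le> 2 * B"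
            using wB[of x] wB[of "x + h n"] by linarith
          also have "\<dots> = (b - t) * (2 * B / (b - t))"
            using t by simp
          also have "\<dots> \<le> h n * (2 * B / (b - t))"
            using False True t B0 by (intro mult_right_mono) auto
          also have "\<dots> \<le> h n * (M + 2 * B / (b - t))"
            using h(1)[of n] M0 by (intro mult_left_mono) auto
          finally show ?thesis .
        qed
        then have "\<bar>(w (x + h n) - w x) / h n\<bar> \<le> M + 2 * B / (b - t)"
          using h(1)[of n] by (simp add: abs_divide pos_divide_le_eq mult.commute)
        then have "\<bar>\<sigma> x\<bar> * \<bar>(w (x + h n) - w x) / h n\<bar> \<le> C * (M + 2 * B / (b - t))"
          using elim True t C by (intro mult_mono) auto
        then show ?thesis
          using True t by (simp add: q_def abs_mult)
      next
        case False
        then show ?thesis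
          using C M0 B0 t by (simp add: q_def)
      qed
    qed
  qed
  have "(\<lambda>n. - L * (LINT x|lborel. indicator {a<..<t} x * u x) + c * (u t - M * h n) - C * M * h n) \<longlonglongrightarrow>
      - L * (LINT x|lborel. indicator {a<..<t} x * u x) + c * (u t - M * 0) - C * M * 0"
    by (intro tendsto_intros h(2))
  moreover have "eventually (\<lambda>n. - L * (LINT x|lborel. indicator {a<..<t} x * u x) + c * (u t - M * h n) -
      C * M * h n
      \<le> (LINT x|lborel. q n x)) sequentially"
    using hsmall by eventually_elim (use qlow in blast)
  ultimately have "- L * (LINT x|lborel. indicator {a<..<t} x * u x) + c * (u t - M * 0) - C * M * 0
      \<le> (LINT x|lborel. indicator {a<..<t} x * (\<sigma> x * u' x))"
    by (intro tendsto_le[OF sequentially_bot qlim])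
  then show ?thesis
    by simp
qed

text \<open>Fubini turns the bounds on the product domain into bounds on almost every energy slice.
  The bound on differences has a null set for each step, which is why the steps are restricted to a
  countable family; its null sets can be united.\<close>

lemma W1inf_slices:
  fixes S :: "'a::euclidean_space \<times> real \<Rightarrow> real"
  assumes R: "open R" and S: "S \<in> W1inf (R \<times> {a<..<b})"
    and c: "AE x in restrict_space lborel (R \<times> {a<..<b}). c \<le> S x"
  shows "\<exists>C\<ge>0. \<exists>L\<ge>0. AE r in lborel. r \<in> R \<longrightarrow>
    (\<lambda>x. indicator {a<..<b} x * S (r, x)) \<in> borel_measurable borel \<and>
    (AE x in lborel. x \<in> {a<..<b} \<longrightarrow> c \<le> indicator {a<..<b} x * S (r, x) \<and> \<bar>indicator {a<..<b} x * S (r,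
        x)\<bar> \<le> C) \<and>
    (\<forall>n. AE x in lborel. a < x \<and> x + 1 / real (Suc n) < b \<longrightarrow>
      \<bar>indicator {a<..<b} (x + 1 / real (Suc n)) * S (r, x + 1 / real (Suc n)) - indicator {a<..<b} x * S
          (r, x)\<bar> \<le> L * (1 / real (Suc n)))"
proof -
  let ?U = "R \<times> {a<..<b}"
  have U: "open ?U"
    using R by (intro open_Times) auto
  have Us: "?U \<in> sets borel"
    using U by simp
  obtain C where C: "0 \<le> C" and fm: "(\<lambda>x. indicator ?U x * S x) \<in> borel_measurable borel" and fC: "AE x in
      lborel. \<bar>indicator ?U x * S x\<bar> \<le> C"
    using Linf_zero_extension[OF U, of S] S by (auto simp: W1inf_def)
  have "(0, 1) \<in> (Basis :: ('a \<times> real) set)"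
    by (auto simp: Basis_prod_def)
  from W1inf_difference_quotient_bounded[OF U S this] obtain L where L: "0 \<le> L"
    and lip: "\<And>h. 0 < h \<Longrightarrow> AE x in lborel. closed_segment x (x + h *\<^sub>R (0, 1)) \<subseteq> ?U \<longrightarrow> \<bar>S (x + h *\<^sub>R (0, 1))
        - S x\<bar> \<le> L * h"
    by blast
  have c': "AE x in lborel. x \<in> ?U \<longrightarrow> c \<le> S x"
    using c Us by (simp add: AE_restrict_space_iff)
  have sl: "AE r in lborel. AE x in lborel. P (r, x)" if "AE y in lborel. P y" for P :: "'a \<times> real \<Rightarrow> bool"
  proof -
    have "AE y in lborel \<Otimes>\<^sub>M lborel. P y"
      unfolding lborel_prod by (rule that)
    then show ?thesis
      by (rule lborel_pair.AE_pair)
  qed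
  have seg: "closed_segment (r, x) ((r, x) + h *\<^sub>R (0, 1)) \<subseteq> ?U" if "r \<in> R" "a < x" "x + h < b" "0 < h"
      for r x h
  proof
    fix y assume "y \<in> closed_segment (r, x) ((r, x) + h *\<^sub>R (0, 1))"
    then obtain t where t: "0 \<le> t" "t \<le> 1" "y = (1 - t) *\<^sub>R (r, x) + t *\<^sub>R ((r, x) + h *\<^sub>R (0, 1))"
      by (auto simp: in_segment)
    have "y = (r, x + t * h)"
      unfolding t(3) by (simp add: algebra_simps)
    moreover have "0 \<le> t * h" "t * h \<le> h"
      using t that by (auto simp: mult_left_le_one_le)
    then have "a < x + t * h" "x + t * h < b"
      using that by linarith+
    ultimately show "y \<in> ?U"
      using that by simp
  qed
  have "AE r in lborel. \<forall>n. AE x in lborel. closed_segment (r, x) ((r, x) + (1 / real (Suc n)) *\<^sub>R (0, 1))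
      \<subseteq> ?U \<longrightarrow>
      \<bar>S ((r, x) + (1 / real (Suc n)) *\<^sub>R (0, 1)) - S (r, x)\<bar> \<le> L * (1 / real (Suc n))"
    unfolding AE_all_countable by (intro allI sl[OF lip]) simp
  moreover have "AE r in lborel. AE x in lborel. \<bar>indicator ?U (r, x) * S (r, x)\<bar> \<le> C"
    by (rule sl[OF fC])
  moreover have "AE r in lborel. AE x in lborel. (r, x) \<in> ?U \<longrightarrow> c \<le> S (r, x)"
    by (rule sl[OF c'])
  ultimately have "AE r in lborel. r \<in> R \<longrightarrow>
    (\<lambda>x. indicator {a<..<b} x * S (r, x)) \<in> borel_measurable borel \<and>
    (AE x in lborel. x \<in> {a<..<b} \<longrightarrow> c \<le> indicator {a<..<b} x * S (r, x) \<and> \<bar>indicator {a<..<b} x * S (r,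
        x)\<bar> \<le> C) \<and>
    (\<forall>n. AE x in lborel. a < x \<and> x + 1 / real (Suc n) < b \<longrightarrow>
      \<bar>indicator {a<..<b} (x + 1 / real (Suc n)) * S (r, x + 1 / real (Suc n)) - indicator {a<..<b} x * S
          (r, x)\<bar> \<le> L * (1 / real (Suc n)))"
  proof eventually_elim
    case (elim r)
    show ?case
    proof (intro impI conjI allI)
      assume r: "r \<in> R"
      have "(\<lambda>x. indicator ?U (r, x) * S (r, x)) \<in> borel_measurable borel"
        by (rule measurable_compose[OF _ fm]) (simp add: borel_prod[symmetric])
      then show "(\<lambda>x. indicator {a<..<b} x * S (r, x)) \<in> borel_measurable borel"
        using r by (simp add: indicator_times)
      show "AE x in lborel. x \<in> {a<..<b} \<longrightarrow> c \<le> indicator {a<..<b} x * S (r, x) \<and> \<bar>indicator {a<..<b} x * S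
          (r, x)\<bar> \<le> C"
        using elim(2,3) by eventually_elim (use r in \<open>auto simp: indicator_times\<close>)
      show "AE x in lborel. a < x \<and> x + 1 / real (Suc n) < b \<longrightarrow>
        \<bar>indicator {a<..<b} (x + 1 / real (Suc n)) * S (r, x + 1 / real (Suc n)) - indicator {a<..<b} x *
            S (r, x)\<bar> \<le> L * (1 / real (Suc n))" for n
        using elim(1)[rule_format, of n]
      proof eventually_elim
        case (elim x)
        show ?case
        proof
          assume x: "a < x \<and> x + 1 / real (Suc n) < b"
          have pos: "0 < 1 / real (Suc n)"
            by simp
          then have "x < b" "a < x + 1 / real (Suc n)"
            using x by linarith+
          then have "x \<in> {a<..<b}" "x + 1 / real (Suc n) \<in> {a<..<b}"
            using x by (simp_all only: greaterThanLessThan_iff)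
          moreover have "\<bar>S ((r, x) + (1 / real (Suc n)) *\<^sub>R (0, 1)) - S (r, x)\<bar> \<le> L * (1 / real (Suc n))"
            using elim seg[OF r _ _ pos, of x] x by blast
          ultimately show "\<bar>indicator {a<..<b} (x + 1 / real (Suc n)) * S (r, x + 1 / real (Suc n)) -
              indicator {a<..<b} x * S (r, x)\<bar> \<le> L * (1 / real (Suc n))"
            by (simp only: indicator_simps) simp
        qed
      qed
    qed
  qed
  with C L show ?thesis
    by blast
qed

subsection \<open>Integration over the phase space\<close>

lemma AE_fst_pair_measure:
  assumes "sigma_finite_measure M2" and "AE x in M1. P x"
  shows "AE y in M1 \<Otimes>\<^sub>M M2. P (fst y)"
proof -
  interpret M2: sigma_finite_measure M2 by fact
  obtain N where N: "{x \<in> space M1. \<not> P x} \<subseteq> N" "emeasure M1 N = 0" "N \<in> sets M1"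
    using assms(2) by (rule AE_E)
  have "N \<times> space M2 \<in> null_sets (M1 \<Otimes>\<^sub>M M2)"
    using N by (auto simp: null_sets_def M2.emeasure_pair_measure_Times)
  then show ?thesis
    by (rule AE_I') (use N(1) in \<open>auto simp: space_pair_measure\<close>)
qed

lemma gradient_eqI:
  assumes "(f has_derivative (\<lambda>k. D \<bullet> k)) (at x)"
  shows "gradient f x = D"
  unfolding gradient_def
proof (rule the_equality)
  show "GDERIV f x :> D"
    using assms by (simp add: gderiv_def inner_commute)
  fix D' assume "GDERIV f x :> D'"
  then have "(\<lambda>k. D \<bullet> k) = (\<lambda>k. k \<bullet> D')"
    using assms unfolding gderiv_def by (intro has_derivative_unique)
  then have "D \<bullet> k = D' \<bullet> k" for k
    by (metis inner_commute)
  then show "D' = D"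
    by (metis vector_eq_rdot)
qed

lemma finite_measure_restrict_lborel:
  fixes X :: "'a::euclidean_space set"
  assumes "X \<in> sets borel" "bounded X"
  shows "finite_measure (restrict_space lborel X)"
proof
  show "emeasure (restrict_space lborel X) (space (restrict_space lborel X)) \<noteq> \<infinity>"
    using assms emeasure_bounded_finite[OF assms(2)] by (simp add: space_restrict_space
        emeasure_restrict_space)
qed

locale phase_domain =
  fixes R :: "(real^3) set" and a b :: real
  assumes open_R: "open R" and bounded_R: "bounded R" and convex_R: "convex R" and a_less_b: "a < b"
begin

abbreviation "A \<equiv> restrict_space lborel {a<..<b}"
abbreviation "M \<equiv> A \<Otimes>\<^sub>M phase R"

text \<open>Phase space and energies with the boundary included, in the argument order of test
  functions. It is compact, so whatever is continuous on it is bounded and measurable on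
  \<open>M\<close>.\<close>

definition K :: "((real^3) \<times> (real^3) \<times> real) set" where
  "K = closure R \<times> sphere 0 1 \<times> {a..b}"

lemma finite_measures: "finite_measure A" "finite_measure (restrict_space lborel R)" "finite_measure
    (phase R)" "finite_measure M"
proof -
  show A: "finite_measure A" and R: "finite_measure (restrict_space lborel R)"
    using open_R bounded_R by (auto intro!: finite_measure_restrict_lborel)
  show P: "finite_measure (phase R)"
    unfolding phase_def by (intro finite_measure_pair_measure R finite_sphere_measure)
  show "finite_measure M"
    by (intro finite_measure_pair_measure A P)
qed

sublocale A: finite_measure A by (rule finite_measures)
sublocale LR: finite_measure "restrict_space lborel R" by (rule finite_measures)
sublocale P: finite_measure "phase R" by (rule finite_measures)
sublocale M: finite_measure M by (rule finite_measures)
sublocale RS: pair_sigma_finite "restrict_space lborel R" sphere_measure ..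
sublocale AP: pair_sigma_finite A "phase R" ..

lemma space_A: "space A = {a<..<b}"
  and space_phase: "space (phase R) = R \<times> sphere 0 1"
  and space_M: "space M = {a<..<b} \<times> R \<times> sphere 0 1"
  by (auto simp: phase_def space_pair_measure space_restrict_space)

lemma perm_K: "(e, r, s) \<in> space M \<Longrightarrow> (r, s, e) \<in> K"
  using closure_subset[of R] by (auto simp: space_M K_def)

lemma compact_K: "compact K"
  unfolding K_def using bounded_R by (intro compact_Times) auto

lemma measurable_coordinates:
  "(\<lambda>y. fst y) \<in> M \<rightarrow>\<^sub>M borel" "(\<lambda>y. fst (snd y)) \<in> M \<rightarrow>\<^sub>M borel" "(\<lambda>y. snd (snd y)) \<in> M \<rightarrow>\<^sub>M borel"
proof -
  have A: "(\<lambda>x. x) \<in> restrict_space lborel X \<rightarrow>\<^sub>M borel" for X :: "'b::euclidean_space set"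
    by (intro measurable_restrict_space1) simp
  show "(\<lambda>y. fst y) \<in> M \<rightarrow>\<^sub>M borel"
    by (rule measurable_compose[OF measurable_fst A])
  show "(\<lambda>y. fst (snd y)) \<in> M \<rightarrow>\<^sub>M borel"
    unfolding phase_def by (rule measurable_compose[OF measurable_snd measurable_compose[OF measurable_fst
        A]])
  have "(\<lambda>x. x) \<in> sphere_measure \<rightarrow>\<^sub>M borel"
    by (intro continuous_on_sphere_measurable continuous_on_id)
  then show "(\<lambda>y. snd (snd y)) \<in> M \<rightarrow>\<^sub>M borel"
    unfolding phase_def by (rule measurable_compose[OF measurable_snd measurable_compose[OF measurable_snd]])
qed

lemma measurable_on_K:
  fixes k :: "_ \<Rightarrow> 'c::topological_space"
  assumes "continuous_on K k"
  shows "(\<lambda>(e, r, s). k (r, s, e)) \<in> borel_measurable M"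
proof -
  have "(\<lambda>y. (fst (snd y), snd (snd y), fst y)) \<in> M \<rightarrow>\<^sub>M (borel \<Otimes>\<^sub>M (borel \<Otimes>\<^sub>M borel))"
    by (intro measurable_Pair measurable_coordinates)
  then have "(\<lambda>y. (fst (snd y), snd (snd y), fst y)) \<in> M \<rightarrow>\<^sub>M borel"
    by (simp add: borel_prod)
  then have "(\<lambda>y. (fst (snd y), snd (snd y), fst y)) \<in> M \<rightarrow>\<^sub>M restrict_space borel K"
    by (rule measurable_restrict_space2[rotated]) (auto intro: perm_K simp del: space_pair_measure)
  from measurable_compose[OF this borel_measurable_continuous_on_restrict[OF assms]] show ?thesis
    by (simp add: case_prod_beta')
qed

lemma bounded_on_K:
  fixes k :: "_ \<Rightarrow> 'c::real_normed_vector"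
  assumes "continuous_on K k"
  shows "\<exists>B\<ge>0. \<forall>p\<in>K. norm (k p) \<le> B"
proof -
  have "bounded (k ` K)"
    by (intro compact_imp_bounded compact_continuous_image assms compact_K)
  then obtain B where "\<forall>p\<in>K. norm (k p) \<le> B"
    unfolding bounded_iff by blast
  then have "\<forall>p\<in>K. norm (k p) \<le> max B 0"
    by (auto simp: le_max_iff_disj)
  then show ?thesis
    by (intro exI[of _ "max B 0"]) auto
qed

text \<open>A common class for continuous test data and bounded measurable coefficients. It is
  closed under sums and bilinear products and contained in \<open>L2 M\<close>, which settles the
  integrability questions of the energy identity.\<close>

definition essentially_bounded :: "(real \<times> (real^3) \<times> (real^3) \<Rightarrow> 'c::euclidean_space) \<Rightarrow> bool" where
  "essentially_bounded f \<longleftrightarrow> f \<in> borel_measurable M \<and> (\<exists>C. AE y in M. norm (f y) \<le> C)"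

lemma essentially_bounded_on_K:
  fixes k :: "_ \<Rightarrow> 'c::euclidean_space"
  assumes "continuous_on K k"
  shows "essentially_bounded (\<lambda>(e, r, s). k (r, s, e))"
proof -
  obtain B where "\<forall>p\<in>K. norm (k p) \<le> B"
    using bounded_on_K[OF assms] by blast
  then have "AE y in M. norm ((\<lambda>(e, r, s). k (r, s, e)) y) \<le> B"
    by (intro AE_I2) (auto dest: perm_K)
  then show ?thesis
    using measurable_on_K[OF assms] by (auto simp: essentially_bounded_def)
qed

lemma essentially_bounded_bilinear:
  fixes f :: "_ \<Rightarrow> 'c::euclidean_space" and g :: "_ \<Rightarrow> 'd::euclidean_space"
    and B :: "'c \<Rightarrow> 'd \<Rightarrow> 'e::euclidean_space"
  assumes bil: "bounded_bilinear B"
    and f: "essentially_bounded f" and g: "essentially_bounded g"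
  shows "essentially_bounded (\<lambda>y. B (f y) (g y))"
proof -
  have m: "f \<in> borel_measurable M" "g \<in> borel_measurable M"
    using f g by (auto simp: essentially_bounded_def)
  have "(\<lambda>y. B (f y) (g y)) \<in> borel_measurable M"
    by (rule borel_measurable_continuous_Pair[OF m]) (intro bounded_bilinear.continuous_on[OF bil]
        continuous_intros)
  moreover obtain C D where "AE y in M. norm (f y) \<le> C" "AE y in M. norm (g y) \<le> D"
    using f g by (auto simp: essentially_bounded_def)
  then have "AE y in M. norm (B (f y) (g y)) \<le> C * D * norm1"
    if "\<And>x y. norm (B x y) \<le> norm x * norm y * norm1" "0 \<le> norm1" for norm1
  proof eventually_elim
    case (elim y)
    have "norm (B (f y) (g y)) \<le> norm (f y) * norm (g y) * norm1"
      by (rule that)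
    also have "\<dots> \<le> C * D * norm1"
      using elim that(2) by (intro mult_right_mono mult_mono) (auto intro: order_trans[OF norm_ge_zero])
    finally show ?case .
  qed
  ultimately show ?thesis
    using bounded_bilinear.nonneg_bounded[OF bil] unfolding essentially_bounded_def by metis
qed

lemmas essentially_bounded_mult = essentially_bounded_bilinear[OF bounded_bilinear_mult[where 'a = real]]
lemmas essentially_bounded_scaleR = essentially_bounded_bilinear[OF bounded_bilinear_scaleR]
lemmas essentially_bounded_inner = essentially_bounded_bilinear[OF bounded_bilinear_inner]

lemma essentially_bounded_add:
  assumes f: "essentially_bounded f" and g: "essentially_bounded g"
  shows "essentially_bounded (\<lambda>y. f y + g y)"
proof -
  obtain C D where "AE y in M. norm (f y) \<le> C" "AE y in M. norm (g y) \<le> D"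
    using f g by (auto simp: essentially_bounded_def)
  then have "AE y in M. norm (f y + g y) \<le> C + D"
    by eventually_elim (auto intro: norm_triangle_mono)
  then show ?thesis
    using f g by (auto simp: essentially_bounded_def)
qed

lemma essentially_bounded_minus: "essentially_bounded f \<Longrightarrow> essentially_bounded (\<lambda>y. - f y)"
  by (auto simp: essentially_bounded_def)

lemma essentially_bounded_diff: "essentially_bounded f \<Longrightarrow> essentially_bounded g \<Longrightarrow> essentially_bounded (\<lambda>y.
    f y - g y)"
  using essentially_bounded_add[of f "\<lambda>y. - g y"] essentially_bounded_minus[of g] by simp

lemma essentially_bounded_L2:
  assumes "essentially_bounded f"
  shows "f \<in> L2 M"
proof (rule L2I)
  show m: "f \<in> borel_measurable M"
    using assms by (simp add: essentially_bounded_def)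
  obtain C where C: "AE y in M. norm (f y) \<le> C"
    using assms by (auto simp: essentially_bounded_def)
  show "integrable M (\<lambda>y. (norm (f y))\<^sup>2)"
  proof (rule M.integrable_const_bound)
    show "AE y in M. norm ((norm (f y))\<^sup>2) \<le> C\<^sup>2"
      using C by eventually_elim (auto intro: power_mono)
  qed (use m in measurable)
qed

lemma essentially_bounded_integrable:
  assumes "essentially_bounded f"
  shows "integrable M f"
  using M.L2_integrable(1)[OF essentially_bounded_L2[OF assms]] .

lemma AE_phase:
  assumes "AE r in restrict_space lborel R. Q r"
  shows "AE x in phase R. Q (fst x)"
  unfolding phase_def by (intro AE_fst_pair_measure assms sphere_measure.sigma_finite_measure_axioms)

text \<open>The coefficients live on \<open>(r, \<epsilon>)\<close>, the points of \<open>M\<close>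
  are \<open>(\<epsilon>, r, s)\<close>. A Borel null set containing the failures of
  \<open>Q\<close> is sliced, the order of the variables is exchanged, and the slices are extended
  by \<open>s\<close> and reassembled; the superset supplies the measurability that is not assumed
  of \<open>Q\<close>.\<close>

lemma AE_coefficient:
  assumes "AE x in restrict_space lborel (R \<times> {a<..<b}). Q x"
  shows "AE y in M. Q (fst (snd y), fst y)"
proof -
  have U: "R \<times> {a<..<b} \<in> sets borel"
    using open_R by (intro borel_open open_Times) auto
  have Rs: "R \<in> sets borel"
    using open_R by simp
  have "AE x in lborel. x \<in> R \<times> {a<..<b} \<longrightarrow> Q x"
    using assms U by (simp add: AE_restrict_space_iff)
  then obtain N where N: "{x \<in> space lborel. \<not> (x \<in> R \<times> {a<..<b} \<longrightarrow> Q x)} \<subseteq> N" "emeasure lborel N = 0" "N \<in>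
      sets lborel"
    by (rule AE_E)
  have Nb: "N \<in> sets borel"
    using N(3) by simp
  have "AE x in lborel. x \<notin> N"
    using N(2,3) by (intro AE_not_in) (simp add: null_sets_def)
  then have "AE x in lborel \<Otimes>\<^sub>M lborel. x \<notin> N"
    unfolding lborel_prod .
  then have "AE r in lborel. AE e in lborel. (r, e) \<notin> N"
    by (rule lborel_pair.AE_pair)
  then have "AE e in lborel. AE r in lborel. (r, e) \<notin> N"
  proof (subst (asm) lborel_pair.AE_commute)
    have "(\<lambda>y :: (real^3) \<times> real. (fst y, snd y) \<notin> N) \<in> borel \<rightarrow>\<^sub>M count_space UNIV"
      using Nb by simp
    then show "{y \<in> space (lborel \<Otimes>\<^sub>M lborel). (fst y, snd y) \<notin> N} \<in> sets (lborel \<Otimes>\<^sub>M lborel)"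
      unfolding lborel_prod using Nb by (simp add: pred_def)
  qed
  then have "AE e in A. AE r in restrict_space lborel R. (r, e) \<notin> N"
    using Rs by (subst AE_restrict_space_iff, simp) (auto simp: AE_restrict_space_iff elim!: eventually_mono)
  then have "AE e in A. AE x in phase R. (fst x, e) \<notin> N"
    by eventually_elim (rule AE_phase)
  moreover have "{y \<in> space M. (fst (snd y), fst y) \<notin> N} \<in> sets M"
  proof -
    have "(\<lambda>y. (fst (snd y), fst y)) \<in> M \<rightarrow>\<^sub>M (borel \<Otimes>\<^sub>M borel)"
      by (intro measurable_Pair measurable_coordinates)
    then have "(\<lambda>y. (fst (snd y), fst y)) -` (- N) \<inter> space M \<in> sets M"
      using Nb by (intro measurable_sets[where A = borel]) (auto simp: borel_prod)
    also have "(\<lambda>y. (fst (snd y), fst y)) -` (- N) \<inter> space M = {y \<in> space M. (fst (snd y), fst y) \<notin> N}"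
      by auto
    finally show ?thesis .
  qed
  ultimately have "AE y in M. (fst (snd y), fst y) \<notin> N"
    by (intro AP.AE_pair_measure) auto
  then show ?thesis
    using AE_space
  proof eventually_elim
    case (elim y)
    then have "(fst (snd y), fst y) \<in> R \<times> {a<..<b}"
      by (auto simp: space_M)
    then have "\<not> Q (fst (snd y), fst y) \<Longrightarrow> (fst (snd y), fst y) \<in> N"
      by (intro subsetD[OF N(1)]) simp
    with elim(1) show ?case
      by blast
  qed
qed

lemma essentially_bounded_coefficient:
  assumes "f \<in> Linf (R \<times> {a<..<b})"
  shows "essentially_bounded (\<lambda>(e, r, s). f (r, e))"
proof -
  obtain C where C: "AE x in restrict_space lborel (R \<times> {a<..<b}). \<bar>f x\<bar> \<le> C"
    and m: "f \<in> borel_measurable (restrict_space lborel (R \<times> {a<..<b}))"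
    using assms by (auto simp: Linf_def)
  have "(\<lambda>y. (fst (snd y), fst y)) \<in> M \<rightarrow>\<^sub>M (borel \<Otimes>\<^sub>M borel)"
    by (intro measurable_Pair measurable_coordinates)
  then have "(\<lambda>y. (fst (snd y), fst y)) \<in> M \<rightarrow>\<^sub>M lborel"
    by (simp add: borel_prod)
  then have "(\<lambda>y. (fst (snd y), fst y)) \<in> M \<rightarrow>\<^sub>M restrict_space lborel (R \<times> {a<..<b})"
    by (rule measurable_restrict_space2[rotated]) (auto simp: space_M)
  from measurable_compose[OF this m] have "(\<lambda>(e, r, s). f (r, e)) \<in> borel_measurable M"
    by (simp add: case_prod_beta')
  moreover have "AE y in M. norm ((\<lambda>(e, r, s). f (r, e)) y) \<le> C"
    using AE_coefficient[OF C] by (simp add: case_prod_beta')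
  ultimately show ?thesis
    by (auto simp: essentially_bounded_def)
qed

lemma integral_phase_iterated:
  fixes f :: "_ \<Rightarrow> real"
  assumes "integrable (phase R) f"
  shows "(LINT x|phase R. f x) = (LINT r|restrict_space lborel R. LINT s|sphere_measure. f (r, s))"
    and "(LINT x|phase R. f x) = (LINT s|sphere_measure. LINT r|restrict_space lborel R. f (r, s))"
  using RS.integral_fst'[of f] RS.integral_snd[of "\<lambda>r s. f (r, s)"] assms by (simp_all add: phase_def)

lemma integral_M_iterated:
  fixes f :: "_ \<Rightarrow> real"
  assumes "integrable M f"
  shows "(LINT y|M. f y) = (LINT e|A. LINT x|phase R. f (e, x))"
    and "(LINT y|M. f y) = (LINT x|phase R. LINT e|A. f (e, x))"
    and "AE e in A. integrable (phase R) (\<lambda>x. f (e, x))"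
    and "AE x in phase R. integrable A (\<lambda>e. f (e, x))"
    and "integrable A (\<lambda>e. LINT x|phase R. f (e, x))"
    and "integrable (phase R) (\<lambda>x. LINT e|A. f (e, x))"
  using AP.integral_fst'[of f] AP.integral_snd[of "\<lambda>e x. f (e, x)"] AP.AE_integrable_fst'[of f]
    AP.AE_integrable_snd[of "\<lambda>e x. f (e, x)"] AP.integrable_fst'[of f] AP.integrable_snd[of "\<lambda>e x. f (e,
        x)"] assms
  by simp_all

text \<open>Fubini with the sphere innermost, since the rotation and divergence terms vanish for
  each fixed energy and position.\<close>

lemma integral_M_eq_0:
  fixes f :: "_ \<Rightarrow> real"
  assumes f: "integrable M f" and 0: "\<And>e r. e \<in> {a<..<b} \<Longrightarrow> r \<in> R \<Longrightarrow> (LINT s|sphere_measure. f (e, r, s)) = 0"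
  shows "(LINT y|M. f y) = 0"
proof -
  have "AE e in A. (LINT x|phase R. f (e, x)) = 0"
    using integral_M_iterated(3)[OF f] AE_space
  proof eventually_elim
    case (elim e)
    have "(LINT x|phase R. f (e, x)) = (LINT r|restrict_space lborel R. LINT s|sphere_measure. f (e, r, s))"
      by (rule integral_phase_iterated(1)[OF elim(1)])
    also have "\<dots> = (LINT r|restrict_space lborel R. 0)"
      using 0 elim(2) by (intro Bochner_Integration.integral_cong) (auto simp: space_A space_restrict_space)
    finally show ?case
      by simp
  qed
  then show ?thesis
    unfolding integral_M_iterated(1)[OF f] by (rule integral_eq_zero_AE)
qed

text \<open>Fubini with position innermost, since the sign of the transport term is known for each
  fixed energy and direction.\<close>

lemma integral_M_le_0:
  fixes f :: "_ \<Rightarrow> real"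
  assumes f: "integrable M f" and le: "\<And>e s. e \<in> {a<..<b} \<Longrightarrow> s \<in> sphere 0 1 \<Longrightarrow> (LINT r|restrict_space lborel
      R. f (e, r, s)) \<le> 0"
  shows "(LINT y|M. f y) \<le> 0"
proof -
  have "AE e in A. 0 \<le> - (LINT x|phase R. f (e, x))"
    using integral_M_iterated(3)[OF f] AE_space
  proof eventually_elim
    case (elim e)
    have "(LINT x|phase R. f (e, x)) = (LINT s|sphere_measure. LINT r|restrict_space lborel R. f (e, r, s))"
      by (rule integral_phase_iterated(2)[OF elim(1)])
    moreover have "0 \<le> (LINT s|sphere_measure. - (LINT r|restrict_space lborel R. f (e, r, s)))"
      using le elim(2) by (intro integral_nonneg_AE AE_I2) (auto simp: space_A)
    ultimately show ?case
      by simp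
  qed
  then have "0 \<le> (LINT e|A. - (LINT x|phase R. f (e, x)))"
    by (rule integral_nonneg_AE)
  then show ?thesis
    unfolding integral_M_iterated(1)[OF f] by simp
qed

end

subsection \<open>Energy estimate\<close>

text \<open>The Gronwall step works with \<open>Sup (exp (- \<lambda> t) y t)\<close>, where \<open>\<lambda> = 2 L / c\<close> makes the integral
  term absorbable.\<close>

lemma gronwall_half:
  fixes y :: "real \<Rightarrow> real"
  assumes ab: "a < b" and pos: "0 < c" "0 < L" "0 \<le> Q"
    and y: "\<And>t. t \<in> {a<..<b} \<Longrightarrow> 0 \<le> y t" "\<And>t. t \<in> {a<..<b} \<Longrightarrow> y t \<le> B"
    and ym: "y \<in> borel_measurable (restrict_space lborel {a<..<b})"
    and H: "\<And>t. t \<in> {a<..<b} \<Longrightarrow> c / 2 * y t \<le> L / 2 * (LINT e|restrict_space lborel {a<..<b}. indicator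
        {..<t} e * y e) + Q"
    and t: "t \<in> {a<..<b}"
  shows "y t \<le> exp (2 * L / c * (b - a)) * (4 / c) * Q"
proof -
  define l where "l = 2 * L / c"
  have l: "l > 0"
    using pos by (simp add: l_def)
  define D where "D = (\<lambda>t. exp (- l * t) * y t) ` {a<..<b}"
  have ne: "D \<noteq> {}"
    using t by (auto simp: D_def)
  have bdd: "bdd_above D"
  proof (rule bdd_aboveI)
    fix z assume "z \<in> D"
    then obtain u where u: "u \<in> {a<..<b}" "z = exp (- l * u) * y u"
      by (auto simp: D_def)
    have "exp (- l * u) * y u \<le> exp (- l * a) * B"
      using u y l by (intro mult_mono) auto
    then show "z \<le> exp (- l * a) * B"
      using u by simp
  qed
  define m where "m = Sup D"
  have m: "exp (- l * u) * y u \<le> m" if "u \<in> {a<..<b}" for u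
    unfolding m_def using that by (intro cSup_upper bdd) (auto simp: D_def)
  have m0: "0 \<le> m"
    using m[OF t] y(1)[OF t] by (meson exp_ge_zero mult_nonneg_nonneg order_trans)
  have ee: "exp (l * u) * exp (- l * u) = 1" for u
    by (simp flip: exp_add)
  have ym': "y u \<le> m * exp (l * u)" if "u \<in> {a<..<b}" for u
  proof -
    have "exp (l * u) * (exp (- l * u) * y u) \<le> exp (l * u) * m"
      using m[OF that] by (intro mult_left_mono) auto
    moreover have "exp (l * u) * (exp (- l * u) * y u) = y u"
      unfolding mult.assoc[symmetric] ee by simp
    ultimately show ?thesis
      by (simp only: mult.commute)
  qed
  have fin: "finite_measure (restrict_space lborel {a<..<b})"
    by (intro finite_measure_restrict_lborel) auto
  have bound: "exp (- l * u) * y u \<le> m / 2 + 2 / c * exp (- l * a) * Q" if u: "u \<in> {a<..<b}" for u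
  proof -
    have FTC: "has_bochner_integral lborel (\<lambda>e. indicator {a..u} e *\<^sub>R (m * exp (l * e))) (m * exp (l * u)
        / l - m * exp (l * a) / l)"
    proof (rule has_bochner_integral_FTC_Icc)
      show "((\<lambda>e. m * exp (l * e) / l) has_vector_derivative m * exp (l * x)) (at x within {a..u})" for x
        unfolding has_real_derivative_iff_has_vector_derivative[symmetric]
        using l by (auto intro!: derivative_eq_intros)
    qed (use u in \<open>auto intro!: continuous_intros\<close>)
    have "(LINT e|restrict_space lborel {a<..<b}. indicator {..<u} e * y e) =
        (LINT e|lborel. indicator {a<..<b} e * (indicator {..<u} e * y e))"
      by (simp add: integral_restrict_space)
    also have "\<dots> \<le> (LINT e|lborel. indicator {a..u} e *\<^sub>R (m * exp (l * e)))"
    proof (rule integral_mono)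
      show "integrable lborel (\<lambda>e. indicator {a..u} e *\<^sub>R (m * exp (l * e)))"
        using FTC by (simp add: has_bochner_integral_iff)
      show "integrable lborel (\<lambda>e. indicator {a<..<b} e * (indicator {..<u} e * y e))"
      proof -
        have "integrable (restrict_space lborel {a<..<b}) (\<lambda>e. indicator {..<u} e * y e)"
        proof (rule finite_measure.integrable_const_bound[OF fin])
          show "AE e in restrict_space lborel {a<..<b}. norm (indicator {..<u} e * y e) \<le> \<bar>B\<bar>"
            using y by (intro AE_I2) (force simp: space_restrict_space indicator_def)
          show "(\<lambda>e. indicator {..<u} e * y e) \<in> borel_measurable (restrict_space lborel {a<..<b})"
            by (intro borel_measurable_times[OF _ ym] measurable_restrict_space1) simp
        qed
        then show ?thesis
          by (simp add: integrable_restrict_space)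
      qed
      show "indicator {a<..<b} e * (indicator {..<u} e * y e) \<le> indicator {a..u} e *\<^sub>R (m * exp (l * e))"
          for e
        using ym'[of e] m0 u by (auto simp: indicator_def)
    qed
    also have "\<dots> \<le> m * exp (l * u) / l"
      using has_bochner_integral_integral_eq[OF FTC] m0 l by simp
    finally have "c / 2 * y u \<le> L / 2 * (m * exp (l * u) / l) + Q"
      using H[OF u] mult_left_mono[of _ "m * exp (l * u) / l" "L / 2"] pos by fastforce
    \<comment> \<open>With \<open>l = 2 * L / c\<close> the integral term is half of what can be
      absorbed: after division by \<open>c / 2\<close> it leaves \<open>m / 2\<close> against
      \<open>m\<close>.\<close>
    also have "L / 2 * (m * exp (l * u) / l) = c / 4 * m * exp (l * u)"
      using pos by (simp add: l_def field_simps)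
    finally have "y u \<le> m / 2 * exp (l * u) + 2 / c * Q"
      using pos by (simp add: field_simps)
    then have "exp (- l * u) * y u \<le> exp (- l * u) * (m / 2 * exp (l * u) + 2 / c * Q)"
      by (intro mult_left_mono) auto
    also have "\<dots> = m / 2 * (exp (l * u) * exp (- l * u)) + exp (- l * u) * (2 / c * Q)"
      by (simp only: distrib_left mult_ac)
    also have "\<dots> = m / 2 + exp (- l * u) * (2 / c * Q)"
      unfolding ee by simp
    also have "exp (- l * u) * (2 / c * Q) \<le> exp (- l * a) * (2 / c * Q)"
      using u l pos by (intro mult_right_mono) auto
    finally show ?thesis
      by (simp add: mult_ac)
  qed
  have "m \<le> m / 2 + 2 / c * exp (- l * a) * Q"
    unfolding m_def using bound by (intro cSup_least ne) (auto simp: D_def m_def)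
  then have mQ: "m \<le> 4 / c * exp (- l * a) * Q"
    by simp
  have "y t \<le> m * exp (l * t)"
    by (rule ym'[OF t])
  also have "\<dots> \<le> (4 / c * exp (- l * a) * Q) * exp (l * b)"
    using mQ m0 t l pos by (intro mult_mono) auto
  also have "\<dots> = (exp (- l * a) * exp (l * b)) * (4 / c) * Q"
    by (simp only: mult_ac)
  also have "exp (- l * a) * exp (l * b) = exp (l * (b - a))"
    by (simp add: right_diff_distrib flip: exp_add)
  finally show ?thesis
    by (simp add: l_def)
qed

text \<open>The right-hand side contains the unknowns: the hypothesis admits any bound for
  \<open>sqrt y\<close>, and \<open>X^2\<close> is approached by values of \<open>x\<close>. With
  \<open>Z = sqrt Y + X\<close>, both \<open>Y\<close> and \<open>X^2\<close> are at most a constant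
  times \<open>N * Z\<close>, so \<open>Z^2 \<le> 2 * (K1 + K2) * N * Z\<close>, and one factor
  cancels. The bound \<open>B\<close> makes the supremum \<open>Y\<close> finite but does not enter
  the result.\<close>

lemma gronwall_absorption:
  fixes y x :: "real \<Rightarrow> real"
  assumes ab: "a < b" and pos: "0 < c" "0 < d" "0 < L" "0 \<le> N" "0 \<le> X"
    and y: "\<And>t. t \<in> {a<..<b} \<Longrightarrow> 0 \<le> y t" "\<And>t. t \<in> {a<..<b} \<Longrightarrow> y t \<le> B"
    and ym: "y \<in> borel_measurable (restrict_space lborel {a<..<b})"
    and x: "\<And>t. t \<in> {a<..<b} \<Longrightarrow> 0 \<le> x t" "\<And>\<delta>. 0 < \<delta> \<Longrightarrow> \<exists>t\<in>{a<..<b}. X\<^sup>2 - \<delta> \<le> x t"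
    and H: "\<And>t Z. t \<in> {a<..<b} \<Longrightarrow> 0 \<le> Z \<Longrightarrow> (\<And>e. e \<in> {a<..<b} \<Longrightarrow> sqrt (y e) \<le> Z) \<Longrightarrow>
      c / 2 * y t + d * x t \<le> L / 2 * (LINT e|restrict_space lborel {a<..<b}. indicator {..<t} e * y e) +
          N * (Z + X)"
    and t: "t \<in> {a<..<b}"
  defines "K1 \<equiv> exp (2 * L / c * (b - a)) * (4 / c)"
  shows "sqrt (y t) \<le> 2 * (K1 + (L / 2 * (b - a) * K1 + 1) / d) * N"
proof -
  \<comment> \<open>Inserting \<open>y \<le> K1 * Q\<close> into the integral gives
    \<open>d * x \<le> (L / 2 * (b - a) * K1 + 1) * Q\<close>.\<close>
  define K2 where "K2 = (L / 2 * (b - a) * K1 + 1) / d"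
  have K: "0 < K1" "0 < K2"
    unfolding K1_def K2_def using pos ab by (auto intro!: divide_pos_pos add_nonneg_pos mult_nonneg_nonneg)
  define Y where "Y = Sup (y ` {a<..<b})"
  have bdd: "bdd_above (y ` {a<..<b})"
    using y by (auto intro!: bdd_aboveI[of _ B])
  have yY: "y u \<le> Y" if "u \<in> {a<..<b}" for u
    unfolding Y_def using that bdd by (intro cSup_upper) auto
  have Y0: "0 \<le> Y"
    using yY[OF t] y(1)[OF t] by linarith
  define Z where "Z = sqrt Y + X"
  have Z0: "0 \<le> Z"
    using Y0 pos by (simp add: Z_def)
  define Q where "Q = N * Z"
  have Q0: "0 \<le> Q"
    using pos Z0 by (simp add: Q_def)
  have H': "c / 2 * y u + d * x u \<le> L / 2 * (LINT e|restrict_space lborel {a<..<b}. indicator {..<u} e * y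
      e) + Q"
    if u: "u \<in> {a<..<b}" for u
    using H[OF u, of "sqrt Y"] yY Y0 by (simp add: Q_def Z_def)
  have yQ: "y u \<le> K1 * Q" if u: "u \<in> {a<..<b}" for u
  proof -
    have "c / 2 * y v \<le> L / 2 * (LINT e|restrict_space lborel {a<..<b}. indicator {..<v} e * y e) + Q"
      if v: "v \<in> {a<..<b}" for v
      using H'[OF v] mult_nonneg_nonneg[of d "x v"] x(1)[OF v] pos by linarith
    from gronwall_half[OF ab pos(1,3) Q0 y ym this u] show ?thesis
      by (simp add: K1_def)
  qed
  have YQ: "Y \<le> K1 * Q"
    unfolding Y_def using t yQ by (intro cSup_least) auto
  have xQ: "x u \<le> K2 * Q" if u: "u \<in> {a<..<b}" for u
  proof -
    have "(LINT e|restrict_space lborel {a<..<b}. indicator {..<u} e * y e) \<le> (LINT e|restrict_space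
        lborel {a<..<b}. K1 * Q)"
    proof (rule integral_mono')
      show "integrable (restrict_space lborel {a<..<b}) (\<lambda>e. K1 * Q)"
        by (intro finite_measure.integrable_const finite_measure_restrict_lborel) auto
      show "indicator {..<u} e * y e \<le> K1 * Q" if "e \<in> space (restrict_space lborel {a<..<b})" for e
        using yQ[of e] that K Q0 by (auto simp: indicator_def space_restrict_space)
    qed (use K Q0 in simp)
    also have "\<dots> = (b - a) * (K1 * Q)"
      using ab by (simp add: measure_restrict_space space_restrict_space)
    finally have "L / 2 * (LINT e|restrict_space lborel {a<..<b}. indicator {..<u} e * y e) \<le> L / 2 * ((b
        - a) * (K1 * Q))"
      using pos by (intro mult_left_mono) auto
    moreover have "0 \<le> c / 2 * y u"
      using y(1)[OF u] pos by simp
    ultimately have "d * x u \<le> L / 2 * ((b - a) * (K1 * Q)) + Q"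
      using H'[OF u] by linarith
    also have "\<dots> = (d * K2) * Q"
    proof -
      have "d * K2 = L / 2 * (b - a) * K1 + 1"
        using pos by (simp add: K2_def)
      then show ?thesis
        by (simp only: distrib_right mult.assoc mult_1)
    qed
    also have "\<dots> = d * (K2 * Q)"
      by (simp only: mult.assoc)
    finally show ?thesis
      using pos by simp
  qed
  have "X\<^sup>2 \<le> K2 * Q"
  proof (rule field_le_epsilon)
    fix \<delta> :: real assume "0 < \<delta>"
    then obtain u where "u \<in> {a<..<b}" "X\<^sup>2 - \<delta> \<le> x u"
      using x(2) by blast
    then show "X\<^sup>2 \<le> K2 * Q + \<delta>"
      using xQ[of u] by linarith
  qed
  moreover have "Z\<^sup>2 \<le> 2 * (Y + X\<^sup>2)"
    using sum_squares_bound[of "sqrt Y" X] Y0 by (simp add: Z_def power2_sum)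
  ultimately have "Z * Z \<le> 2 * (K1 + K2) * N * Z"
    using YQ by (simp add: Q_def power2_eq_square algebra_simps)
  then have "Z \<le> 2 * (K1 + K2) * N"
    using Z0 K pos by (cases "Z = 0") auto
  moreover have "sqrt (y t) \<le> Z"
    using yY[OF t] pos by (simp add: Z_def add_increasing2)
  ultimately show ?thesis
    by (simp add: K2_def)
qed

section \<open>Terms of the energy identity\<close>

context phase_domain
begin

text \<open>Test functions take \<open>(r, s, \<epsilon>)\<close>, whereas points of \<open>M\<close> are \<open>(\<epsilon>, r, s)\<close>.\<close>

definition on_M :: "((real^3) \<times> (real^3) \<times> real \<Rightarrow> 'c) \<Rightarrow> real \<times> (real^3) \<times> (real^3) \<Rightarrow> 'c" where
  "on_M k y = k (fst (snd y), snd (snd y), fst y)"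

definition coeff :: "((real^3) \<times> real \<Rightarrow> 'c) \<Rightarrow> real \<times> (real^3) \<times> (real^3) \<Rightarrow> 'c" where
  "coeff f y = f (fst (snd y), fst y)"

lemma on_M_apply [simp]: "on_M k (e, r, s) = k (r, s, e)" "on_M k (e, x) = k (fst x, snd x, e)"
  by (simp_all add: on_M_def)

lemma coeff_apply [simp]: "coeff f (e, r, s) = f (r, e)"
  by (simp add: coeff_def)

lemma essentially_bounded_on_M: "continuous_on K k \<Longrightarrow> essentially_bounded (on_M k)"
  using essentially_bounded_on_K[of k] by (simp add: on_M_def[abs_def] case_prod_beta')

lemma essentially_bounded_coeff: "f \<in> Linf (R \<times> {a<..<b}) \<Longrightarrow> essentially_bounded (coeff f)"
  using essentially_bounded_coefficient[of f] by (simp add: coeff_def[abs_def] case_prod_beta')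

lemma essentially_bounded_const: "essentially_bounded (\<lambda>_. c)"
  by (auto simp: essentially_bounded_def)

lemma essentially_bounded_vec:
  fixes f :: "_ \<Rightarrow> real^3"
  assumes "\<And>i. essentially_bounded (\<lambda>y. f y $ i)"
  shows "essentially_bounded f"
proof -
  have eq: "f = (\<lambda>y. f y $ 1 *\<^sub>R axis 1 1 + f y $ 2 *\<^sub>R axis 2 1 + f y $ 3 *\<^sub>R axis 3 1)"
    by (auto simp: fun_eq_iff vec_eq_iff forall_3 axis_def)
  show ?thesis
    by (subst eq) (intro essentially_bounded_add essentially_bounded_scaleR essentially_bounded_const assms)
qed

lemma essentially_bounded_indicator: "essentially_bounded (\<lambda>y. indicator {..<t} (fst y) :: real)"
proof -
  have "(\<lambda>y. indicator {..<t} (fst y) :: real) \<in> borel_measurable M"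
    by (rule measurable_compose[OF measurable_coordinates(1)]) simp
  then show ?thesis
    by (auto simp: essentially_bounded_def intro!: exI[of _ 1])
qed

lemma phase_slice:
  fixes k :: "_ \<Rightarrow> 'c::euclidean_space"
  assumes k: "continuous_on K k" and t: "t \<in> {a<..<b}"
  shows "(\<lambda>(r, s). k (r, s, t)) \<in> L2 (phase R)"
proof (rule L2I)
  have "(\<lambda>x. (t, x)) \<in> phase R \<rightarrow>\<^sub>M M"
    using t by (intro measurable_Pair1') (simp add: space_A)
  from measurable_compose[OF this measurable_on_K[OF k]]
  show m: "(\<lambda>(r, s). k (r, s, t)) \<in> borel_measurable (phase R)"
    by (simp add: case_prod_beta')
  obtain B where B: "\<forall>p\<in>K. norm (k p) \<le> B"
    using bounded_on_K[OF k] by blast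
  show "integrable (phase R) (\<lambda>x. (norm (case x of (r, s) \<Rightarrow> k (r, s, t)))\<^sup>2)"
  proof (rule P.integrable_const_bound)
    show "AE x in phase R. norm ((norm (case x of (r, s) \<Rightarrow> k (r, s, t)))\<^sup>2) \<le> B\<^sup>2"
      using B t perm_K by (intro AE_I2) (auto simp: space_phase space_M intro!: power_mono)
  qed (use m in measurable)
qed

text \<open>The partial derivatives are explicit arguments, which makes linear combinations and
  continuity up to the boundary direct. The derivative in the direction variable is that of the
  radially constant extension, so \<open>vs\<close> is the surface gradient.\<close>

definition C1_data where
  "C1_data v vt vr vs \<longleftrightarrow>
    continuous_on K v \<and> continuous_on K vt \<and> continuous_on K vr \<and> continuous_on K vs \<and>
    (\<forall>r\<in>closure R. \<forall>s\<in>sphere 0 1. \<forall>e\<in>{a..b}.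
      ((\<lambda>e. v (r, s, e)) has_real_derivative vt (r, s, e)) (at e within {a..b}) \<and>
      ((\<lambda>x. v (x, s, e)) has_derivative (\<lambda>k. vr (r, s, e) \<bullet> k)) (at r within closure R) \<and>
      ((\<lambda>x. v (r, x /\<^sub>R norm x, e)) has_derivative (\<lambda>k. vs (r, s, e) \<bullet> k)) (at s))"

text \<open>Points where a line in direction \<open>s\<close> leaves \<open>R\<close> stand in for \<open>Gamma_out R\<close>: they lie in it, and
  no other boundary points enter the transport estimate.\<close>

definition admissible_data where
  "admissible_data v vt vr vs \<longleftrightarrow> C1_data v vt vr vs \<and>
    (\<forall>r\<in>closure R. \<forall>s\<in>sphere 0 1. v (r, s, a) = 0) \<and>
    (\<forall>r\<in>frontier R. \<forall>s\<in>sphere 0 1. \<forall>t>0. r - t *\<^sub>R s \<in> R \<longrightarrow> (\<forall>e\<in>{a<..<b}. v (r, s, e) = 0))"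

text \<open>\<open>D p\<close> is the derivative of the radially constant extension in the direction
  variable alone; its trace is the surface divergence.\<close>

definition field_data where
  "field_data \<Phi> D \<longleftrightarrow> continuous_on K \<Phi> \<and> (\<forall>i. continuous_on K (\<lambda>p. D p (axis i 1))) \<and>
    (\<forall>r\<in>closure R. \<forall>s\<in>sphere 0 1. \<forall>e\<in>{a..b}.
      ((\<lambda>x. \<Phi> (r, x /\<^sub>R norm x, e)) has_derivative D (r, s, e)) (at s) \<and> \<Phi> (r, s, e) \<bullet> s = 0)"

lemma continuous_on_K_section:
  assumes "continuous_on K k"
  shows "r \<in> closure R \<Longrightarrow> e \<in> {a..b} \<Longrightarrow> continuous_on (sphere 0 1) (\<lambda>s. k (r, s, e))"
    and "s \<in> sphere 0 1 \<Longrightarrow> e \<in> {a..b} \<Longrightarrow> continuous_on (closure R) (\<lambda>r. k (r, s, e))"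
    and "r \<in> closure R \<Longrightarrow> s \<in> sphere 0 1 \<Longrightarrow> continuous_on {a..b} (\<lambda>e. k (r, s, e))"
  by (rule continuous_on_compose2[OF assms]; force simp: K_def intro!: continuous_intros)+

definition div_data :: "((real^3) \<times> (real^3) \<times> real \<Rightarrow> (real^3) \<Rightarrow> (real^3)) \<Rightarrow> (real^3) \<times> (real^3) \<times> real \<Rightarrow>
    real" where
  "div_data D p = (\<Sum>i\<in>UNIV. D p (axis i 1) $ i)"

lemma surf_div_field_data:
  assumes "field_data \<Phi> D" "r \<in> closure R" "s \<in> sphere 0 1" "e \<in> {a..b}"
  shows "surf_div (\<lambda>s'. \<Phi> (r, s', e)) s = div_data D (r, s, e)"
proof -
  have "((\<lambda>x. \<Phi> (r, x /\<^sub>R norm x, e)) has_derivative D (r, s, e)) (at s)"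
    using assms by (auto simp: field_data_def)
  from frechet_derivative_at[OF this] show ?thesis
    unfolding surf_div_def sum_Basis_axis div_data_def by (simp add: inner_axis)
qed

lemma continuous_div_data: "field_data \<Phi> D \<Longrightarrow> continuous_on K (div_data D)"
  unfolding div_data_def[abs_def] field_data_def by (intro continuous_intros continuous_on_component) auto

text \<open>The product of \<open>v\<close> with its derivative along \<open>s\<close> is half the
  derivative of \<open>v^2\<close> along \<open>s\<close>. The square is nonnegative and vanishes at
  exit points, so the sign holds for each fixed energy and direction; the energy cut-off is constant
  there.\<close>

lemma energy_transport_le_0:
  assumes v: "admissible_data v vt vr vs"
  shows "(LINT y|M. indicator {..<t} (fst y) * (on_M v y * on_M (\<lambda>p. fst (snd p) \<bullet> vr p) y)) \<le> 0"
proof (rule integral_M_le_0)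
  have c: "continuous_on K v" "continuous_on K vr"
    using v by (auto simp: admissible_data_def C1_data_def)
  have "continuous_on K (\<lambda>p. fst (snd p) \<bullet> vr p)"
    by (intro continuous_intros c)
  then show "integrable M (\<lambda>y. indicator {..<t} (fst y) * (on_M v y * on_M (\<lambda>p. fst (snd p) \<bullet> vr p) y))"
    by (intro essentially_bounded_integrable essentially_bounded_mult essentially_bounded_indicator
        essentially_bounded_on_M c)
  fix e and s :: "real^3" assume e: "e \<in> {a<..<b}" and s: "s \<in> sphere 0 1"
  have e': "e \<in> {a..b}"
    using e by simp
  have "(LINT r|restrict_space lborel R. s \<bullet> (2 * v (r, s, e)) *\<^sub>R vr (r, s, e)) \<le> 0"
  proof (rule integral_directional_derivative_le_0[OF open_R convex_R bounded_R])
    show "((\<lambda>r. (v (r, s, e))\<^sup>2) has_derivative (\<lambda>k. ((2 * v (x, s, e)) *\<^sub>R vr (x, s, e)) \<bullet> k)) (at x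
        within closure R)"
      if "x \<in> closure R" for x
    proof -
      have "((\<lambda>x. v (x, s, e)) has_derivative (\<lambda>k. vr (x, s, e) \<bullet> k)) (at x within closure R)"
        using v that s e' by (auto simp: admissible_data_def C1_data_def)
      from has_derivative_power[OF this, of 2] show ?thesis
        by (simp add: algebra_simps)
    qed
    show "continuous_on (closure R) (\<lambda>x. (2 * v (x, s, e)) *\<^sub>R vr (x, s, e))"
      by (intro continuous_intros continuous_on_K_section c s e')
    show "(v (r, s, e))\<^sup>2 = 0" if "r \<in> frontier R" "0 < t" "r - t *\<^sub>R s \<in> R" for r t
      using v that s e by (auto simp: admissible_data_def)
  qed auto
  then have "(LINT r|restrict_space lborel R. v (r, s, e) * (s \<bullet> vr (r, s, e))) \<le> 0"
    by (simp add: mult.assoc)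
  then show "(LINT r|restrict_space lborel R. indicator {..<t} (fst (e, r, s)) *
      (on_M v (e, r, s) * on_M (\<lambda>p. fst (snd p) \<bullet> vr p) (e, r, s))) \<le> 0"
    by (simp add: indicator_def)
qed

lemma energy_cross_eq_0:
  assumes v: "C1_data v vt vr vs" and G: "essentially_bounded (coeff G)"
  shows "(LINT y|M. indicator {..<t} (fst y) * (on_M v y * (coeff G y \<bullet> on_M (\<lambda>p. cross3 (fst (snd p)) (vs
      p)) y))) = 0"
proof (rule integral_M_eq_0)
  have c: "continuous_on K v" "continuous_on K vs"
    using v by (auto simp: C1_data_def)
  have "continuous_on K (\<lambda>p. cross3 (fst (snd p)) (vs p))"
    by (intro continuous_intros continuous_on_cross c)
  then show "integrable M (\<lambda>y. indicator {..<t} (fst y) * (on_M v y * (coeff G y \<bullet> on_M (\<lambda>p. cross3 (fst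
      (snd p)) (vs p)) y)))"
    by (intro essentially_bounded_integrable essentially_bounded_mult essentially_bounded_inner
        essentially_bounded_indicator essentially_bounded_on_M c G)
  fix e r assume e: "e \<in> {a<..<b}" and r: "r \<in> R"
  have r': "r \<in> closure R" and e': "e \<in> {a..b}"
    using closure_subset r e by auto
  have "(LINT s|sphere_measure. v (r, s, e) * (G (r, e) \<bullet> cross3 s (vs (r, s, e)))) = 0"
    using v r' e' by (intro sphere_integral_cross_gradient_eq_0 continuous_on_K_section c) (auto simp:
        C1_data_def)
  then show "(LINT s|sphere_measure. indicator {..<t} (fst (e, r, s)) *
      (on_M v (e, r, s) * (coeff G (e, r, s) \<bullet> on_M (\<lambda>p. cross3 (fst (snd p)) (vs p)) (e, r, s)))) = 0"
    by (simp add: indicator_def)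
qed

lemma energy_divergence_eq_0:
  assumes v: "C1_data v vt vr vs" and \<Phi>: "field_data \<Phi> D"
  shows "(LINT y|M. indicator {..<t} (fst y) * (on_M v y * on_M (div_data D) y + on_M vs y \<bullet> on_M \<Phi> y)) = 0"
proof (rule integral_M_eq_0)
  have c: "continuous_on K v" "continuous_on K vs" "continuous_on K \<Phi>" "continuous_on K (div_data D)"
    using v \<Phi> continuous_div_data by (auto simp: C1_data_def field_data_def)
  show "integrable M (\<lambda>y. indicator {..<t} (fst y) * (on_M v y * on_M (div_data D) y + on_M vs y \<bullet> on_M \<Phi> y))"
    by (intro essentially_bounded_integrable essentially_bounded_mult essentially_bounded_inner
        essentially_bounded_add
        essentially_bounded_indicator essentially_bounded_on_M c)
  fix e r assume e: "e \<in> {a<..<b}" and r: "r \<in> R"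
  have r': "r \<in> closure R" and e': "e \<in> {a..b}"
    using closure_subset r e by auto
  have "(LINT s|sphere_measure. v (r, s, e) * surf_div (\<lambda>s. \<Phi> (r, s, e)) s + vs (r, s, e) \<bullet> \<Phi> (r, s, e)) = 0"
  proof (rule sphere_integration_by_parts)
    show "continuous_on (sphere 0 1) (\<lambda>s. D (r, s, e) (axis i 1))" for i
      using \<Phi> by (intro continuous_on_K_section(1)[of "\<lambda>p. D p (axis i 1)"] r' e') (auto simp: field_data_def)
  qed (use v \<Phi> r' e' c in \<open>auto simp: C1_data_def field_data_def intro!: continuous_on_K_section\<close>)
  also have "(LINT s|sphere_measure. v (r, s, e) * surf_div (\<lambda>s. \<Phi> (r, s, e)) s + vs (r, s, e) \<bullet> \<Phi> (r, s,
      e)) =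
      (LINT s|sphere_measure. v (r, s, e) * div_data D (r, s, e) + vs (r, s, e) \<bullet> \<Phi> (r, s, e))"
    using surf_div_field_data[OF \<Phi> r' _ e'] by (intro Bochner_Integration.integral_cong) auto
  finally show "(LINT s|sphere_measure. indicator {..<t} (fst (e, r, s)) *
      (on_M v (e, r, s) * on_M (div_data D) (e, r, s) + on_M vs (e, r, s) \<bullet> on_M \<Phi> (e, r, s))) = 0"
    by (simp add: indicator_def)
qed

text \<open>The one-dimensional estimate is applied to \<open>v^2\<close> along the energy line over
  almost every \<open>(r, s)\<close>, and the result is integrated; the factor 2 in the derivative
  of the square explains the halves. \<open>L\<close> does not depend on \<open>v\<close>.\<close>

lemma energy_stopping_power:
  assumes S: "S \<in> W1inf (R \<times> {a<..<b})"
    and cS: "0 < cS" "AE x in restrict_space lborel (R \<times> {a<..<b}). cS \<le> S x"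
  shows "\<exists>L>0. \<forall>v vt vr vs t. C1_data v vt vr vs \<longrightarrow> (\<forall>r\<in>closure R. \<forall>s\<in>sphere 0 1. v (r, s, a) = 0) \<longrightarrow> t \<in>
      {a<..<b} \<longrightarrow>
    cS / 2 * (LINT x|phase R. (v (fst x, snd x, t))\<^sup>2) - L / 2 * (LINT y|M. indicator {..<t} (fst y) *
        (on_M v y)\<^sup>2)
    \<le> (LINT y|M. indicator {..<t} (fst y) * (coeff S y * on_M vt y * on_M v y))"
proof -
  define regular where "regular C L' r \<longleftrightarrow>
    (\<lambda>x. indicator {a<..<b} x * S (r, x)) \<in> borel_measurable borel \<and>
    (AE x in lborel. x \<in> {a<..<b} \<longrightarrow> cS \<le> indicator {a<..<b} x * S (r, x) \<and> \<bar>indicator {a<..<b} x * S (r,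
        x)\<bar> \<le> C) \<and>
    (\<forall>n. AE x in lborel. a < x \<and> x + 1 / real (Suc n) < b \<longrightarrow>
      \<bar>indicator {a<..<b} (x + 1 / real (Suc n)) * S (r, x + 1 / real (Suc n)) - indicator {a<..<b} x * S
          (r, x)\<bar> \<le> L' * (1 / real (Suc n)))"
    for C L' r
  obtain C L' where C: "0 \<le> C" and L': "0 \<le> L'" and sl: "AE r in lborel. r \<in> R \<longrightarrow> regular C L' r"
    using W1inf_slices[OF open_R S cS(2)] unfolding regular_def by blast
  \<comment> \<open>The Gronwall argument divides by a rate proportional to \<open>L\<close>, so
    \<open>L\<close> is made strictly positive.\<close>
  define L where "L = L' + 1"
  have "cS / 2 * (LINT x|phase R. (v (fst x, snd x, t))\<^sup>2) - L / 2 * (LINT y|M. indicator {..<t} (fst y) *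
      (on_M v y)\<^sup>2)
    \<le> (LINT y|M. indicator {..<t} (fst y) * (coeff S y * on_M vt y * on_M v y))"
    if v: "C1_data v vt vr vs" and va: "\<forall>r\<in>closure R. \<forall>s\<in>sphere 0 1. v (r, s, a) = 0" and t: "t \<in>
        {a<..<b}" for v vt vr vs t
  proof -
    have c: "continuous_on K v" "continuous_on K vt"
      using v by (auto simp: C1_data_def)
    have "essentially_bounded (coeff S)"
      using S by (intro essentially_bounded_coeff) (simp add: W1inf_def)
    then have i1: "integrable M (\<lambda>y. indicator {..<t} (fst y) * (coeff S y * on_M vt y * on_M v y))"
      by (intro essentially_bounded_integrable essentially_bounded_mult essentially_bounded_indicator
          essentially_bounded_on_M c)
    have i2: "integrable M (\<lambda>y. indicator {..<t} (fst y) * (on_M v y)\<^sup>2)"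
      unfolding power2_eq_square
      by (intro essentially_bounded_integrable essentially_bounded_mult essentially_bounded_indicator
          essentially_bounded_on_M c)
    have i3: "integrable (phase R) (\<lambda>x. (v (fst x, snd x, t))\<^sup>2)"
      using L2D(2)[OF phase_slice[OF c(1) t]] by (simp add: case_prod_beta')
    have Rs: "R \<in> sets borel"
      using open_R by simp
    have "AE r in restrict_space lborel R. regular C L' r"
      using sl Rs by (simp add: AE_restrict_space_iff)
    from AE_phase[OF this] have "AE x in phase R. cS / 2 * (v (fst x, snd x, t))\<^sup>2 - L' / 2 * (LINT e|A.
        indicator {..<t} e * (v (fst x, snd x, e))\<^sup>2)
      \<le> (LINT e|A. indicator {..<t} e * (S (fst x, e) * vt (fst x, snd x, e) * v (fst x, snd x, e)))"
      using AE_space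
    proof eventually_elim
      case (elim x)
      obtain r s where x: "x = (r, s)" "r \<in> closure R" "s \<in> sphere 0 1"
        using elim(2) closure_subset[of R] by (cases x) (auto simp: space_phase)
      have toA: "(LINT e|A. indicator {..<t} e * f e) = (LINT e|lborel. indicator {a<..<t} e * f e)" for f
          :: "real \<Rightarrow> real"
        unfolding integral_restrict_space[of "{a<..<b}" lborel, simplified]
        by (intro Bochner_Integration.integral_cong) (use t in \<open>auto simp: indicator_def\<close>)
      have "cS * (v (r, s, t))\<^sup>2 - L' * (LINT e|lborel. indicator {a<..<t} e * (v (r, s, e))\<^sup>2)
        \<le> (LINT e|lborel. indicator {a<..<t} e * ((indicator {a<..<b} e * S (r, e)) * (2 * v (r, s, e) *
            vt (r, s, e))))"
      proof (rule weighted_integral_derivative_ge[where b = b])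
        show "((\<lambda>e. (v (r, s, e))\<^sup>2) has_real_derivative 2 * v (r, s, e) * vt (r, s, e)) (at e within
            {a..b})" if "e \<in> {a..b}" for e
        proof -
          have "((\<lambda>e. v (r, s, e)) has_real_derivative vt (r, s, e)) (at e within {a..b})"
            using v x that by (auto simp: C1_data_def)
          from DERIV_power[OF this, of 2] show ?thesis
            by (simp add: mult_ac)
        qed
        show "continuous_on {a..b} (\<lambda>e. 2 * v (r, s, e) * vt (r, s, e))"
          by (intro continuous_intros continuous_on_K_section c x)
        show "(v (r, s, a))\<^sup>2 = 0"
          using va x by simp
      qed (use elim(1) x t cS C L' in \<open>auto simp: regular_def\<close>)
      also have "\<dots> = 2 * (LINT e|lborel. indicator {a<..<t} e * (S (r, e) * vt (r, s, e) * v (r, s, e)))"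
        unfolding Bochner_Integration.integral_mult_right_zero[symmetric]
        by (intro Bochner_Integration.integral_cong) (use t in \<open>auto simp: indicator_def\<close>)
      finally show ?case
        unfolding toA x by simp
    qed
    then have "(LINT x|phase R. cS / 2 * (v (fst x, snd x, t))\<^sup>2 - L' / 2 * (LINT e|A. indicator {..<t} e
        * (v (fst x, snd x, e))\<^sup>2))
      \<le> (LINT x|phase R. (LINT e|A. indicator {..<t} e * (S (fst x, e) * vt (fst x, snd x, e) * v (fst x,
          snd x, e))))"
      using integral_M_iterated(6)[OF i1] integral_M_iterated(6)[OF i2] i3
      by (intro integral_mono_AE Bochner_Integration.integrable_diff integrable_mult_right) (simp_all add:
          coeff_def)
    then have "cS / 2 * (LINT x|phase R. (v (fst x, snd x, t))\<^sup>2) - L' / 2 * (LINT y|M. indicator {..<t}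
        (fst y) * (on_M v y)\<^sup>2)
      \<le> (LINT y|M. indicator {..<t} (fst y) * (coeff S y * on_M vt y * on_M v y))"
      using integral_M_iterated(6)[OF i2] i3 unfolding integral_M_iterated(2)[OF i1]
          integral_M_iterated(2)[OF i2]
      by (simp add: coeff_def)
    moreover have "L' / 2 * (LINT y|M. indicator {..<t} (fst y) * (on_M v y)\<^sup>2) \<le> L / 2 * (LINT y|M.
        indicator {..<t} (fst y) * (on_M v y)\<^sup>2)"
      by (intro mult_right_mono integral_nonneg_AE AE_I2) (simp_all add: L_def)
    ultimately show ?thesis
      by linarith
  qed
  moreover have "L > 0"
    using L' by (simp add: L_def)
  ultimately show ?thesis
    by blast
qed

end

section \<open>Energy estimate for the dual pairing\<close>

locale transport_problem = phase_domain +
  fixes S T :: "(real^3) \<times> real \<Rightarrow> real" and G :: "(real^3) \<times> real \<Rightarrow> (real^3)" and cS cT :: real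
  assumes S: "S \<in> W1inf (R \<times> {a<..<b})" and T: "T \<in> Linf (R \<times> {a<..<b})"
    and G: "\<And>i. (\<lambda>x. G x $ i) \<in> Linf (R \<times> {a<..<b})"
    and cS: "0 < cS" "AE x in restrict_space lborel (R \<times> {a<..<b}). cS \<le> S x"
    and cT: "0 < cT" "AE x in restrict_space lborel (R \<times> {a<..<b}). cT \<le> T x"
begin

lemma essentially_bounded_coefficients:
  "essentially_bounded (coeff S)" "essentially_bounded (coeff T)" "essentially_bounded (coeff G)"
proof -
  show "essentially_bounded (coeff S)" "essentially_bounded (coeff T)"
    using S T by (auto intro: essentially_bounded_coeff simp: W1inf_def)
  have "essentially_bounded (\<lambda>y. coeff G y $ i)" for i
    using essentially_bounded_coeff[OF G[of i]] by (simp add: coeff_def[abs_def])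
  then show "essentially_bounded (coeff G)"
    by (rule essentially_bounded_vec)
qed

text \<open>The pair \<open>(a, b)\<close> belonging to a test function and a field. It takes the
  derivatives as data and is linear in all arguments jointly.\<close>

definition dual_pair where
  "dual_pair v vt vr vs \<Phi> D y =
    (coeff S y * on_M vt y - on_M (\<lambda>p. fst (snd p) \<bullet> vr p) y
      - coeff G y \<bullet> on_M (\<lambda>p. cross3 (fst (snd p)) (vs p)) y + on_M (div_data D) y,
     coeff T y *\<^sub>R on_M vs y + on_M \<Phi> y)"

lemma continuous_on_data:
  assumes "C1_data v vt vr vs" "field_data \<Phi> D"
  shows "continuous_on K v" "continuous_on K vt" "continuous_on K vr" "continuous_on K vs" "continuous_on K \<Phi>"
    "continuous_on K (div_data D)" "continuous_on K (\<lambda>p. fst (snd p) \<bullet> vr p)"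
    "continuous_on K (\<lambda>p. cross3 (fst (snd p)) (vs p))"
  using assms continuous_div_data[OF assms(2)]
  by (auto simp: C1_data_def field_data_def intro!: continuous_intros continuous_on_cross)

lemma essentially_bounded_dual_pair:
  assumes "C1_data v vt vr vs" "field_data \<Phi> D"
  shows "essentially_bounded (\<lambda>y. fst (dual_pair v vt vr vs \<Phi> D y))"
    and "essentially_bounded (\<lambda>y. snd (dual_pair v vt vr vs \<Phi> D y))"
  unfolding dual_pair_def fst_conv snd_conv
  by (intro essentially_bounded_add essentially_bounded_diff essentially_bounded_mult
      essentially_bounded_inner
      essentially_bounded_scaleR essentially_bounded_coefficients essentially_bounded_on_M
          continuous_on_data[OF assms])+

lemma energy_inequality:
  "\<exists>L>0. \<forall>v vt vr vs \<Phi> D t. admissible_data v vt vr vs \<longrightarrow> field_data \<Phi> D \<longrightarrow> t \<in> {a<..<b} \<longrightarrow>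
    cS / 2 * (LINT x|phase R. (v (fst x, snd x, t))\<^sup>2) + cT * (LINT y|M. indicator {..<t} (fst y) * (norm
        (on_M vs y))\<^sup>2)
    \<le> L / 2 * (LINT y|M. indicator {..<t} (fst y) * (on_M v y)\<^sup>2)
      + (LINT y|M. indicator {..<t} (fst y) * (fst (dual_pair v vt vr vs \<Phi> D y) * on_M v y + snd
          (dual_pair v vt vr vs \<Phi> D y) \<bullet> on_M vs y))"
proof -
  obtain L where L: "0 < L" and stop: "\<And>v vt vr vs t. C1_data v vt vr vs \<Longrightarrow> (\<forall>r\<in>closure R. \<forall>s\<in>sphere 0 1. v
      (r, s, a) = 0) \<Longrightarrow> t \<in> {a<..<b} \<Longrightarrow>
    cS / 2 * (LINT x|phase R. (v (fst x, snd x, t))\<^sup>2) - L / 2 * (LINT y|M. indicator {..<t} (fst y) *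
        (on_M v y)\<^sup>2)
    \<le> (LINT y|M. indicator {..<t} (fst y) * (coeff S y * on_M vt y * on_M v y))"
    using energy_stopping_power[OF S cS] by blast
  have "cS / 2 * (LINT x|phase R. (v (fst x, snd x, t))\<^sup>2) + cT * (LINT y|M. indicator {..<t} (fst y) *
      (norm (on_M vs y))\<^sup>2)
    \<le> L / 2 * (LINT y|M. indicator {..<t} (fst y) * (on_M v y)\<^sup>2)
      + (LINT y|M. indicator {..<t} (fst y) * (fst (dual_pair v vt vr vs \<Phi> D y) * on_M v y + snd
          (dual_pair v vt vr vs \<Phi> D y) \<bullet> on_M vs y))"
    if v: "admissible_data v vt vr vs" and \<Phi>: "field_data \<Phi> D" and t: "t \<in> {a<..<b}" for v vt vr vs \<Phi> D t
  proof -
    have C1: "C1_data v vt vr vs"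
      using v by (simp add: admissible_data_def)
    note c = continuous_on_data[OF C1 \<Phi>]
    let ?\<chi> = "\<lambda>y. indicator {..<t} (fst y) :: real"
    let ?f1 = "\<lambda>y. ?\<chi> y * (coeff S y * on_M vt y * on_M v y)"
    let ?f2 = "\<lambda>y. ?\<chi> y * (on_M v y * on_M (\<lambda>p. fst (snd p) \<bullet> vr p) y)"
    let ?f3 = "\<lambda>y. ?\<chi> y * (on_M v y * (coeff G y \<bullet> on_M (\<lambda>p. cross3 (fst (snd p)) (vs p)) y))"
    let ?f4 = "\<lambda>y. ?\<chi> y * (on_M v y * on_M (div_data D) y + on_M vs y \<bullet> on_M \<Phi> y)"
    let ?f5 = "\<lambda>y. ?\<chi> y * (coeff T y * (on_M vs y \<bullet> on_M vs y))"
    have i: "integrable M ?f1" "integrable M ?f2" "integrable M ?f3" "integrable M ?f4" "integrable M ?f5"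
      by (intro essentially_bounded_integrable essentially_bounded_add essentially_bounded_mult
          essentially_bounded_inner
          essentially_bounded_indicator essentially_bounded_coefficients essentially_bounded_on_M c)+
    have "(LINT y|M. ?\<chi> y * (fst (dual_pair v vt vr vs \<Phi> D y) * on_M v y + snd (dual_pair v vt vr vs \<Phi> D
        y) \<bullet> on_M vs y)) =
        (LINT y|M. ?f1 y - ?f2 y - ?f3 y + ?f4 y + ?f5 y)"
      by (intro Bochner_Integration.integral_cong refl) (simp add: dual_pair_def inner_add_left
          inner_commute algebra_simps)
    also have "\<dots> = (LINT y|M. ?f1 y) - (LINT y|M. ?f2 y) - (LINT y|M. ?f3 y) + (LINT y|M. ?f4 y) + (LINT
        y|M. ?f5 y)"
      using i by simp
    finally have eq: "(LINT y|M. ?\<chi> y * (fst (dual_pair v vt vr vs \<Phi> D y) * on_M v y + snd (dual_pair v vt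
        vr vs \<Phi> D y) \<bullet> on_M vs y)) =
        (LINT y|M. ?f1 y) - (LINT y|M. ?f2 y) + (LINT y|M. ?f5 y)"
      using energy_cross_eq_0[OF C1 essentially_bounded_coefficients(3), of t] energy_divergence_eq_0[OF
          C1 \<Phi>, of t] by simp
    have "cT * (LINT y|M. ?\<chi> y * (norm (on_M vs y))\<^sup>2) = (LINT y|M. cT * (?\<chi> y * (on_M vs y \<bullet> on_M vs y)))"
      by (simp add: power2_norm_eq_inner)
    also have "\<dots> \<le> (LINT y|M. ?f5 y)"
    proof (rule integral_mono_AE)
      show "integrable M (\<lambda>y. cT * (?\<chi> y * (on_M vs y \<bullet> on_M vs y)))"
        by (intro essentially_bounded_integrable essentially_bounded_mult essentially_bounded_inner
            essentially_bounded_const essentially_bounded_indicator essentially_bounded_on_M c)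
      show "AE y in M. cT * (?\<chi> y * (on_M vs y \<bullet> on_M vs y)) \<le> ?f5 y"
        using AE_coefficient[OF cT(2)]
        by eventually_elim (auto simp: coeff_def indicator_def intro!: mult_right_mono)
    qed (rule i)
    finally show ?thesis
      using stop[OF C1 _ t] v energy_transport_le_0[OF v, of t] unfolding eq by (fastforce simp:
          admissible_data_def)
  qed
  with L show ?thesis
    by blast
qed

lemma phase_L2_norm_on_M: "L2_norm (phase R) (\<lambda>x. on_M v (e, x)) = sqrt (LINT x|phase R. (v (fst x, snd x,
    e))\<^sup>2)"
  by (simp add: L2_norm_def)

text \<open>Duality of L1 and L-infinity in energy, with values in L2 of phase space. It serves
  twice: for the first component of the dual pair in the energy estimate, and for the source term in
  the bound on the functional.\<close>

lemma L2_pairing_le: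
  assumes f: "f \<in> L2 M" and v: "continuous_on K v" and Z: "0 \<le> Z"
    and vZ: "\<And>e. e \<in> {a<..<b} \<Longrightarrow> sqrt (LINT x|phase R. (v (fst x, snd x, e))\<^sup>2) \<le> Z"
  shows "(LINT y|M. f y * on_M v y) \<le> Z * (LINT e|A. L2_norm (phase R) (\<lambda>x. f (e, x)))"
proof -
  have vL2: "on_M v \<in> L2 M"
    by (intro essentially_bounded_L2 essentially_bounded_on_M v)
  have i: "integrable M (\<lambda>y. f y * on_M v y)"
    using L2_inner_integrable[OF f vL2] by simp
  have nint: "integrable A (\<lambda>e. L2_norm (phase R) (\<lambda>x. f (e, x)))"
    by (intro A.L2_integrable(1) L2_prod_sections(2) finite_measures f)
  have "(LINT e|A. LINT x|phase R. f (e, x) * on_M v (e, x)) \<le> (LINT e|A. Z * L2_norm (phase R) (\<lambda>x. f (e,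
      x)))"
  proof (rule integral_mono_AE)
    show "AE e in A. (LINT x|phase R. f (e, x) * on_M v (e, x)) \<le> Z * L2_norm (phase R) (\<lambda>x. f (e, x))"
      using L2_prod_sections(1)[OF finite_measures(1,3) f] L2_prod_sections(1)[OF finite_measures(1,3)
          vL2] AE_space
    proof eventually_elim
      case (elim e)
      have "(LINT x|phase R. f (e, x) \<bullet> on_M v (e, x)) \<le> L2_norm (phase R) (\<lambda>x. f (e, x)) * L2_norm (phase
          R) (\<lambda>x. on_M v (e, x))"
        using L2_Cauchy_Schwarz[OF elim(1,2)] by linarith
      also have "\<dots> \<le> L2_norm (phase R) (\<lambda>x. f (e, x)) * Z"
        unfolding phase_L2_norm_on_M using elim(3) by (intro mult_left_mono L2_norm_nonneg vZ) (simp add: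
            space_A)
      finally show ?case
        by (simp add: mult.commute)
    qed
  qed (use nint integral_M_iterated(5)[OF i] in simp_all)
  then show ?thesis
    unfolding integral_M_iterated(1)[OF i] by simp
qed

text \<open>The absorption lemma is used with \<open>y\<close> the squared norm of \<open>v\<close>
  at a fixed energy, \<open>x\<close> the squared norm of the surface gradient up to that energy,
  and \<open>X\<close> its norm over all energies. The constant depends on \<open>L\<close>,
  \<open>cS\<close>, \<open>cT\<close> and the length of the energy interval, so it is uniform in
  \<open>v\<close> and \<open>\<Phi>\<close>.\<close>

lemma energy_estimate:
  "\<exists>C\<ge>0. \<forall>v vt vr vs \<Phi> D t. admissible_data v vt vr vs \<longrightarrow> field_data \<Phi> D \<longrightarrow> t \<in> {a<..<b} \<longrightarrow>
    sqrt (LINT x|phase R. (v (fst x, snd x, t))\<^sup>2) \<le>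
    C * ((LINT e|A. L2_norm (phase R) (\<lambda>x. fst (dual_pair v vt vr vs \<Phi> D (e, x)))) + L2_norm M (\<lambda>y. snd
        (dual_pair v vt vr vs \<Phi> D y)))"
proof -
  obtain L where L: "0 < L" and energy: "\<And>v vt vr vs \<Phi> D t. admissible_data v vt vr vs \<Longrightarrow> field_data \<Phi> D \<Longrightarrow>
      t \<in> {a<..<b} \<Longrightarrow>
    cS / 2 * (LINT x|phase R. (v (fst x, snd x, t))\<^sup>2) + cT * (LINT y|M. indicator {..<t} (fst y) * (norm
        (on_M vs y))\<^sup>2)
    \<le> L / 2 * (LINT y|M. indicator {..<t} (fst y) * (on_M v y)\<^sup>2)
      + (LINT y|M. indicator {..<t} (fst y) * (fst (dual_pair v vt vr vs \<Phi> D y) * on_M v y + snd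
          (dual_pair v vt vr vs \<Phi> D y) \<bullet> on_M vs y))"
    using energy_inequality by blast
  define K1 where "K1 = exp (2 * L / cS * (b - a)) * (4 / cS)"
  define C where "C = 2 * (K1 + (L / 2 * (b - a) * K1 + 1) / cT)"
  have C0: "0 \<le> C"
    using L cS cT a_less_b by (auto simp: C_def K1_def intro!: add_nonneg_nonneg mult_nonneg_nonneg
        divide_nonneg_nonneg)
  have "sqrt (LINT x|phase R. (v (fst x, snd x, t))\<^sup>2) \<le>
    C * ((LINT e|A. L2_norm (phase R) (\<lambda>x. fst (dual_pair v vt vr vs \<Phi> D (e, x)))) + L2_norm M (\<lambda>y. snd
        (dual_pair v vt vr vs \<Phi> D y)))"
    if v: "admissible_data v vt vr vs" and \<Phi>: "field_data \<Phi> D" and t: "t \<in> {a<..<b}" for v vt vr vs \<Phi> D t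
  proof -
    have C1: "C1_data v vt vr vs"
      using v by (simp add: admissible_data_def)
    note c = continuous_on_data[OF C1 \<Phi>]
    define h1 where "h1 y = fst (dual_pair v vt vr vs \<Phi> D y)" for y
    define h2 where "h2 y = snd (dual_pair v vt vr vs \<Phi> D y)" for y
    have eb: "essentially_bounded h1" "essentially_bounded h2"
      using essentially_bounded_dual_pair[OF C1 \<Phi>] by (simp_all add: h1_def[abs_def] h2_def[abs_def])
    note hL2 = eb[THEN essentially_bounded_L2]
    have vsL2: "on_M vs \<in> L2 M"
      by (intro essentially_bounded_L2 essentially_bounded_on_M c)
    define N1 where "N1 = (LINT e|A. L2_norm (phase R) (\<lambda>x. h1 (e, x)))"
    define N2 where "N2 = L2_norm M h2"
    define X where "X = L2_norm M (on_M vs)"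
    define y where "y e = (LINT x|phase R. (v (fst x, snd x, e))\<^sup>2)" for e
    define x where "x t = (LINT y|M. indicator {..<t} (fst y) * (norm (on_M vs y))\<^sup>2)" for t
    have N: "0 \<le> N1" "0 \<le> N2" "0 \<le> X"
      by (auto simp: N1_def N2_def X_def L2_norm_nonneg intro!: integral_nonneg_AE)
    have iv: "integrable M (\<lambda>y. (on_M v y)\<^sup>2)"
      unfolding power2_eq_square by (intro essentially_bounded_integrable essentially_bounded_mult
          essentially_bounded_on_M c)
    have ivs: "integrable M (\<lambda>y. (norm (on_M vs y))\<^sup>2)"
      using L2D(2)[OF vsL2] .
    have icv: "integrable M (\<lambda>y. indicator {..<t} (fst y) * (on_M v y)\<^sup>2)" for t
      unfolding power2_eq_square
      by (intro essentially_bounded_integrable essentially_bounded_mult essentially_bounded_indicator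
          essentially_bounded_on_M c)
    have icvs: "integrable M (\<lambda>y. indicator {..<t} (fst y) * (norm (on_M vs y))\<^sup>2)" for t
      unfolding power2_norm_eq_inner
      by (intro essentially_bounded_integrable essentially_bounded_mult essentially_bounded_inner
          essentially_bounded_indicator essentially_bounded_on_M c)
    obtain B where B: "\<forall>p\<in>K. norm (v p) \<le> B" "0 \<le> B"
      using bounded_on_K[OF c(1)] by blast
    have ybound: "y t \<le> B\<^sup>2 * measure (phase R) (space (phase R))" if t: "t \<in> {a<..<b}" for t
    proof -
      have "y t \<le> (LINT x|phase R. B\<^sup>2)"
        unfolding y_def
      proof (rule integral_mono)
        show "integrable (phase R) (\<lambda>x. (v (fst x, snd x, t))\<^sup>2)"
          using L2D(2)[OF phase_slice[OF c(1) t]] by (simp add: case_prod_beta')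
        show "(v (fst x, snd x, t))\<^sup>2 \<le> B\<^sup>2" if "x \<in> space (phase R)" for x
        proof -
          have "(fst x, snd x, t) \<in> K"
            using that t by (intro perm_K) (auto simp: space_M space_phase)
          then have "\<bar>v (fst x, snd x, t)\<bar> \<le> B"
            using B(1) by auto
          then have "\<bar>v (fst x, snd x, t)\<bar>\<^sup>2 \<le> B\<^sup>2"
            by (intro power_mono) auto
          then show ?thesis
            by simp
        qed
      qed simp
      then show ?thesis
        by (simp add: mult.commute)
    qed
    have "sqrt (y t) \<le> 2 * (exp (2 * L / cS * (b - a)) * (4 / cS) + (L / 2 * (b - a) * (exp (2 * L / cS *
        (b - a)) * (4 / cS)) + 1) / cT) * (N1 + N2)"
    proof (rule gronwall_absorption[where X = X and x = x, OF a_less_b cS(1) cT(1) L _ N(3) _ ybound])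
      show "y \<in> borel_measurable A"
        using integral_M_iterated(5)[OF iv] by (simp add: y_def[abs_def])
      show "0 \<le> y t" "0 \<le> x t" for t
        by (auto simp: y_def x_def intro!: integral_nonneg_AE)
      show "\<exists>t\<in>{a<..<b}. X\<^sup>2 - \<delta> \<le> x t" if \<delta>: "0 < \<delta>" for \<delta>
      proof -
        \<comment> \<open>Energies increasing to \<open>b\<close>; the denominator
          \<open>n + 2\<close> places the first one strictly inside the interval. Along them the
          truncated squared gradient norms tend to \<open>X^2\<close>.\<close>
        define \<tau> where "\<tau> n = b - (b - a) / real (n + 2)" for n
        have \<tau>: "\<tau> n \<in> {a<..<b}" for n
        proof -
          have "(b - a) / real (n + 2) < (b - a) / 1"
            using a_less_b by (intro divide_strict_left_mono) auto
          moreover have "0 < (b - a) / real (n + 2)"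
            using a_less_b by simp
          ultimately show ?thesis
            by (simp add: \<tau>_def)
        qed
        have "(\<lambda>n. (b - a) / real (n + 2)) \<longlonglongrightarrow> 0"
          using LIMSEQ_ignore_initial_segment[OF lim_const_over_n[of "b - a"], of 2] by simp
        then have \<tau>lim: "\<tau> \<longlonglongrightarrow> b - 0"
          unfolding \<tau>_def[abs_def] by (intro tendsto_intros)
        have "(\<lambda>n. x (\<tau> n)) \<longlonglongrightarrow> (LINT y|M. (norm (on_M vs y))\<^sup>2)"
          unfolding x_def
        proof (rule integral_dominated_convergence)
          show "AE y in M. norm (indicator {..<\<tau> n} (fst y) * (norm (on_M vs y))\<^sup>2) \<le> (norm (on_M vs
              y))\<^sup>2" for n
            by (intro AE_I2) (simp add: indicator_def)
          show "AE y in M. (\<lambda>n. indicator {..<\<tau> n} (fst y) * (norm (on_M vs y))\<^sup>2) \<longlonglongrightarrow> (norm (on_M vs y))\<^sup>2"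
          proof (intro AE_I2 tendsto_eventually)
            fix y assume "y \<in> space M"
            then have "fst y < b"
              by (auto simp: space_M)
            then have "eventually (\<lambda>n. fst y < \<tau> n) sequentially"
              using order_tendstoD(1)[OF \<tau>lim, of "fst y"] by simp
            then show "eventually (\<lambda>n. indicator {..<\<tau> n} (fst y) * (norm (on_M vs y))\<^sup>2 = (norm (on_M vs
                y))\<^sup>2) sequentially"
              by eventually_elim simp
          qed
        qed (use ivs icvs in auto)
        then have "(\<lambda>n. x (\<tau> n)) \<longlonglongrightarrow> X\<^sup>2"
          by (simp add: X_def L2_norm_power2)
        then have "eventually (\<lambda>n. X\<^sup>2 - \<delta> < x (\<tau> n)) sequentially"
          using \<delta> by (intro order_tendstoD(1)) auto
        then obtain n where "X\<^sup>2 - \<delta> < x (\<tau> n)"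
          using eventually_happens by force
        then show ?thesis
          using \<tau>[of n] by (intro bexI[of _ "\<tau> n"]) auto
      qed
      show "cS / 2 * y t + cT * x t \<le> L / 2 * (LINT e|A. indicator {..<t} e * y e) + (N1 + N2) * (Z + X)"
        if t: "t \<in> {a<..<b}" and Z: "0 \<le> Z" and yZ: "\<And>e. e \<in> {a<..<b} \<Longrightarrow> sqrt (y e) \<le> Z" for t Z
      proof -
        have e1: "(LINT y|M. indicator {..<t} (fst y) * (on_M v y)\<^sup>2) = (LINT e|A. indicator {..<t} e * y e)"
          unfolding integral_M_iterated(1)[OF icv] by (simp add: y_def)
        have c1: "(\<lambda>y. indicator {..<t} (fst y) * h1 y) \<in> L2 M" and c2: "(\<lambda>y. indicator {..<t} (fst y) *\<^sub>R
            h2 y) \<in> L2 M"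
          by (intro essentially_bounded_L2 essentially_bounded_mult essentially_bounded_scaleR
              essentially_bounded_indicator eb)+
        have i1: "integrable M (\<lambda>y. (indicator {..<t} (fst y) * h1 y) * on_M v y)"
          and i2: "integrable M (\<lambda>y. (indicator {..<t} (fst y) *\<^sub>R h2 y) \<bullet> on_M vs y)"
          by (intro essentially_bounded_integrable essentially_bounded_mult essentially_bounded_inner
              essentially_bounded_scaleR
              essentially_bounded_indicator essentially_bounded_on_M eb c)+
        have "(LINT y|M. (indicator {..<t} (fst y) * h1 y) * on_M v y) \<le>
            Z * (LINT e|A. L2_norm (phase R) (\<lambda>x. indicator {..<t} (fst (e, x)) * h1 (e, x)))"
          using yZ by (intro L2_pairing_le c1 c Z) (simp add: y_def)
        also have "\<dots> \<le> Z * N1"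
          unfolding N1_def
        proof (intro mult_left_mono Z integral_mono)
          show "integrable A (\<lambda>e. L2_norm (phase R) (\<lambda>x. indicator {..<t} (fst (e, x)) * h1 (e, x)))"
            by (intro A.L2_integrable(1) L2_prod_sections(2) finite_measures c1)
          show "integrable A (\<lambda>e. L2_norm (phase R) (\<lambda>x. h1 (e, x)))"
            by (intro A.L2_integrable(1) L2_prod_sections(2) finite_measures hL2)
          show "L2_norm (phase R) (\<lambda>x. indicator {..<t} (fst (e, x)) * h1 (e, x)) \<le> L2_norm (phase R) (\<lambda>x.
              h1 (e, x))" for e
            using L2_norm_scaleR[of "phase R" "indicator {..<t} e" "\<lambda>x. h1 (e, x)"] L2_norm_nonneg[of
                "phase R" "\<lambda>x. h1 (e, x)"]
            by (simp add: indicator_def split: if_splits)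
        qed
        finally have u1: "(LINT y|M. (indicator {..<t} (fst y) * h1 y) * on_M v y) \<le> Z * N1" .
        have n2: "L2_norm M (\<lambda>y. indicator {..<t} (fst y) *\<^sub>R h2 y) \<le> N2"
          unfolding N2_def L2_norm_def
          by (intro real_sqrt_le_mono integral_mono L2D(2) c2 hL2) (simp add: indicator_def)
        have "(LINT y|M. (indicator {..<t} (fst y) *\<^sub>R h2 y) \<bullet> on_M vs y) \<le> L2_norm M (\<lambda>y. indicator
            {..<t} (fst y) *\<^sub>R h2 y) * X"
          unfolding X_def using L2_Cauchy_Schwarz[OF c2 vsL2] by linarith
        also have "\<dots> \<le> N2 * X"
          by (intro mult_right_mono n2 N)
        finally have u2: "(LINT y|M. (indicator {..<t} (fst y) *\<^sub>R h2 y) \<bullet> on_M vs y) \<le> N2 * X" .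
        have "(LINT y|M. indicator {..<t} (fst y) * (h1 y * on_M v y + h2 y \<bullet> on_M vs y)) =
            (LINT y|M. (indicator {..<t} (fst y) * h1 y) * on_M v y + (indicator {..<t} (fst y) *\<^sub>R h2 y)
                \<bullet> on_M vs y)"
          by (intro Bochner_Integration.integral_cong refl) (simp add: algebra_simps)
        also have "\<dots> = (LINT y|M. (indicator {..<t} (fst y) * h1 y) * on_M v y) + (LINT y|M. (indicator
            {..<t} (fst y) *\<^sub>R h2 y) \<bullet> on_M vs y)"
          using i1 i2 by (rule Bochner_Integration.integral_add)
        also have "\<dots> \<le> Z * N1 + N2 * X"
          using u1 u2 by simp
        also have "\<dots> \<le> (N1 + N2) * (Z + X)"
          using N Z by (simp add: algebra_simps)
        finally show ?thesis
          using energy[OF v \<Phi> t] unfolding e1 x_def y_def h1_def h2_def by simp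
      qed
    qed (use N t in auto)
    then show ?thesis
      by (simp add: C_def K1_def N1_def N2_def h1_def h2_def[abs_def] y_def)
  qed
  with C0 show ?thesis
    by blast
qed

end

subsection \<open>The dual problem\<close>

lemma linear_functional_inner:
  fixes l :: "'a::euclidean_space \<Rightarrow> real"
  assumes "linear l"
  shows "l k = (\<Sum>i\<in>Basis. l i *\<^sub>R i) \<bullet> k"
proof -
  have "l k = l (\<Sum>i\<in>Basis. (k \<bullet> i) *\<^sub>R i)"
    by (simp add: euclidean_representation)
  also have "\<dots> = (\<Sum>i\<in>Basis. (k \<bullet> i) * l i)"
    by (simp add: linear_sum[OF assms] linear_cmul[OF assms])
  finally show ?thesis
    by (simp add: inner_sum_left inner_commute[of k] mult.commute)
qed

section \<open>Data of test functions and tangential fields\<close>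

context phase_domain
begin

text \<open>The partial derivatives are those of the radial extension along the coordinate
  embeddings. In the direction variable they are taken within the complement of the origin, an open
  set, hence in the full sense; the vanishing at exit points holds because these lie in
  \<open>Gamma_out R\<close>.\<close>

lemma admissible_has_data:
  assumes "v \<in> admissible R a b"
  shows "\<exists>vt vr vs. admissible_data v vt vr vs"
proof -
  let ?X = "closure R \<times> (- {0}) \<times> {a..b}"
  obtain f' where cf': "continuous_on ?X f'"
    and f': "\<And>p. p \<in> ?X \<Longrightarrow> (radial_ext v has_derivative blinfun_apply (f' p)) (at p within ?X)"
    using assms by (auto simp: admissible_def C1_on_def)
  have KX: "K \<subseteq> ?X"
    by (auto simp: K_def)
  define vt where "vt p = blinfun_apply (f' p) (0, 0, 1)" for p
  define vr where "vr p = (\<Sum>i\<in>Basis. blinfun_apply (f' p) (i, 0, 0) *\<^sub>R i)" for p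
  define vs where "vs p = (\<Sum>i\<in>Basis. blinfun_apply (f' p) (0, i, 0) *\<^sub>R i)" for p
  have cfK: "continuous_on K (\<lambda>p. blinfun_apply (f' p) k)" for k
    by (intro continuous_intros continuous_on_subset[OF cf' KX])
  have cont: "continuous_on K vt" "continuous_on K vr" "continuous_on K vs"
    unfolding vt_def[abs_def] vr_def[abs_def] vs_def[abs_def] by (intro continuous_intros cfK)+
  have "continuous_on K (radial_ext v)"
    by (rule continuous_on_subset[OF has_derivative_continuous_on[OF f'] KX])
  then have cv: "continuous_on K v"
    by (rule continuous_on_eq) (auto simp: K_def radial_ext_def)
  have der: "((\<lambda>e. v (r, s, e)) has_real_derivative vt (r, s, e)) (at e within {a..b})"
    "((\<lambda>x. v (x, s, e)) has_derivative (\<lambda>k. vr (r, s, e) \<bullet> k)) (at r within closure R)"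
    "((\<lambda>x. v (r, x /\<^sub>R norm x, e)) has_derivative (\<lambda>k. vs (r, s, e) \<bullet> k)) (at s)"
    if r: "r \<in> closure R" and s: "s \<in> sphere 0 1" and e: "e \<in> {a..b}" for r s e
  proof -
    have p: "(r, s, e) \<in> ?X"
      using r s e by auto
    note fp = f'[OF p]
    have lin: "linear (blinfun_apply (f' (r, s, e)))"
      by (rule has_derivative_linear[OF fp])
    have sub: "(radial_ext v has_derivative blinfun_apply (f' (r, s, e))) (at (r, s, e) within X)" if "X \<subseteq>
        ?X" for X
      by (rule has_derivative_subset[OF fp that])
    have "((\<lambda>e. (r, s, e)) has_derivative (\<lambda>k. (0, 0, k))) (at e within {a..b})"
      by (auto intro!: derivative_eq_intros)
    then have "((\<lambda>e. radial_ext v (r, s, e)) has_derivative (\<lambda>k. blinfun_apply (f' (r, s, e)) (0, 0, k)))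
        (at e within {a..b})"
      by (rule has_derivative_in_compose) (use r s e in \<open>auto intro!: sub\<close>)
    moreover have "(\<lambda>k. blinfun_apply (f' (r, s, e)) (0, 0, k)) = (*) (vt (r, s, e))"
    proof
      fix k
      have "(0, 0, k) = k *\<^sub>R (0 :: real^3, 0 :: real^3, 1 :: real)"
        by simp
      then show "blinfun_apply (f' (r, s, e)) (0, 0, k) = vt (r, s, e) * k"
        by (simp only: linear_cmul[OF lin] vt_def) simp
    qed
    ultimately show "((\<lambda>e. v (r, s, e)) has_real_derivative vt (r, s, e)) (at e within {a..b})"
      using s by (simp add: has_field_derivative_def radial_ext_def)
    have lr: "linear (\<lambda>k. blinfun_apply (f' (r, s, e)) (k, 0, 0))" and ls: "linear (\<lambda>k. blinfun_apply (f'
        (r, s, e)) (0, k, 0))"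
    proof -
      have "linear (\<lambda>k :: real^3. (k, 0 :: real^3, 0 :: real))" "linear (\<lambda>k :: real^3. (0 :: real^3, k, 0
          :: real))"
        by (auto intro!: linearI)
      then show "linear (\<lambda>k. blinfun_apply (f' (r, s, e)) (k, 0, 0))" "linear (\<lambda>k. blinfun_apply (f' (r,
          s, e)) (0, k, 0))"
        using linear_compose[OF _ lin] by (auto simp: o_def)
    qed
    have "((\<lambda>x. (x, s, e)) has_derivative (\<lambda>k. (k, 0, 0))) (at r within closure R)"
      by (auto intro!: derivative_eq_intros simp: zero_prod_def)
    then have "((\<lambda>x. radial_ext v (x, s, e)) has_derivative (\<lambda>k. blinfun_apply (f' (r, s, e)) (k, 0, 0)))
        (at r within closure R)"
      by (rule has_derivative_in_compose) (use r s e in \<open>auto intro!: sub\<close>)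
    moreover have "(\<lambda>k. blinfun_apply (f' (r, s, e)) (k, 0, 0)) = (\<lambda>k. vr (r, s, e) \<bullet> k)"
      unfolding vr_def by (intro ext linear_functional_inner lr)
    ultimately show "((\<lambda>x. v (x, s, e)) has_derivative (\<lambda>k. vr (r, s, e) \<bullet> k)) (at r within closure R)"
      using s by (simp add: radial_ext_def)
    have "((\<lambda>x. (r, x, e)) has_derivative (\<lambda>k. (0, k, 0))) (at s within - {0})"
      by (auto intro!: derivative_eq_intros simp: zero_prod_def)
    then have "((\<lambda>x. radial_ext v (r, x, e)) has_derivative (\<lambda>k. blinfun_apply (f' (r, s, e)) (0, k, 0)))
        (at s within - {0})"
      by (rule has_derivative_in_compose) (use r s e in \<open>auto intro!: sub\<close>)
    moreover have "at s within - {0} = at s"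
      using s by (intro at_within_open) auto
    moreover have "(\<lambda>k. blinfun_apply (f' (r, s, e)) (0, k, 0)) = (\<lambda>k. vs (r, s, e) \<bullet> k)"
      unfolding vs_def by (intro ext linear_functional_inner ls)
    ultimately show "((\<lambda>x. v (r, x /\<^sub>R norm x, e)) has_derivative (\<lambda>k. vs (r, s, e) \<bullet> k)) (at s)"
      by (simp add: radial_ext_def)
  qed
  have "admissible_data v vt vr vs"
    unfolding admissible_data_def C1_data_def
  proof (intro conjI ballI allI impI)
    show "v (r, s, a) = 0" if "r \<in> closure R" "s \<in> sphere 0 1" for r s
      using assms that by (auto simp: admissible_def)
    show "v (r, s, e) = 0" if "r \<in> frontier R" "s \<in> sphere 0 1" "0 < t" "r - t *\<^sub>R s \<in> R" "e \<in> {a<..<b}"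
        for r s t e
      using exit_point_in_Gamma_out[OF open_R that(1-4)] assms that(5) unfolding admissible_def by blast
  qed (use cv cont der in auto)
  then show ?thesis
    by blast
qed

text \<open>At interior points the derivatives within closed sets are full derivatives, so the
  operators of the weak formulation return the given data.\<close>

lemma C1_data_derivatives:
  assumes v: "C1_data v vt vr vs" and r: "r \<in> R" and s: "s \<in> sphere 0 1" and e: "e \<in> {a<..<b}"
  shows "deriv (\<lambda>e. v (r, s, e)) e = vt (r, s, e)"
    and "gradient (\<lambda>x. v (x, s, e)) r = vr (r, s, e)"
    and "surf_grad (\<lambda>s. v (r, s, e)) s = vs (r, s, e)"
proof -
  have r': "r \<in> closure R" and e': "e \<in> {a..b}"
    using r e closure_subset by auto
  have d: "((\<lambda>e. v (r, s, e)) has_real_derivative vt (r, s, e)) (at e within {a..b})"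
      "((\<lambda>x. v (x, s, e)) has_derivative (\<lambda>k. vr (r, s, e) \<bullet> k)) (at r within closure R)"
      "((\<lambda>x. v (r, x /\<^sub>R norm x, e)) has_derivative (\<lambda>k. vs (r, s, e) \<bullet> k)) (at s)"
    using v r' s e' by (auto simp: C1_data_def)
  have "e \<in> interior {a..b}"
    using e by simp
  from at_within_interior[OF this] d(1) have "((\<lambda>e. v (r, s, e)) has_real_derivative vt (r, s, e)) (at e)"
    by simp
  then show "deriv (\<lambda>e. v (r, s, e)) e = vt (r, s, e)"
    by (rule DERIV_imp_deriv)
  have "((\<lambda>x. v (x, s, e)) has_derivative (\<lambda>k. vr (r, s, e) \<bullet> k)) (at r within R)"
    using d(2) closure_subset by (rule has_derivative_subset)
  then show "gradient (\<lambda>x. v (x, s, e)) r = vr (r, s, e)"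
    unfolding at_within_open[OF r open_R] by (rule gradient_eqI)
  show "surf_grad (\<lambda>s. v (r, s, e)) s = vs (r, s, e)"
    unfolding surf_grad_def using d(3) by (rule gradient_eqI)
qed

lemma tangential_has_data:
  assumes "\<Phi> \<in> tangential_test_fields R {a<..<b}"
  shows "\<exists>D. field_data \<Phi> D"
proof -
  let ?U = "(UNIV :: (real^3) set) \<times> (- {0 :: real^3}) \<times> (UNIV :: real set)"
  have "Ck_on (Suc 0) ?U (radial_ext \<Phi>)"
    using assms by (simp add: tangential_test_fields_def smooth_on_def del: Ck_on.simps)
  then have "(\<forall>p\<in>?U. radial_ext \<Phi> differentiable (at p)) \<and>
      (\<forall>i\<in>Basis. continuous_on ?U (\<lambda>p. frechet_derivative (radial_ext \<Phi>) (at p) i))"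
    by (simp only: Ck_on.simps)
  then have d: "\<And>p. p \<in> ?U \<Longrightarrow> radial_ext \<Phi> differentiable (at p)"
    and c: "\<And>i. i \<in> Basis \<Longrightarrow> continuous_on ?U (\<lambda>p. frechet_derivative (radial_ext \<Phi>) (at p) i)"
    by blast+
  have KU: "K \<subseteq> ?U"
    by (auto simp: K_def)
  define D where "D p k = frechet_derivative (radial_ext \<Phi>) (at p) (0, k, 0)" for p k
  have "continuous_on ?U (radial_ext \<Phi>)"
    using d by (intro continuous_at_imp_continuous_on ballI differentiable_imp_continuous_within)
  from continuous_on_subset[OF this KU] have "continuous_on K \<Phi>"
    by (rule continuous_on_eq) (auto simp: K_def radial_ext_def)
  moreover have "continuous_on K (\<lambda>p. D p (axis i 1))" for i
    unfolding D_def by (intro continuous_on_subset[OF c KU]) (auto simp: Basis_prod_def Basis_vec_real)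
  moreover have "((\<lambda>x. \<Phi> (r, x /\<^sub>R norm x, e)) has_derivative D (r, s, e)) (at s)" if s: "s \<in> sphere 0 1"
      for r s e
  proof -
    have "(r, s, e) \<in> ?U"
      using s by auto
    from frechet_derivative_works[THEN iffD1, OF d[OF this]]
    have f: "(radial_ext \<Phi> has_derivative frechet_derivative (radial_ext \<Phi>) (at (r, s, e))) (at (r, s, e))" .
    have "((\<lambda>x. (r, x, e)) has_derivative (\<lambda>k. (0, k, 0))) (at s)"
      by (auto intro!: derivative_eq_intros)
    from has_derivative_compose[OF this f] show ?thesis
      by (simp add: radial_ext_def D_def[abs_def])
  qed
  ultimately have "field_data \<Phi> D"
    using assms by (auto simp: field_data_def tangential_test_fields_def)
  then show ?thesis
    by blast
qed

lemma admissible_data_lincomb: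
  assumes "admissible_data v vt vr vs" "admissible_data v' vt' vr' vs'"
  shows "admissible_data (\<lambda>p. c * v p + d * v' p) (\<lambda>p. c * vt p + d * vt' p)
    (\<lambda>p. c *\<^sub>R vr p + d *\<^sub>R vr' p) (\<lambda>p. c *\<^sub>R vs p + d *\<^sub>R vs' p)"
proof -
  have D: "((\<lambda>x. c * f x + d * g x) has_derivative (\<lambda>k. (c *\<^sub>R u + d *\<^sub>R w) \<bullet> k)) F"
    if "(f has_derivative (\<lambda>k. u \<bullet> k)) F" "(g has_derivative (\<lambda>k. w \<bullet> k)) F" for f g :: "real^3 \<Rightarrow> real"
        and u w F
    using that by (auto intro!: derivative_eq_intros simp: inner_add_left)
  have E: "((\<lambda>x. c * f x + d * g x) has_real_derivative c * u + d * w) (at z within Z)"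
    if "(f has_real_derivative u) (at z within Z)" "(g has_real_derivative w) (at z within Z)" for f g u w z Z
    by (intro DERIV_add DERIV_cmult that)
  have C: "C1_data v vt vr vs" "C1_data v' vt' vr' vs'"
    using assms by (auto simp: admissible_data_def)
  show ?thesis
    unfolding admissible_data_def C1_data_def
  proof (intro conjI ballI)
    show "continuous_on K (\<lambda>p. c * v p + d * v' p)" "continuous_on K (\<lambda>p. c * vt p + d * vt' p)"
      "continuous_on K (\<lambda>p. c *\<^sub>R vr p + d *\<^sub>R vr' p)" "continuous_on K (\<lambda>p. c *\<^sub>R vs p + d *\<^sub>R vs' p)"
      using C by (auto simp: C1_data_def intro!: continuous_intros)
  next
    fix r s :: "real^3" and e assume *: "r \<in> closure R" "s \<in> sphere 0 1" "e \<in> {a..b}"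
    show "((\<lambda>e. c * v (r, s, e) + d * v' (r, s, e)) has_real_derivative c * vt (r, s, e) + d * vt' (r, s,
        e)) (at e within {a..b})"
      using C * by (intro E) (auto simp: C1_data_def)
    show "((\<lambda>x. c * v (x, s, e) + d * v' (x, s, e)) has_derivative (\<lambda>k. (c *\<^sub>R vr (r, s, e) + d *\<^sub>R vr'
        (r, s, e)) \<bullet> k)) (at r within closure R)"
      using C * by (intro D) (auto simp: C1_data_def)
    show "((\<lambda>x. c * v (r, x /\<^sub>R norm x, e) + d * v' (r, x /\<^sub>R norm x, e)) has_derivative (\<lambda>k. (c *\<^sub>R vs
        (r, s, e) + d *\<^sub>R vs' (r, s, e)) \<bullet> k)) (at s)"
      using C * by (intro D) (auto simp: C1_data_def)
  qed (use assms in \<open>auto simp: admissible_data_def\<close>)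
qed

lemma field_data_lincomb:
  assumes "field_data \<Phi> D" "field_data \<Phi>' D'"
  shows "field_data (\<lambda>p. c *\<^sub>R \<Phi> p + d *\<^sub>R \<Phi>' p) (\<lambda>p k. c *\<^sub>R D p k + d *\<^sub>R D' p k)"
  unfolding field_data_def
proof (intro conjI ballI allI)
  fix r s :: "real^3" and e assume *: "r \<in> closure R" "s \<in> sphere 0 1" "e \<in> {a..b}"
  show "((\<lambda>x. c *\<^sub>R \<Phi> (r, x /\<^sub>R norm x, e) + d *\<^sub>R \<Phi>' (r, x /\<^sub>R norm x, e)) has_derivative (\<lambda>k. c *\<^sub>R D
      (r, s, e) k + d *\<^sub>R D' (r, s, e) k)) (at s)"
    using assms * by (intro has_derivative_add has_derivative_scaleR_right) (auto simp: field_data_def)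
  show "(c *\<^sub>R \<Phi> (r, s, e) + d *\<^sub>R \<Phi>' (r, s, e)) \<bullet> s = 0"
    using assms * by (simp add: field_data_def inner_add_left)
qed (use assms in \<open>auto simp: field_data_def intro!: continuous_intros\<close>)

lemma admissible_data_0: "admissible_data (\<lambda>_. 0) (\<lambda>_. 0) (\<lambda>_. 0) (\<lambda>_. 0)"
  by (simp add: admissible_data_def C1_data_def)

lemma field_data_0: "field_data (\<lambda>_. 0) (\<lambda>_ _. 0)"
  by (simp add: field_data_def)

end

section \<open>The functional on dual pairs and its representation\<close>

context transport_problem
begin

lemma dual_pair_lincomb:
  "dual_pair (\<lambda>p. c * v p + d * v' p) (\<lambda>p. c * vt p + d * vt' p) (\<lambda>p. c *\<^sub>R vr p + d *\<^sub>R vr' p) (\<lambda>p. c *\<^sub>R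
      vs p + d *\<^sub>R vs' p)
     (\<lambda>p. c *\<^sub>R \<Phi> p + d *\<^sub>R \<Phi>' p) (\<lambda>p k. c *\<^sub>R D p k + d *\<^sub>R D' p k) y =
   c *\<^sub>R dual_pair v vt vr vs \<Phi> D y + d *\<^sub>R dual_pair v' vt' vr' vs' \<Phi>' D' y"
  by (simp add: dual_pair_def on_M_def div_data_def inner_add_right cross_add_right cross_mult_right
      sum.distrib
      sum_distrib_left algebra_simps)

text \<open>The functional is a relation because one pair may come from several choices of
  \<open>v\<close> and \<open>\<Phi>\<close>; that the value is the same for all of them is a
  consequence of the Hahn-Banach theorem in its graph form.\<close>

definition test_graph where
  "test_graph Q = {(h, c). \<exists>v vt vr vs \<Phi> D. admissible_data v vt vr vs \<and> field_data \<Phi> D \<and>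
     h = dual_pair v vt vr vs \<Phi> D \<and> c = (LINT y|M. Q y * on_M v y)}"

lemma test_graphI:
  assumes "admissible_data v vt vr vs" "field_data \<Phi> D"
  shows "(dual_pair v vt vr vs \<Phi> D, LINT y|M. Q y * on_M v y) \<in> test_graph Q"
  unfolding test_graph_def using assms by blast

lemma subspace_test_graph:
  assumes Q: "Q \<in> L2 M"
  shows "subspace (test_graph Q)"
proof -
  have lin: "c *\<^sub>R x + d *\<^sub>R x' \<in> test_graph Q" if x: "x \<in> test_graph Q" and x': "x' \<in> test_graph Q" for c
      d x x'
  proof -
    obtain v vt vr vs \<Phi> D where v: "admissible_data v vt vr vs" "field_data \<Phi> D"
      "x = (dual_pair v vt vr vs \<Phi> D, LINT y|M. Q y * on_M v y)"
      using x by (auto simp: test_graph_def)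
    obtain v' vt' vr' vs' \<Phi>' D' where v': "admissible_data v' vt' vr' vs'" "field_data \<Phi>' D'"
      "x' = (dual_pair v' vt' vr' vs' \<Phi>' D', LINT y|M. Q y * on_M v' y)"
      using x' by (auto simp: test_graph_def)
    have i: "integrable M (\<lambda>y. Q y * on_M u y)" if "continuous_on K u" for u
      using L2_inner_integrable[OF Q essentially_bounded_L2[OF essentially_bounded_on_M[OF that]]] by simp
    have int: "integrable M (\<lambda>y. Q y * on_M v y)" "integrable M (\<lambda>y. Q y * on_M v' y)"
      using v v' by (auto intro!: i simp: admissible_data_def C1_data_def)
    have "(LINT y|M. Q y * on_M (\<lambda>p. c * v p + d * v' p) y) = (LINT y|M. c * (Q y * on_M v y) + d * (Q y *
        on_M v' y))"
      by (intro Bochner_Integration.integral_cong refl) (simp add: on_M_def algebra_simps)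
    also have "\<dots> = c * (LINT y|M. Q y * on_M v y) + d * (LINT y|M. Q y * on_M v' y)"
      using int by simp
    finally have c: "(LINT y|M. Q y * on_M (\<lambda>p. c * v p + d * v' p) y) = c * (LINT y|M. Q y * on_M v y) +
        d * (LINT y|M. Q y * on_M v' y)" .
    have eq: "c *\<^sub>R x + d *\<^sub>R x' = (dual_pair (\<lambda>p. c * v p + d * v' p) (\<lambda>p. c * vt p + d * vt' p) (\<lambda>p. c
        *\<^sub>R vr p + d *\<^sub>R vr' p) (\<lambda>p. c *\<^sub>R vs p + d *\<^sub>R vs' p)
     (\<lambda>p. c *\<^sub>R \<Phi> p + d *\<^sub>R \<Phi>' p) (\<lambda>p k. c *\<^sub>R D p k + d *\<^sub>R D' p k), LINT y|M. Q y * on_M (\<lambda>p. c * v p +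
         d * v' p) y)"
      unfolding v(3) v'(3) c by (simp add: dual_pair_lincomb plus_fun_def scaleR_fun_def fun_eq_iff)
    show ?thesis
      unfolding eq by (intro test_graphI admissible_data_lincomb field_data_lincomb v v')
  qed
  obtain x0 where x0: "x0 \<in> test_graph Q"
    using test_graphI[OF admissible_data_0 field_data_0] by blast
  show ?thesis
  proof (rule subspaceI)
    show "0 \<in> test_graph Q"
      using lin[OF x0 x0, of 0 0] by simp
    show "x + y \<in> test_graph Q" if "x \<in> test_graph Q" "y \<in> test_graph Q" for x y
      using lin[OF that, of 1 1] by simp
    show "c *\<^sub>R x \<in> test_graph Q" if "x \<in> test_graph Q" for c x
      using lin[OF that that, of c 0] by simp
  qed
qed

lemma test_graph_L2:
  assumes "(h, c) \<in> test_graph Q"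
  shows "h \<in> L2 M"
proof -
  obtain v vt vr vs \<Phi> D where v: "admissible_data v vt vr vs" "field_data \<Phi> D" and h: "h = dual_pair v vt
      vr vs \<Phi> D"
    using assms by (auto simp: test_graph_def)
  have eb: "essentially_bounded (\<lambda>y. fst (h y))" "essentially_bounded (\<lambda>y. snd (h y))"
    unfolding h using v by (intro essentially_bounded_dual_pair; simp add: admissible_data_def)+
  have "(\<lambda>y. (fst (h y), 0)) \<in> L2 M" "(\<lambda>y. (0, snd (h y))) \<in> L2 M"
    using eb[THEN essentially_bounded_L2]
    by (auto simp: L2_def norm_Pair borel_prod[symmetric] intro!: measurable_Pair)
  from L2_add[OF this] show ?thesis
    by simp
qed

text \<open>The pairing of \<open>Q\<close> with \<open>v\<close> is at most the L1-L2 norm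
  \<open>q\<close> of \<open>Q\<close> times the energy bound on \<open>v\<close>. The functional is
  thus dominated with the constant \<open>C * q\<close>, which then bounds \<open>\<psi>\<close> at
  almost every energy.\<close>

lemma dual_solution:
  assumes Q: "Q \<in> L2 M"
  shows "\<exists>\<psi> g. \<psi> \<in> L2 M \<and> g \<in> L2 M \<and> (\<exists>C. AE e in A. L2_norm (phase R) (\<lambda>x. \<psi> (e, x)) \<le> C) \<and>
    (\<forall>v vt vr vs \<Phi> D. admissible_data v vt vr vs \<longrightarrow> field_data \<Phi> D \<longrightarrow>
      (LINT y|M. Q y * on_M v y) = (LINT y|M. \<psi> y * fst (dual_pair v vt vr vs \<Phi> D y) + g y \<bullet> snd
          (dual_pair v vt vr vs \<Phi> D y)))"
proof -
  obtain C where C: "0 \<le> C" and est: "\<And>v vt vr vs \<Phi> D t. admissible_data v vt vr vs \<Longrightarrow> field_data \<Phi> D \<Longrightarrow> t \<in>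
      {a<..<b} \<Longrightarrow>
    sqrt (LINT x|phase R. (v (fst x, snd x, t))\<^sup>2) \<le>
    C * ((LINT e|A. L2_norm (phase R) (\<lambda>x. fst (dual_pair v vt vr vs \<Phi> D (e, x)))) + L2_norm M (\<lambda>y. snd
        (dual_pair v vt vr vs \<Phi> D y)))"
    using energy_estimate by blast
  define q where "q = (LINT e|A. L2_norm (phase R) (\<lambda>x. Q (e, x)))"
  have q: "0 \<le> q"
    by (auto simp: q_def L2_norm_nonneg intro!: integral_nonneg_AE)
  have "\<exists>\<psi> g. \<psi> \<in> L2 M \<and> g \<in> L2 M \<and> (AE e in A. L2_norm (phase R) (\<lambda>x. \<psi> (e, x)) \<le> C * q) \<and>
    (\<forall>(h, c)\<in>test_graph Q. c = (LINT y|M. \<psi> y * fst (h y) + g y \<bullet> snd (h y)))"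
  proof (rule L1_L2_dominated_representation[OF finite_measures(1,3) subspace_test_graph[OF Q]])
    show "fst ` test_graph Q \<subseteq> L2 M"
      using test_graph_L2 by auto
    fix h c assume "(h, c) \<in> test_graph Q"
    then obtain v vt vr vs \<Phi> D where v: "admissible_data v vt vr vs" "field_data \<Phi> D"
      and h: "h = dual_pair v vt vr vs \<Phi> D" and c: "c = (LINT y|M. Q y * on_M v y)"
      by (auto simp: test_graph_def)
    have "0 \<le> (LINT e|A. L2_norm (phase R) (\<lambda>x. fst (h (e, x))))"
      by (auto simp: L2_norm_nonneg intro!: integral_nonneg_AE)
    then have "c \<le> (C * ((LINT e|A. L2_norm (phase R) (\<lambda>x. fst (h (e, x)))) + L2_norm M (\<lambda>y. snd (h y)))) * q"
      unfolding c q_def using v est[OF v] C L2_norm_nonneg[of M "\<lambda>y. snd (h y)"]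
      by (intro L2_pairing_le Q) (auto simp: h admissible_data_def C1_data_def)
    then show "c \<le> C * q * ((LINT e|A. L2_norm (phase R) (\<lambda>x. fst (h (e, x)))) + L2_norm M (\<lambda>y. snd (h y)))"
      by (simp add: mult_ac)
  qed (use C q in simp)
  then obtain \<psi> g where \<psi>: "\<psi> \<in> L2 M" "g \<in> L2 M" "AE e in A. L2_norm (phase R) (\<lambda>x. \<psi> (e, x)) \<le> C * q"
    and rep: "\<forall>(h, c)\<in>test_graph Q. c = (LINT y|M. \<psi> y * fst (h y) + g y \<bullet> snd (h y))"
    by blast
  have "(LINT y|M. Q y * on_M v y) = (LINT y|M. \<psi> y * fst (dual_pair v vt vr vs \<Phi> D y) + g y \<bullet> snd
      (dual_pair v vt vr vs \<Phi> D y))"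
    if v: "admissible_data v vt vr vs" "field_data \<Phi> D" for v vt vr vs \<Phi> D
    using bspec[OF rep test_graphI[OF v]] by simp
  with \<psi> show ?thesis
    by blast
qed

end

text \<open>Joint measurability is part of \<open>L2_L2\<close>, so Tonelli's theorem gives
  integrability on the product from the iterated integral.\<close>

lemma L2_L2_case_prod:
  assumes A: "finite_measure A" and P: "finite_measure P" and u: "u \<in> L2_L2 A P"
  shows "case_prod u \<in> L2 (A \<Otimes>\<^sub>M P)"
proof (rule L2I)
  interpret A: finite_measure A by fact
  interpret P: finite_measure P by fact
  interpret AP: pair_sigma_finite A P ..
  show m: "case_prod u \<in> borel_measurable (A \<Otimes>\<^sub>M P)"
    using u by (simp add: L2_L2_def)
  show "integrable (A \<Otimes>\<^sub>M P) (\<lambda>y. (norm (case_prod u y))\<^sup>2)"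
  proof (rule AP.Fubini_integrable)
    show "(\<lambda>y. (norm (case_prod u y))\<^sup>2) \<in> borel_measurable (A \<Otimes>\<^sub>M P)"
      using m by measurable
    show "integrable A (\<lambda>e. LINT x|P. norm ((norm (case_prod u (e, x)))\<^sup>2))"
      using u by (simp add: L2_L2_def L2_norm_power2)
    show "AE e in A. integrable P (\<lambda>x. (norm (case_prod u (e, x)))\<^sup>2)"
      using u by (auto simp: L2_L2_def L2_def elim!: eventually_mono)
  qed
qed

section \<open>Construction of the weak solution\<close>

context transport_problem
begin

text \<open>The tangential projection of \<open>g\<close> is the surface gradient: projecting changes none of the
  pairings, since all the fields that \<open>g\<close> is tested with are tangential.\<close>

lemma tangential_projection:
  assumes g: "g \<in> L2 M"
  defines "gt y \<equiv> g y - (g y \<bullet> snd (snd y)) *\<^sub>R snd (snd y)"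
  shows "gt \<in> L2 M"
    and "y \<in> space M \<Longrightarrow> gt y \<bullet> snd (snd y) = 0"
    and "w \<bullet> snd (snd y) = 0 \<Longrightarrow> gt y \<bullet> w = g y \<bullet> w"
proof -
  have n: "norm (snd (snd y)) = 1" if "y \<in> space M" for y
    using that by (auto simp: space_M)
  show o: "gt y \<bullet> snd (snd y) = 0" if "y \<in> space M" for y
    using n[OF that] by (simp add: gt_def inner_diff_left norm_eq_1)
  show "gt y \<bullet> w = g y \<bullet> w" if "w \<bullet> snd (snd y) = 0"
    using that by (simp add: gt_def inner_diff_left inner_commute[of "snd (snd y)" w])
  have gm: "g \<in> borel_measurable M"
    using g by (rule L2D)
  have m: "gt \<in> borel_measurable M"
    unfolding gt_def[abs_def]
    by (intro borel_measurable_diff borel_measurable_scaleR borel_measurable_inner gm measurable_coordinates)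
  show "gt \<in> L2 M"
  proof (rule L2I[OF m])
    have "(norm (gt y))\<^sup>2 \<le> (norm (g y))\<^sup>2" if "y \<in> space M" for y
    proof -
      have "(norm (gt y))\<^sup>2 + (g y \<bullet> snd (snd y))\<^sup>2 = (norm (g y))\<^sup>2"
        using n[OF that] unfolding gt_def power2_norm_eq_inner
        by (simp add: inner_diff_left inner_diff_right inner_commute norm_eq_1 power2_eq_square)
      then show ?thesis
        by (metis le_add_same_cancel1 zero_le_power2)
    qed
    then have "AE y in M. norm ((norm (gt y))\<^sup>2) \<le> norm ((norm (g y))\<^sup>2)"
      by (intro AE_I2) simp
    then show "integrable M (\<lambda>y. (norm (gt y))\<^sup>2)"
      by (intro Bochner_Integration.integrable_bound[OF L2D(2)[OF g]] borel_measurable_power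
          measurable_compose[OF m borel_measurable_norm])
  qed
qed

text \<open>This translates the iterated integrals of the weak formulation into integrals over
  \<open>M\<close>: \<open>k\<close> stands for an expression with derivative operators,
  \<open>w\<close> for the essentially bounded data that it equals at the points of phase
  space.\<close>

lemma LINT_phase_inner:
  fixes f :: "real \<Rightarrow> (real^3) \<times> (real^3) \<Rightarrow> 'b::euclidean_space"
  assumes f: "case_prod f \<in> L2 M" and w: "essentially_bounded w"
    and eq: "\<And>e r s. e \<in> {a<..<b} \<Longrightarrow> r \<in> R \<Longrightarrow> s \<in> sphere 0 1 \<Longrightarrow> k e (r, s) = w (e, r, s)"
  shows "(LINT e|A. phase_inner R (f e) (k e)) = (LINT y|M. case_prod f y \<bullet> w y)"
    and "integrable A (\<lambda>e. phase_inner R (f e) (k e))"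
    and "integrable M (\<lambda>y. case_prod f y \<bullet> w y)"
proof -
  show i: "integrable M (\<lambda>y. case_prod f y \<bullet> w y)"
    by (intro L2_inner_integrable f essentially_bounded_L2 w)
  have *: "phase_inner R (f e) (k e) = (LINT x|phase R. case_prod f (e, x) \<bullet> w (e, x))" if "e \<in> space A" for e
    unfolding phase_inner_def using that eq
    by (intro Bochner_Integration.integral_cong) (auto simp: space_phase space_A)
  show "(LINT e|A. phase_inner R (f e) (k e)) = (LINT y|M. case_prod f y \<bullet> w y)"
    unfolding integral_M_iterated(1)[OF i] by (intro Bochner_Integration.integral_cong refl *)
  show "integrable A (\<lambda>e. phase_inner R (f e) (k e))"
    using integral_M_iterated(5)[OF i] by (subst Bochner_Integration.integrable_cong[OF refl *]) auto
qed

text \<open>The representation splits: \<open>v = 0\<close> with arbitrary \<open>\<Phi>\<close>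
  says that the second component is the weak surface gradient of \<open>\<psi>\<close>, and
  \<open>\<Phi> = 0\<close> with arbitrary \<open>v\<close> gives the weak equation.\<close>

lemma weak_solution_exists:
  assumes q: "q \<in> L2_L2 A (phase R)"
  shows "\<exists>\<psi>. weak_solution R a b T S G q \<psi>"
proof -
  have Q: "case_prod q \<in> L2 M"
    by (intro L2_L2_case_prod finite_measures q)
  obtain \<psi>0 g0 where \<psi>0: "\<psi>0 \<in> L2 M" and g0: "g0 \<in> L2 M" and bound: "\<exists>C. AE e in A. L2_norm (phase R) (\<lambda>x.
      \<psi>0 (e, x)) \<le> C"
    and rep: "\<And>v vt vr vs \<Phi> D. admissible_data v vt vr vs \<Longrightarrow> field_data \<Phi> D \<Longrightarrow>
      (LINT y|M. case_prod q y * on_M v y) = (LINT y|M. \<psi>0 y * fst (dual_pair v vt vr vs \<Phi> D y) + g0 y \<bullet>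
          snd (dual_pair v vt vr vs \<Phi> D y))"
    using dual_solution[OF Q] by blast
  define gt where "gt y = g0 y - (g0 y \<bullet> snd (snd y)) *\<^sub>R snd (snd y)" for y
  note gt = tangential_projection[OF g0, folded gt_def]
  define \<psi> where "\<psi> e x = \<psi>0 (e, x)" for e x
  define g where "g e x = gt (e, x)" for e x
  have c\<psi>: "case_prod \<psi> = \<psi>0" and cg: "case_prod g = gt"
    by (auto simp: \<psi>_def g_def)
  have "\<psi> \<in> Linf_L2 A (phase R)"
    using L2D(1)[OF \<psi>0] L2_prod_sections(1)[OF finite_measures(1,3) \<psi>0] bound
    unfolding Linf_L2_def by (simp add: c\<psi>) (simp add: \<psi>_def[abs_def])
  moreover have gL2: "g \<in> L2_L2 A (phase R)"
    using L2D(1)[OF gt(1)] L2_prod_sections(1)[OF finite_measures(1,3) gt(1)] L2D(2)[OF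
        L2_prod_sections(2)[OF finite_measures(1,3) gt(1)]]
    unfolding L2_L2_def by (simp add: cg) (simp add: g_def[abs_def])
  moreover have "weak_surf_grad R {a<..<b} \<psi> g"
    unfolding weak_surf_grad_def
  proof (intro conjI ballI)
    show "AE e in A. AE (r, s) in phase R. g e (r, s) \<bullet> s = 0"
      using gt(2) by (intro AE_I2) (auto simp: g_def space_M space_A space_phase)
    fix \<Phi> assume "\<Phi> \<in> tangential_test_fields R {a<..<b}"
    then obtain D where D: "field_data \<Phi> D"
      using tangential_has_data by blast
    have c: "continuous_on K \<Phi>" "continuous_on K (div_data D)"
      using D continuous_div_data by (auto simp: field_data_def)
    note p1 = LINT_phase_inner[of \<psi> "on_M (div_data D)" "\<lambda>e (r, s). surf_div (\<lambda>s'. \<Phi> (r, s', e)) s"]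
    note p2 = LINT_phase_inner[of g "on_M \<Phi>" "\<lambda>e (r, s). \<Phi> (r, s, e)"]
    have 1: "(LINT e|A. phase_inner R (\<psi> e) (\<lambda>(r, s). surf_div (\<lambda>s'. \<Phi> (r, s', e)) s)) = (LINT y|M. \<psi>0 y *
        on_M (div_data D) y)"
      "integrable M (\<lambda>y. \<psi>0 y * on_M (div_data D) y)"
      using p1(1,3) \<psi>0 surf_div_field_data[OF D] closure_subset[of R] c
      by (auto simp: c\<psi> subset_iff intro: essentially_bounded_on_M)
    have 2: "(LINT e|A. phase_inner R (g e) (\<lambda>(r, s). \<Phi> (r, s, e))) = (LINT y|M. gt y \<bullet> on_M \<Phi> y)"
      "integrable M (\<lambda>y. gt y \<bullet> on_M \<Phi> y)"
      using p2(1,3) gt(1) c by (auto simp: cg intro: essentially_bounded_on_M)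
    have "0 = (LINT y|M. \<psi>0 y * on_M (div_data D) y + g0 y \<bullet> on_M \<Phi> y)"
      using rep[OF admissible_data_0 D] by (simp add: dual_pair_def on_M_def)
    also have "\<dots> = (LINT y|M. \<psi>0 y * on_M (div_data D) y + gt y \<bullet> on_M \<Phi> y)"
    proof (intro Bochner_Integration.integral_cong refl)
      fix y assume y: "y \<in> space M"
      then have "on_M \<Phi> y \<bullet> snd (snd y) = 0"
        using D closure_subset[of R] by (cases y) (auto simp: field_data_def space_M subset_iff)
      then show "\<psi>0 y * on_M (div_data D) y + g0 y \<bullet> on_M \<Phi> y = \<psi>0 y * on_M (div_data D) y + gt y \<bullet> on_M \<Phi> y"
        using gt(3) by simp
    qed
    also have "\<dots> = (LINT y|M. \<psi>0 y * on_M (div_data D) y) + (LINT y|M. gt y \<bullet> on_M \<Phi> y)"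
      using 1(2) 2(2) by (rule Bochner_Integration.integral_add)
    finally show "(LINT e|A. phase_inner R (\<psi> e) (\<lambda>(r, s). surf_div (\<lambda>s'. \<Phi> (r, s', e)) s)) =
        - (LINT e|A. phase_inner R (g e) (\<lambda>(r, s). \<Phi> (r, s, e)))"
      unfolding 1(1) 2(1) by simp
  qed
  moreover have "(LINT e|A.
        phase_inner R (\<psi> e) (\<lambda>(r, s). S (r, e) * deriv (\<lambda>e. v (r, s, e)) e)
      - phase_inner R (\<psi> e) (\<lambda>(r, s). s \<bullet> gradient (\<lambda>x. v (x, s, e)) r)
      - phase_inner R (\<psi> e) (\<lambda>(r, s). G (r, e) \<bullet> cross3 s (surf_grad (\<lambda>s'. v (r, s', e)) s))
      + phase_inner R (\<lambda>(r, s). T (r, e) *\<^sub>R g e (r, s)) (\<lambda>(r, s). surf_grad (\<lambda>s'. v (r, s', e)) s))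
    = (LINT e|A. phase_inner R (q e) (\<lambda>(r, s). v (r, s, e)))" if v_adm: "v \<in> admissible R a b" for v
  proof -
    obtain vt vr vs where v: "admissible_data v vt vr vs"
      using admissible_has_data[OF v_adm] by blast
    have C1: "C1_data v vt vr vs"
      using v by (simp add: admissible_data_def)
    note c = continuous_on_data[OF C1 field_data_0]
    note d = C1_data_derivatives[OF C1]
    have eb1: "essentially_bounded (\<lambda>y. coeff S y * on_M vt y)"
      and eb3: "essentially_bounded (\<lambda>y. coeff G y \<bullet> on_M (\<lambda>p. cross3 (fst (snd p)) (vs p)) y)"
      and eb4: "essentially_bounded (\<lambda>y. coeff T y *\<^sub>R on_M vs y)"
      by (intro essentially_bounded_mult essentially_bounded_inner essentially_bounded_scaleR
          essentially_bounded_coefficients essentially_bounded_on_M c)+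
    have \<psi>': "case_prod \<psi> \<in> L2 M" and g': "case_prod g \<in> L2 M"
      using \<psi>0 gt(1) by (simp_all add: c\<psi> cg)
    define k1 where "k1 = (\<lambda>e (r, s). S (r, e) * deriv (\<lambda>e. v (r, s, e)) e)"
    define k2 where "k2 = (\<lambda>e (r, s). s \<bullet> gradient (\<lambda>x. v (x, s, e)) r)"
    define k3 where "k3 = (\<lambda>e (r, s). G (r, e) \<bullet> cross3 s (surf_grad (\<lambda>s'. v (r, s', e)) s))"
    define k4 where "k4 = (\<lambda>e (r, s). T (r, e) *\<^sub>R surf_grad (\<lambda>s'. v (r, s', e)) s)"
    define k5 where "k5 = (\<lambda>e (r, s). v (r, s, e))"
    have e1: "\<And>e r s. e \<in> {a<..<b} \<Longrightarrow> r \<in> R \<Longrightarrow> s \<in> sphere 0 1 \<Longrightarrow> k1 e (r, s) = coeff S (e, r, s) * on_M vt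
        (e, r, s)"
      and e2: "\<And>e r s. e \<in> {a<..<b} \<Longrightarrow> r \<in> R \<Longrightarrow> s \<in> sphere 0 1 \<Longrightarrow> k2 e (r, s) = on_M (\<lambda>p. fst (snd p) \<bullet> vr p)
          (e, r, s)"
      and e3: "\<And>e r s. e \<in> {a<..<b} \<Longrightarrow> r \<in> R \<Longrightarrow> s \<in> sphere 0 1 \<Longrightarrow> k3 e (r, s) = coeff G (e, r, s) \<bullet> on_M (\<lambda>p.
          cross3 (fst (snd p)) (vs p)) (e, r, s)"
      and e4: "\<And>e r s. e \<in> {a<..<b} \<Longrightarrow> r \<in> R \<Longrightarrow> s \<in> sphere 0 1 \<Longrightarrow> k4 e (r, s) = coeff T (e, r, s) *\<^sub>R on_M vs
          (e, r, s)"
      and e5: "\<And>e r s. e \<in> {a<..<b} \<Longrightarrow> r \<in> R \<Longrightarrow> s \<in> sphere 0 1 \<Longrightarrow> k5 e (r, s) = on_M v (e, r, s)"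
      using d by (simp_all add: k1_def k2_def k3_def k4_def k5_def)
    have p1: "(LINT e|A. phase_inner R (\<psi> e) (k1 e)) = (LINT y|M. \<psi>0 y * (coeff S y * on_M vt y))"
        "integrable A (\<lambda>e. phase_inner R (\<psi> e) (k1 e))" "integrable M (\<lambda>y. \<psi>0 y * (coeff S y * on_M vt y))"
      using LINT_phase_inner[of \<psi> _ k1, OF \<psi>' eb1] e1 by (simp_all add: c\<psi>)
    have p2: "(LINT e|A. phase_inner R (\<psi> e) (k2 e)) = (LINT y|M. \<psi>0 y * on_M (\<lambda>p. fst (snd p) \<bullet> vr p) y)"
        "integrable A (\<lambda>e. phase_inner R (\<psi> e) (k2 e))" "integrable M (\<lambda>y. \<psi>0 y * on_M (\<lambda>p. fst (snd p) \<bullet>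
            vr p) y)"
      using LINT_phase_inner[of \<psi> _ k2, OF \<psi>' essentially_bounded_on_M[OF c(7)]] e2 by (simp_all add: c\<psi>)
    have p3: "(LINT e|A. phase_inner R (\<psi> e) (k3 e)) = (LINT y|M. \<psi>0 y * (coeff G y \<bullet> on_M (\<lambda>p. cross3
        (fst (snd p)) (vs p)) y))"
        "integrable A (\<lambda>e. phase_inner R (\<psi> e) (k3 e))" "integrable M (\<lambda>y. \<psi>0 y * (coeff G y \<bullet> on_M (\<lambda>p.
            cross3 (fst (snd p)) (vs p)) y))"
      using LINT_phase_inner[of \<psi> _ k3, OF \<psi>' eb3] e3 by (simp_all add: c\<psi>)
    have p4: "(LINT e|A. phase_inner R (g e) (k4 e)) = (LINT y|M. gt y \<bullet> (coeff T y *\<^sub>R on_M vs y))"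
        "integrable A (\<lambda>e. phase_inner R (g e) (k4 e))" "integrable M (\<lambda>y. gt y \<bullet> (coeff T y *\<^sub>R on_M vs y))"
      using LINT_phase_inner[of g _ k4, OF g' eb4] e4 by (simp_all only: cg)
    have p5: "(LINT e|A. phase_inner R (q e) (k5 e)) = (LINT y|M. case_prod q y * on_M v y)"
      using LINT_phase_inner(1)[of q _ k5, OF Q essentially_bounded_on_M[OF c(1)]] e5 by simp
    have swap: "phase_inner R (\<lambda>(r, s). T (r, e) *\<^sub>R g e (r, s)) (\<lambda>(r, s). surf_grad (\<lambda>s'. v (r, s', e))
        s) = phase_inner R (g e) (k4 e)" for e
      unfolding phase_inner_def by (intro Bochner_Integration.integral_cong refl) (auto simp: k4_def
          case_prod_beta')
    have "(LINT e|A. phase_inner R (\<psi> e) (k1 e) - phase_inner R (\<psi> e) (k2 e) - phase_inner R (\<psi> e) (k3 e)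
        + phase_inner R (g e) (k4 e)) =
        (LINT e|A. phase_inner R (\<psi> e) (k1 e)) - (LINT e|A. phase_inner R (\<psi> e) (k2 e)) - (LINT e|A.
            phase_inner R (\<psi> e) (k3 e)) + (LINT e|A. phase_inner R (g e) (k4 e))"
      by (intro trans[OF Bochner_Integration.integral_add] arg_cong2[where f = "(+)"] trans[OF
          Bochner_Integration.integral_diff]
          arg_cong2[where f = "(-)"] Bochner_Integration.integrable_diff p1(2) p2(2) p3(2) p4(2) refl)
    also have "\<dots> = (LINT y|M. \<psi>0 y * (coeff S y * on_M vt y)) - (LINT y|M. \<psi>0 y * on_M (\<lambda>p. fst (snd p) \<bullet>
        vr p) y)
        - (LINT y|M. \<psi>0 y * (coeff G y \<bullet> on_M (\<lambda>p. cross3 (fst (snd p)) (vs p)) y)) + (LINT y|M. gt y \<bullet>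
            (coeff T y *\<^sub>R on_M vs y))"
      unfolding p1(1) p2(1) p3(1) p4(1) ..
    also have "\<dots> = (LINT y|M. \<psi>0 y * (coeff S y * on_M vt y) - \<psi>0 y * on_M (\<lambda>p. fst (snd p) \<bullet> vr p) y
        - \<psi>0 y * (coeff G y \<bullet> on_M (\<lambda>p. cross3 (fst (snd p)) (vs p)) y) + gt y \<bullet> (coeff T y *\<^sub>R on_M vs y))"
      by (intro sym[OF trans[OF Bochner_Integration.integral_add]] arg_cong2[where f = "(+)"] trans[OF
          Bochner_Integration.integral_diff]
          arg_cong2[where f = "(-)"] Bochner_Integration.integrable_diff p1(3) p2(3) p3(3) p4(3) refl)
    also have "\<dots> = (LINT y|M. \<psi>0 y * fst (dual_pair v vt vr vs (\<lambda>_. 0) (\<lambda>_ _. 0) y) + g0 y \<bullet> snd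
        (dual_pair v vt vr vs (\<lambda>_. 0) (\<lambda>_ _. 0) y))"
    proof (intro Bochner_Integration.integral_cong refl)
      fix y assume y: "y \<in> space M"
      obtain e r s where es: "y = (e, r, s)"
        by (cases y)
      have rs: "r \<in> closure R" "s \<in> sphere 0 1" "e \<in> {a..b}"
        using y closure_subset[of R] by (auto simp: es space_M)
      have dv: "((\<lambda>x. v (r, x /\<^sub>R norm x, e)) has_derivative (\<lambda>k. vs (r, s, e) \<bullet> k)) (at s)"
        using C1 rs by (auto simp: C1_data_def)
      \<comment> \<open>Surface gradients are tangential, so \<open>g0\<close> may be exchanged for
        its tangential part \<open>gt\<close> in the diffusion term.\<close>
      have "vs (r, s, e) \<bullet> s = 0"
        using radially_constant_derivative_eq_0[of s "\<lambda>x. v (r, x, e)", OF _ dv] rs by simp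
      then have "gt y \<bullet> (coeff T y *\<^sub>R on_M vs y) = g0 y \<bullet> (coeff T y *\<^sub>R on_M vs y)"
        by (intro gt(3)) (simp add: es)
      then show "\<psi>0 y * (coeff S y * on_M vt y) - \<psi>0 y * on_M (\<lambda>p. fst (snd p) \<bullet> vr p) y
          - \<psi>0 y * (coeff G y \<bullet> on_M (\<lambda>p. cross3 (fst (snd p)) (vs p)) y) + gt y \<bullet> (coeff T y *\<^sub>R on_M vs y) =
        \<psi>0 y * fst (dual_pair v vt vr vs (\<lambda>_. 0) (\<lambda>_ _. 0) y) + g0 y \<bullet> snd (dual_pair v vt vr vs (\<lambda>_. 0)
            (\<lambda>_ _. 0) y)"
        by (simp add: dual_pair_def div_data_def on_M_def algebra_simps)
    qed
    also have "\<dots> = (LINT y|M. case_prod q y * on_M v y)"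
      by (rule rep[OF v field_data_0, symmetric])
    also have "\<dots> = (LINT e|A. phase_inner R (q e) (k5 e))"
      by (rule p5[symmetric])
    finally show ?thesis
      unfolding swap unfolding k1_def k2_def k3_def k5_def .
  qed
  ultimately show ?thesis
    unfolding weak_solution_def by (intro exI[of _ \<psi>] conjI bexI[of _ g] ballI)
qed

end

theorem theorem1:
  fixes R :: "(real^3) set" and \<epsilon>min \<epsilon>max cS cT :: real
    and T S :: "(real^3) \<times> real \<Rightarrow> real" and G :: "(real^3) \<times> real \<Rightarrow> (real^3)"
    and q :: "real \<Rightarrow> (real^3) \<times> (real^3) \<Rightarrow> real"
  assumes "rho_convex R"
    and "\<epsilon>min < \<epsilon>max"
    and "T \<in> W1inf (R \<times> {\<epsilon>min<..<\<epsilon>max})"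
    and "S \<in> W1inf (R \<times> {\<epsilon>min<..<\<epsilon>max})"
    and "\<And>i. (\<lambda>x. G x $ i) \<in> W1inf (R \<times> {\<epsilon>min<..<\<epsilon>max})"
    and "0 < cS" and "AE x in restrict_space lborel (R \<times> {\<epsilon>min<..<\<epsilon>max}). cS \<le> S x"
    and "0 < cT" and "AE x in restrict_space lborel (R \<times> {\<epsilon>min<..<\<epsilon>max}). cT \<le> T x"
    and "q \<in> L2_L2 (restrict_space lborel {\<epsilon>min<..<\<epsilon>max}) (phase R)"
  shows "\<exists>\<psi>. weak_solution R \<epsilon>min \<epsilon>max T S G q \<psi>"
proof -
  interpret transport_problem R \<epsilon>min \<epsilon>max S T G cS cT
    using rho_convexD[OF assms(1)] assms(2-9) by unfold_locales (auto simp: W1inf_def)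
  show ?thesis
    using assms(10) by (rule weak_solution_exists)
qed

end
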